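(* Let $\Sigma\subseteq\mathbb{R}^n$ be an arbitrary simply connected harmonic surface with rectifiable boundary $\Gamma$. Then $$\operatorname{diam}(\Sigma)\le\frac12|\Gamma| .$$ The constant $1/2$ is the best possible even for minimal surfaces lying over the unit disk; that is, for every $c<\frac12$ there is a minimal surface $\Sigma\subset\mathbb{R}^3$ that is a graph over the unit disk and is a simply connected harmonic surface with rectifiable boundary $\Gamma$, for which $\operatorname{diam}(\Sigma)>c|\Gamma|$.
   Context: $\mathbb{U}=\{z\in\mathbb{C}:|z|<1\}$ is the unit disk and $\mathbb{T}$ is the unit circle. A Jordan surface in $\mathbb{R}^n$ is the image $\Phi(\overline{\mathbb{U}})$ of the closed unit disk under a homeomorphism $\Phi$ onto its image; its boundary is the Jordan curve $\Gamma=\Phi(\mathbb{T})$, and $|\Gamma|$ is its length. It is called a simply connected harmonic surface if there is a homeomorphism $\tau$ of $\mathbb{U}$ onto $\Phi(\mathbb{U})$ (the surface without its boundary curve) with harmonic coordinate functions; $\tau$ need not extend continuously to $\overline{\mathbb{U}}$ and its Jacobian may vanish at some points. In the definition of distance and diameter, $\Sigma$ denotes the open surface $\tau(\mathbb{U})=\Phi(\mathbb{U})$. For $P,Q\in\Sigma$ the intrinsic distance is $d_I(P,Q)=\inf_{c\in\mathfrak{C}}|c|$, where $\mathfrak{C}$ is the set of all Jordan arcs $c$ in $\Sigma$ connecting $P$ and $Q$ and $|c|$ is the length of $c$ (with $d_I(P,P)=0$). The (geodesic) diameter is $\operatorname{diam}(\Sigma)=\sup_{P,Q\in\Sigma}d_I(P,Q)$.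 *)

theory Defs
  imports "HOL-Analysis.Analysis"
begin

section \<open>Length of curves and intrinsic geometry of subsets\<close>

text \<open>Length as the supremum over inscribed polygons. A partition of the unit interval is
  given by the first \<open>n + 1\<close> terms of a monotone sequence with values in the interval; values
  are extended reals, so that nonrectifiable curves have length \<open>\<infinity>\<close>.\<close>

definition path_length :: "(real \<Rightarrow> 'a::metric_space) \<Rightarrow> ereal" where
  "path_length g =
     (SUP (n, t) \<in> UNIV \<times> {t :: nat \<Rightarrow> real. mono t \<and> range t \<subseteq> {0..1}}.
        ereal (\<Sum>i<n. dist (g (t i)) (g (t (Suc i)))))"

definition rectifiable :: "(real \<Rightarrow> 'a::metric_space) \<Rightarrow> bool" where
  "rectifiable g \<longleftrightarrow> path_length g < \<infinity>"

text \<open>The library's \<^const>\<open>arc\<close> is an injective path, so it cannot join a point to itself; the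
  case \<open>P = Q\<close> is therefore set separately.\<close>

definition intrinsic_dist :: "'a::metric_space set \<Rightarrow> 'a \<Rightarrow> 'a \<Rightarrow> ereal" where
  "intrinsic_dist S P Q =
     (if P = Q then 0
      else (INF c \<in> {c. arc c \<and> path_image c \<subseteq> S \<and> pathstart c = P \<and> pathfinish c = Q}.
              path_length c))"

definition geodesic_diameter :: "'a::metric_space set \<Rightarrow> ereal" where
  "geodesic_diameter S = (SUP P\<in>S. SUP Q\<in>S. intrinsic_dist S P Q)"

section \<open>Functions of class \<open>C\<^sup>2\<close> in the plane and harmonic functions\<close>

text \<open>The plane is identified with \<^typ>\<open>complex\<close>; derivatives are real.\<close>

definition partial_x :: "(complex \<Rightarrow> 'a::real_normed_vector) \<Rightarrow> complex \<Rightarrow> 'a" where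
  "partial_x F z = vector_derivative (\<lambda>t. F (z + of_real t)) (at 0)"

definition partial_y :: "(complex \<Rightarrow> 'a::real_normed_vector) \<Rightarrow> complex \<Rightarrow> 'a" where
  "partial_y F z = vector_derivative (\<lambda>t. F (z + \<i> * of_real t)) (at 0)"

definition C1_on :: "(complex \<Rightarrow> 'a::real_normed_vector) \<Rightarrow> complex set \<Rightarrow> bool" where
  "C1_on F S \<longleftrightarrow>
     open S \<and> F differentiable_on S \<and> continuous_on S (partial_x F) \<and> continuous_on S (partial_y F)"

definition C2_on :: "(complex \<Rightarrow> 'a::real_normed_vector) \<Rightarrow> complex set \<Rightarrow> bool" where
  "C2_on F S \<longleftrightarrow> C1_on F S \<and> C1_on (partial_x F) S \<and> C1_on (partial_y F) S"

definition harmonic_on :: "(complex \<Rightarrow> real) \<Rightarrow> complex set \<Rightarrow> bool" where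
  "harmonic_on u S \<longleftrightarrow>
     C2_on u S \<and> (\<forall>z\<in>S. partial_x (partial_x u) z + partial_y (partial_y u) z = 0)"

section \<open>Jordan surfaces and harmonic surfaces\<close>

definition jordan_surface :: "(complex \<Rightarrow> 'a::topological_space) \<Rightarrow> bool" where
  "jordan_surface \<Phi> \<longleftrightarrow> (\<exists>\<Psi>. homeomorphism (cball 0 1) (\<Phi> ` cball 0 1) \<Phi> \<Psi>)"

text \<open>The open surface (without its boundary curve), and the boundary Jordan curve
  parametrized as a simple closed path.\<close>

definition open_surface :: "(complex \<Rightarrow> 'a) \<Rightarrow> 'a set" where
  "open_surface \<Phi> = \<Phi> ` ball 0 1"

definition boundary_curve :: "(complex \<Rightarrow> 'a) \<Rightarrow> real \<Rightarrow> 'a" where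
  "boundary_curve \<Phi> = (\<lambda>t. \<Phi> (cis (2 * pi * t)))"

text \<open>The harmonic parametrization \<open>\<tau>\<close> is unrelated to \<open>\<Phi>\<close> apart from having the same image
  of the open disk; it need not extend continuously to the closed disk.\<close>

definition simply_connected_harmonic_surface :: "(complex \<Rightarrow> real ^ 'n) \<Rightarrow> bool" where
  "simply_connected_harmonic_surface \<Phi> \<longleftrightarrow>
     jordan_surface \<Phi> \<and>
     (\<exists>\<tau> \<sigma>. homeomorphism (ball 0 1) (open_surface \<Phi>) \<tau> \<sigma> \<and>
            (\<forall>i. harmonic_on (\<lambda>z. \<tau> z $ i) (ball 0 1)))"

section \<open>Minimal surfaces in three-space\<close>

definition unit_normal :: "(complex \<Rightarrow> real ^ 3) \<Rightarrow> complex \<Rightarrow> real ^ 3" where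
  "unit_normal X z = sgn (cross3 (partial_x X z) (partial_y X z))"

text \<open>\<open>H = (eG - 2fF + gE) / (2 (EG - F\<^sup>2))\<close> with \<open>E, F, G\<close> and \<open>e, f, g\<close> the coefficients
  of the first and second fundamental forms.\<close>

definition mean_curvature :: "(complex \<Rightarrow> real ^ 3) \<Rightarrow> complex \<Rightarrow> real" where
  "mean_curvature X z =
     (let E = partial_x X z \<bullet> partial_x X z;
          F = partial_x X z \<bullet> partial_y X z;
          G = partial_y X z \<bullet> partial_y X z;
          e = partial_x (partial_x X) z \<bullet> unit_normal X z;
          f = partial_x (partial_y X) z \<bullet> unit_normal X z;
          g = partial_y (partial_y X) z \<bullet> unit_normal X z
      in (e * G - 2 * f * F + g * E) / (2 * (E * G - F\<^sup>2)))"

definition minimal_immersion_on :: "(complex \<Rightarrow> real ^ 3) \<Rightarrow> complex set \<Rightarrow> bool" where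
  "minimal_immersion_on X S \<longleftrightarrow>
     C2_on X S \<and>
     (\<forall>z\<in>S. cross3 (partial_x X z) (partial_y X z) \<noteq> 0 \<and> mean_curvature X z = 0)"

definition graph_map :: "(complex \<Rightarrow> real) \<Rightarrow> complex \<Rightarrow> real ^ 3" where
  "graph_map u z = vector [Re z, Im z, u z]"

text \<open>\<open>M\<close> is the graph of a \<open>C\<^sup>2\<close> function over the open unit disk and is a minimal surface.\<close>

definition minimal_graph_over_disk :: "(real ^ 3) set \<Rightarrow> bool" where
  "minimal_graph_over_disk M \<longleftrightarrow>
     (\<exists>u. M = graph_map u ` ball 0 1 \<and> minimal_immersion_on (graph_map u) (ball 0 1))"

end

theory Submission
  imports Defs "HOL-Complex_Analysis.Riemann_Mapping" "HOL-Real_Asymp.Real_Asymp"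
begin

text \<open>
  Let \<open>\<tau>\<close> be a harmonic homeomorphism of the unit disk \<open>U\<close> onto the open surface \<open>\<Phi>(U)\<close>, let
  \<open>L\<close> be the length of the boundary curve, and let \<open>P\<close>, \<open>Q\<close> be two points of the surface. A
  Moebius map of the disk carries the preimages of \<open>P\<close> and \<open>Q\<close> to \<open>0\<close> and to a point of the
  positive real axis and keeps the coordinates harmonic. It therefore suffices to bound the length
  of \<open>\<tau>([0,1))\<close> by \<open>L/2\<close>; this is \<open>harmonic_surface_radial_length\<close>.

  The bound is an inequality of Riesz-Fejer type. In the Poisson formula on the circle of radius
  \<open>\<rho>\<close>, write \<open>P\<^sub>x(t) = 1 + 2 A\<^sub>x'(t)\<close> with \<open>A\<^sub>x(t) = arctan (x sin t / (1 - x cos t))\<close>. Integration by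
  parts turns \<open>\<tau>(\<rho>y) - \<tau>(\<rho>x)\<close> into an integral of \<open>A\<^sub>y - A\<^sub>x\<close> against the increments of \<open>\<tau>\<close> along
  the circle. For fixed \<open>t\<close>, \<open>A\<^sub>x(t)\<close> is monotone in \<open>x\<close> with total variation at most \<open>\<pi>/2\<close>, so the
  length of the image of the radius is at most half the length of the image of the circle. The
  circle only enters through inscribed polygons: the increments are taken over the step
  \<open>h = 2\<pi>/n\<close>, and their integral is the mean, over all rotations, of the perimeters of \<open>n\<close>-gons
  with vertices \<open>\<tau>(\<rho> e\<^sup>i\<^sup>t)\<close> (\<open>chord_estimate\<close>, \<open>riesz_fejer_discrete\<close>, \<open>radial_image_length\<close>).

  It remains to see that these perimeters are at most \<open>L\<close> in the limit \<open>\<rho> \<rightarrow> 1\<close>, although \<open>\<tau>\<close> need not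
  extend continuously to the closed disk. Two facts are used. First, bounded harmonic functions
  have radial limits almost everywhere (\<open>fatou_radial_limits\<close>, obtained from the weak type maximal
  inequality and from the monotonicity of the mean squares on circles), and the limits of \<open>\<tau>\<close> lie
  on the boundary curve because \<open>\<tau>\<close> is a homeomorphism onto the open surface. Second, the landing
  points follow each other on the boundary curve in the same cyclic order as the radii
  (\<open>lifted_rays_ordered\<close>): the images of the radii are disjoint arcs in a disk, and lifting
  through the exponential map to a half plane turns a wrong order into two disjoint paths in a
  rectangle that ought to cross. A polygon inscribed in cyclic order has perimeter at most \<open>L\<close>.

  For sharpness, the part of the plane \<open>u = N x\<close> over the unit disk is a minimal graph. Its diameter is
  the major axis \<open>2 \<surd>(1 + N\<^sup>2)\<close>, and its perimeter is at most \<open>4 \<surd>(1 + N\<^sup>2) + 2\<pi>\<close>, so the quotient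
  tends to \<open>1/2\<close> as \<open>N\<close> grows.
\<close>

section \<open>Harmonic functions on the disk are real parts of holomorphic functions\<close>

lemma has_derivative_along_line:
  fixes F :: "complex \<Rightarrow> 'a::real_normed_vector"
  assumes "(F has_derivative D) (at (z + e * of_real t))"
  shows "((\<lambda>t. F (z + e * of_real t)) has_vector_derivative D e) (at t)"
proof -
  have "((\<lambda>t. z + e * of_real t) has_vector_derivative e) (at t)"
    by (auto intro!: derivative_eq_intros)
  from vector_derivative_diff_chain_within[OF this has_derivative_at_withinI[OF assms]]
  show ?thesis by (simp add: o_def)
qed

text \<open>Differentiability makes the full derivative a real-linear function of the increment, and such a
  function is determined by its values at \<open>1\<close> and \<open>\<i>\<close>, the two partial derivatives.\<close>

lemma partials_has_derivative:
  assumes "open S" "F differentiable_on S" "z \<in> S"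
  shows "(F has_derivative (\<lambda>h. Re h *\<^sub>R partial_x F z + Im h *\<^sub>R partial_y F z)) (at z)"
proof -
  obtain D where D: "(F has_derivative D) (at z)"
    using assms by (metis differentiable_def differentiable_on_def at_within_open)
  then interpret bounded_linear D by (rule has_derivative_bounded_linear)
  have D0: "(F has_derivative D) (at (z + e * of_real 0))" for e using D by simp
  have "((\<lambda>t. F (z + of_real t)) has_vector_derivative D 1) (at 0)"
    using has_derivative_along_line[OF D0, of 1] by simp
  then have x: "partial_x F z = D 1"
    unfolding partial_x_def by (rule vector_derivative_at)
  have "((\<lambda>t. F (z + \<i> * of_real t)) has_vector_derivative D \<i>) (at 0)"
    using has_derivative_along_line[OF D0, of \<i>] by simp
  then have y: "partial_y F z = D \<i>"
    unfolding partial_y_def by (rule vector_derivative_at)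
  have "D h = Re h *\<^sub>R D 1 + Im h *\<^sub>R D \<i>" for h
  proof -
    have "h = Re h *\<^sub>R 1 + Im h *\<^sub>R \<i>" by (simp add: complex_eq_iff)
    then have "D h = D (Re h *\<^sub>R 1 + Im h *\<^sub>R \<i>)" by (rule arg_cong)
    then show ?thesis by (simp only: add scaleR)
  qed
  then have "D = (\<lambda>h. Re h *\<^sub>R D 1 + Im h *\<^sub>R D \<i>)" by blast
  with D x y show ?thesis by simp
qed

lemma partials_DERIV:
  fixes u :: "complex \<Rightarrow> real"
  assumes "open S" "u differentiable_on S"
  shows "z + of_real t \<in> S \<Longrightarrow> ((\<lambda>t. u (z + of_real t)) has_real_derivative partial_x u (z + of_real t)) (at t)"
    and "z + \<i> * of_real t \<in> S \<Longrightarrow> ((\<lambda>t. u (z + \<i> * of_real t)) has_real_derivative partial_y u (z + \<i> * of_real t)) (at t)"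
proof -
  show "((\<lambda>t. u (z + of_real t)) has_real_derivative partial_x u (z + of_real t)) (at t)"
    if "z + of_real t \<in> S"
    using has_derivative_along_line[where t = t and e = 1 and z = z, simplified, OF partials_has_derivative[OF assms that]]
    by (simp add: has_real_derivative_iff_has_vector_derivative)
  show "((\<lambda>t. u (z + \<i> * of_real t)) has_real_derivative partial_y u (z + \<i> * of_real t)) (at t)"
    if "z + \<i> * of_real t \<in> S"
    using has_derivative_along_line[where t = t and e = \<i> and z = z, OF partials_has_derivative[OF assms that]]
    by (simp add: has_real_derivative_iff_has_vector_derivative)
qed

text \<open>Schwarz's theorem. The second difference of \<open>u\<close> over a small square equals the area times a
  value of either mixed derivative in that square, by two applications of the mean value theorem;
  both derivatives are continuous, so letting the square shrink gives equality.\<close>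

lemma mixed_partials_commute:
  fixes u :: "complex \<Rightarrow> real"
  assumes "C2_on u S" "a \<in> S"
  shows "partial_y (partial_x u) a = partial_x (partial_y u) a"
proof -
  let ?A = "partial_y (partial_x u)" and ?B = "partial_x (partial_y u)"
  have S: "open S" and u: "u differentiable_on S" and ux: "partial_x u differentiable_on S"
    and uy: "partial_y u differentiable_on S" and A: "continuous_on S ?A" and B: "continuous_on S ?B"
    using assms by (auto simp: C2_on_def C1_on_def)
  have "\<bar>?A a - ?B a\<bar> \<le> 2 * e" if "e > 0" for e
  proof -
    have "isCont ?A a" "isCont ?B a"
      using A B S assms(2) by (auto simp: continuous_on_eq_continuous_at)
    then have "\<exists>d>0. \<forall>z. dist z a < d \<longrightarrow> dist (?A z) (?A a) < e"
      "\<exists>d>0. \<forall>z. dist z a < d \<longrightarrow> dist (?B z) (?B a) < e"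
      using that unfolding continuous_at_eps_delta by blast+
    then obtain d1 d2 where d1: "d1 > 0" "\<And>z. dist z a < d1 \<Longrightarrow> dist (?A z) (?A a) < e"
      and d2: "d2 > 0" "\<And>z. dist z a < d2 \<Longrightarrow> dist (?B z) (?B a) < e"
      by blast
    obtain d3 where d3: "d3 > 0" "ball a d3 \<subseteq> S"
      using S assms(2) open_contains_ball by blast
    define s where "s = min d1 (min d2 d3) / 2"
    have s: "s > 0" using d1 d2 d3 by (simp add: s_def)
    define P where "P = (\<lambda>x y. a + of_real x + \<i> * of_real y)"
    have P: "dist (P x y) a \<le> x + y" if "0 \<le> x" "0 \<le> y" for x y
    proof -
      have "dist (P x y) a = norm (of_real x + \<i> * of_real y)" by (simp add: P_def dist_norm add.assoc)
      also have "\<dots> \<le> norm (of_real x :: complex) + norm (\<i> * of_real y)" by (rule norm_triangle_ineq)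
      finally show ?thesis using that by (simp add: norm_mult)
    qed
    have PS: "P x y \<in> S" if "0 \<le> x" "0 \<le> y" "x + y < 2 * s" for x y
      using P[of x y] that d3 by (auto simp: s_def dist_commute subset_iff)
    have Px: "((\<lambda>x. f (P x y)) has_real_derivative partial_x f (P x y)) (at x)"
      if "P x y \<in> S" "f differentiable_on S" for f :: "complex \<Rightarrow> real" and x y
      using partials_DERIV(1)[OF S that(2), of "a + \<i> * of_real y" x] that(1)
      by (simp add: P_def add_ac)
    have Py: "((\<lambda>y. f (P x y)) has_real_derivative partial_y f (P x y)) (at y)"
      if "P x y \<in> S" "f differentiable_on S" for f :: "complex \<Rightarrow> real" and x y
      using partials_DERIV(2)[OF S that(2), of "a + of_real x" y] that(1)
      by (simp add: P_def add_ac)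
    \<comment> \<open>Slightly less than \<open>s\<close>, so that the closed square of side \<open>r\<close> still lies in the domain.\<close>
    define r where "r = s * (9/10)"
    have r: "0 < r" "2 * r < 2 * s" using s by (auto simp: r_def)
    define D where "D = u (P r r) - u (P r 0) - u (P 0 r) + u (P 0 0)"
    have "\<exists>x>0. x < r \<and> (u (P r r) - u (P r 0)) - (u (P 0 r) - u (P 0 0)) =
        (r - 0) * (partial_x u (P x r) - partial_x u (P x 0))"
      using r by (intro MVT2) (auto intro!: derivative_eq_intros Px u PS)
    then obtain x where x: "0 < x" "x < r" "D = r * (partial_x u (P x r) - partial_x u (P x 0))"
      by (auto simp: D_def)
    have "\<exists>y>0. y < r \<and> partial_x u (P x r) - partial_x u (P x 0) = (r - 0) * ?A (P x y)"
      using r x by (intro MVT2) (auto intro!: Py ux PS)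
    then obtain y where y: "0 < y" "y < r" "D = r * (r * ?A (P x y))" using x by auto
    have "\<exists>y'>0. y' < r \<and> (u (P r r) - u (P 0 r)) - (u (P r 0) - u (P 0 0)) =
        (r - 0) * (partial_y u (P r y') - partial_y u (P 0 y'))"
      using r by (intro MVT2) (auto intro!: derivative_eq_intros Py u PS)
    then obtain y' where y': "0 < y'" "y' < r" "D = r * (partial_y u (P r y') - partial_y u (P 0 y'))"
      by (auto simp: D_def)
    have "\<exists>x'>0. x' < r \<and> partial_y u (P r y') - partial_y u (P 0 y') = (r - 0) * ?B (P x' y')"
      using r y' by (intro MVT2) (auto intro!: Px uy PS)
    then obtain x' where x': "0 < x'" "x' < r" "D = r * (r * ?B (P x' y'))" using y' by auto
    have "?A (P x y) = ?B (P x' y')" using y x' r by simp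
    moreover have "dist (?A (P x y)) (?A a) < e" "dist (?B (P x' y')) (?B a) < e"
      using P[of x y] P[of x' y'] x y x' y' r by (auto intro!: d1(2) d2(2) simp: s_def)
    ultimately show ?thesis by (simp add: dist_real_def abs_less_iff abs_le_iff)
  qed
  then have "\<bar>?A a - ?B a\<bar> \<le> e" if "e > 0" for e
    using that[THEN half_gt_zero] by fastforce
  then have "\<bar>?A a - ?B a\<bar> \<le> 0" by (rule field_le_epsilon) simp
  then show ?thesis by simp
qed

text \<open>The function \<open>u\<^sub>x - \<i> u\<^sub>y\<close> satisfies the Cauchy-Riemann equations: one of them is Laplace's
  equation, the other the symmetry of the mixed derivatives. Its primitive on the disk has real
  part \<open>u\<close> up to a constant.\<close>

proposition harmonic_on_ball_Re_holomorphic: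
  fixes u :: "complex \<Rightarrow> real"
  assumes "harmonic_on u (ball 0 1)"
  obtains F where "F holomorphic_on ball 0 1" "\<And>z. z \<in> ball 0 1 \<Longrightarrow> u z = Re (F z)"
proof -
  let ?U = "ball 0 1 :: complex set"
  have C2: "C2_on u ?U" and lap: "\<And>z. z \<in> ?U \<Longrightarrow> partial_x (partial_x u) z + partial_y (partial_y u) z = 0"
    using assms by (auto simp: harmonic_on_def)
  then have u: "u differentiable_on ?U" and ux: "partial_x u differentiable_on ?U"
    and uy: "partial_y u differentiable_on ?U"
    by (auto simp: C2_on_def C1_on_def)
  define f where "f = (\<lambda>z. complex_of_real (partial_x u z) - \<i> * of_real (partial_y u z))"
  have "(f has_field_derivative
      (of_real (partial_x (partial_x u) z) - \<i> * of_real (partial_x (partial_y u) z))) (at z)"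
    if z: "z \<in> ?U" for z
  proof -
    have "(f has_derivative (\<lambda>h. of_real (Re h *\<^sub>R partial_x (partial_x u) z + Im h *\<^sub>R partial_y (partial_x u) z)
        - \<i> * of_real (Re h *\<^sub>R partial_x (partial_y u) z + Im h *\<^sub>R partial_y (partial_y u) z))) (at z)"
      unfolding f_def
      by (intro derivative_intros partials_has_derivative[OF open_ball ux z]
          partials_has_derivative[OF open_ball uy z])
    also have "(\<lambda>h. of_real (Re h *\<^sub>R partial_x (partial_x u) z + Im h *\<^sub>R partial_y (partial_x u) z)
        - \<i> * of_real (Re h *\<^sub>R partial_x (partial_y u) z + Im h *\<^sub>R partial_y (partial_y u) z)) =
      (*) (of_real (partial_x (partial_x u) z) - \<i> * of_real (partial_x (partial_y u) z))"
    proof -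
      have "partial_y (partial_y u) z = - partial_x (partial_x u) z" using lap[OF z] by linarith
      then show ?thesis
        by (simp add: complex_eq_iff fun_eq_iff algebra_simps mixed_partials_commute[OF C2 z])
    qed
    finally show ?thesis by (simp add: has_field_derivative_def)
  qed
  then have "f holomorphic_on ?U" using holomorphic_on_open[OF open_ball] by blast
  then obtain G where G: "\<And>z. z \<in> ?U \<Longrightarrow> (G has_field_derivative f z) (at z within ?U)"
    using holomorphic_convex_primitive'[of ?U f] by auto
  have "((\<lambda>z. u z - Re (G z)) has_derivative (\<lambda>h. 0)) (at z within ?U)" if z: "z \<in> ?U" for z
  proof -
    have "((\<lambda>z. u z - Re (G z)) has_derivative
        (\<lambda>h. (Re h *\<^sub>R partial_x u z + Im h *\<^sub>R partial_y u z) - Re (f z * h))) (at z within ?U)"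
      using G[OF z] unfolding has_field_derivative_def
      by (intro derivative_intros has_derivative_at_withinI[OF partials_has_derivative[OF open_ball u z]])
    then show ?thesis by (simp add: f_def algebra_simps)
  qed
  then obtain c where c: "\<And>z. z \<in> ?U \<Longrightarrow> u z - Re (G z) = c"
    using has_derivative_zero_constant[of ?U "\<lambda>z. u z - Re (G z)"] by (auto simp: convex_ball)
  show ?thesis
  proof
    show "(\<lambda>z. G z + of_real c) holomorphic_on ?U"
    proof -
      have "G holomorphic_on ?U"
        using G unfolding holomorphic_on_def field_differentiable_def by blast
      then show ?thesis by (intro holomorphic_intros)
    qed
    show "u z = Re (G z + of_real c)" if "z \<in> ?U" for z using c[OF that] by simp
  qed
qed

section \<open>The Poisson formula\<close>

definition poisson :: "real \<Rightarrow> real \<Rightarrow> real" where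
  "poisson r t = (1 - r\<^sup>2) / (1 - 2 * r * cos t + r\<^sup>2)"

lemma poisson_denom_pos:
  fixes r t :: real
  assumes "\<bar>r\<bar> < 1"
  shows "0 < 1 - 2 * r * cos t + r\<^sup>2"
proof -
  have "1 - 2 * r * cos t + r\<^sup>2 \<ge> 1 - 2 * \<bar>r\<bar> + \<bar>r\<bar>\<^sup>2"
    using mult_mono[of "\<bar>r\<bar>" "\<bar>r\<bar>" "\<bar>cos t\<bar>" 1] abs_le_D1[of "r * cos t" "\<bar>r\<bar>"] by (simp add: abs_mult)
  also have "1 - 2 * \<bar>r\<bar> + \<bar>r\<bar>\<^sup>2 = (1 - \<bar>r\<bar>)\<^sup>2" by (simp add: power2_eq_square algebra_simps)
  finally show ?thesis using assms by (smt (verit) zero_less_power2)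
qed

lemma poisson_nonneg: "\<bar>r\<bar> < 1 \<Longrightarrow> 0 \<le> poisson r t"
  using poisson_denom_pos[of r t] by (simp add: poisson_def abs_square_le_1)

text \<open>The first summand is the Cauchy kernel for the point \<open>r\<close> of the disk. The second one belongs to
  the reflected point \<open>1/r\<close> outside the disk and integrates to \<open>0\<close> against holomorphic functions.
  Only their sum is real, which is why the resulting formula passes to real parts.\<close>

lemma poisson_eq_cauchy_kernels:
  assumes "\<bar>r\<bar> < 1"
  shows "cis t / (cis t - of_real r) + of_real r * cis t / (1 - of_real r * cis t) = of_real (poisson r t)"
proof -
  let ?u = "cis t"
  have n: "norm (of_real r * ?u) < 1" using assms by (simp add: norm_mult)
  have 1: "?u - of_real r \<noteq> 0"
  proof
    assume "?u - of_real r = 0"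
    then have "norm ?u = norm (of_real r :: complex)" by simp
    then show False using assms by simp
  qed
  have 2: "1 - of_real r * ?u \<noteq> 0"
  proof
    assume "1 - of_real r * ?u = 0"
    then have "norm (of_real r * ?u) = norm (1 :: complex)" by simp
    then show False using n by simp
  qed
  have c: "?u * cis (-t) = 1" by (simp add: cis_mult)
  have "(?u - of_real r) * (1 - of_real r * ?u) = ?u * of_real (1 - 2 * r * cos t + r\<^sup>2)"
  proof -
    have "of_real (2 * cos t) = ?u + cis (-t)" by (simp add: complex_eq_iff)
    note eq = this[symmetric]
    have "?u * of_real (1 - 2 * r * cos t + r\<^sup>2) = ?u * (1 - of_real r * (?u + cis (-t)) + (of_real r)\<^sup>2)"
      unfolding eq by (simp add: mult_ac)
    also have "\<dots> = ?u - of_real r * ?u * ?u - of_real r * (?u * cis (-t)) + ?u * (of_real r)\<^sup>2"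
      by (simp add: algebra_simps)
    finally show ?thesis by (simp only: c) (simp add: algebra_simps power2_eq_square)
  qed
  moreover have "?u / (?u - of_real r) + of_real r * ?u / (1 - of_real r * ?u) =
      ?u * (1 - (of_real r)\<^sup>2) / ((?u - of_real r) * (1 - of_real r * ?u))"
    using 1 2 by (simp add: divide_simps) (simp add: algebra_simps power2_eq_square)
  ultimately show ?thesis
    by (simp add: poisson_def)
qed

lemma two_pi_pos: "0 < 2 * pi" by simp

proposition poisson_formula:
  assumes F: "F holomorphic_on ball 0 1" and \<rho>: "0 \<le> \<rho>" "\<rho> < 1" and r: "\<bar>r\<bar> < 1"
  shows "((\<lambda>t. poisson r t * Re (F (of_real \<rho> * cis (\<theta> + t)))) has_integral
           2 * pi * Re (F (of_real (r * \<rho>) * cis \<theta>))) {0..2 * pi}"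
proof -
  define G where "G = (\<lambda>w. F (of_real \<rho> * cis \<theta> * w))"
  have in_ball: "of_real \<rho> * cis \<theta> * w \<in> ball 0 1" if "norm w \<le> 1" for w
    using that \<rho> mult_left_mono[of "norm w" 1 \<rho>] by (simp add: norm_mult)
  have contG: "continuous_on (cball 0 1) G"
    unfolding G_def
    by (intro continuous_on_compose2[OF holomorphic_on_imp_continuous_on[OF F]] continuous_intros)
       (use in_ball in \<open>simp add: image_subset_iff\<close>)
  have holG: "G holomorphic_on ball 0 1"
    unfolding G_def
    by (intro holomorphic_on_compose_gen[OF _ F, unfolded o_def] holomorphic_intros)
       (use in_ball in auto)
  have nz: "1 - of_real r * w \<noteq> 0" if "norm w \<le> 1" for w :: complex
  proof -
    have "norm (of_real r * w) < 1"
      using that r mult_left_mono[of "norm w" 1 "\<bar>r\<bar>"] by (simp add: norm_mult)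
    then show ?thesis by auto
  qed
  have 1: "((\<lambda>u. G u / (u - of_real r)) has_contour_integral (2 * of_real pi * \<i> * G (of_real r))) (circlepath 0 1)"
    using r by (intro Cauchy_integral_circlepath contG holG) auto
  have "((\<lambda>u. (u * G u * of_real r / (1 - of_real r * u)) / (u - 0)) has_contour_integral
      (2 * of_real pi * \<i> * (0 * G 0 * of_real r / (1 - of_real r * 0)))) (circlepath 0 1)"
    using nz by (intro Cauchy_integral_circlepath continuous_intros contG holG holomorphic_intros) auto
  then have 2: "((\<lambda>u. (u * G u * of_real r / (1 - of_real r * u)) / u) has_contour_integral 0) (circlepath 0 1)"
    by simp
  note 3 = has_contour_integral_add[OF 1 2,
      unfolded circlepath_def has_contour_integral_part_circlepath_iff[OF two_pi_pos] add_0_right]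
  have "((\<lambda>t. \<i> * (G (cis t) * of_real (poisson r t))) has_integral 2 * of_real pi * \<i> * G (of_real r)) {0..2 * pi}"
  proof (rule has_integral_eq[OF _ 3])
    fix t :: real
    show "(G (0 + of_real 1 * cis t) / (0 + of_real 1 * cis t - of_real r) +
       (0 + of_real 1 * cis t) * G (0 + of_real 1 * cis t) * of_real r / (1 - of_real r * (0 + of_real 1 * cis t)) / (0 + of_real 1 * cis t)) * of_real 1 * \<i> * cis t
       = \<i> * (G (cis t) * of_real (poisson r t))"
    proof -
      have "cis t * G (cis t) * of_real r / (1 - of_real r * cis t) / cis t = G (cis t) * of_real r / (1 - of_real r * cis t)"
        by simp
      then show ?thesis
        unfolding poisson_eq_cauchy_kernels[OF r, symmetric]
        by (simp only: add_0_left of_real_1 mult_1_left mult_1_right) (simp add: algebra_simps add_divide_distrib)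
    qed
  qed
  from has_integral_mult_right[OF this, of "- \<i>"]
  have "((\<lambda>t. G (cis t) * of_real (poisson r t)) has_integral 2 * of_real pi * G (of_real r)) {0..2 * pi}"
    by (simp add: algebra_simps)
  from has_integral_linear[OF this bounded_linear_Re]
  show ?thesis
    by (simp add: o_def G_def mult_ac flip: cis_mult)
qed

section \<open>Integrals of periodic functions\<close>

lemma periodic_add_int:
  fixes f :: "real \<Rightarrow> 'a"
  assumes "\<And>t. f (t + p) = f t"
  shows "f (t + of_int k * p) = f t"
proof (induction k)
  case (nonneg n)
  show ?case
  proof (induction n)
    case (Suc n)
    then show ?case using assms[of "t + real n * p"] by (simp add: algebra_simps)
  qed simp
next
  case (neg n)
  show ?case
  proof (induction n)
    case 0
    then show ?case using assms[of "t - p"] by simp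
  next
    case (Suc n)
    then show ?case using assms[of "t - real (Suc (Suc n)) * p"] by (simp add: algebra_simps)
  qed
qed

lemma integral_periodic_shift:
  fixes f :: "real \<Rightarrow> 'a::banach"
  assumes f: "continuous_on UNIV f" "\<And>t. f (t + p) = f t" and p: "0 < p"
  shows "integral {0..p} (\<lambda>t. f (t + c)) = integral {0..p} f"
proof -
  have int: "f integrable_on {a..b}" for a b
    by (rule integrable_continuous_interval[OF continuous_on_subset[OF f(1)]]) simp
  define d where "d = c - of_int \<lfloor>c / p\<rfloor> * p"
  have d: "0 \<le> d" "d < p"
    using p floor_divide_lower[OF p, of c] floor_divide_upper[OF p, of c] by (auto simp: d_def algebra_simps)
  have "f (t + c) = f (t + d)" for t
    using periodic_add_int[of f p "t + d" "\<lfloor>c / p\<rfloor>", OF f(2)] by (simp add: d_def algebra_simps)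
  then have "integral {0..p} (\<lambda>t. f (t + c)) = integral {0..p} (\<lambda>t. f (t + d))" by simp
  also have "\<dots> = integral {d..p + d} f"
    using integral_shift_real_ivl[of d d "p + d" f] by simp
  also have "\<dots> = integral {d..p} f + integral {p..p + d} f"
    by (rule Henstock_Kurzweil_Integration.integral_combine[symmetric]) (use d int in auto)
  also have "integral {p..p + d} f = integral {0..d} f"
    using integral_shift_real_ivl[of p p "p + d" f] f(2) by simp
  also have "integral {d..p} f + integral {0..d} f = integral {0..p} f"
    using Henstock_Kurzweil_Integration.integral_combine[of 0 d p f] d int by (simp add: add.commute)
  finally show ?thesis .
qed

text \<open>Folding a period onto its half; this is used to pair the two points at distance \<open>t\<close> from the
  centre of an even kernel.\<close>

lemma integral_periodic_symmetric:
  fixes f :: "real \<Rightarrow> real"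
  assumes f: "continuous_on UNIV f" "\<And>t. f (t + p) = f t" and p: "0 < p"
  shows "integral {0..p} f = integral {0..p/2} (\<lambda>t. f t + f (- t))"
proof -
  have int: "f integrable_on {a..b}" for a b
    by (rule integrable_continuous_interval[OF continuous_on_subset[OF f(1)]]) simp
  have int': "(\<lambda>t. f (- t)) integrable_on {a..b}" for a b
    by (intro integrable_continuous_interval continuous_intros continuous_on_compose2[OF f(1)]) auto
  have "integral {0..p} f = integral {0..p/2} f + integral {p/2..p} f"
    by (rule Henstock_Kurzweil_Integration.integral_combine[symmetric]) (use p int in auto)
  also have "integral {p/2..p} f = integral {- (p/2)..0} f"
    using integral_shift_real_ivl[of "p/2" p p f] f(2) by simp
  also have "\<dots> = integral {0..p/2} (\<lambda>t. f (- t))"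
    using Henstock_Kurzweil_Integration.integral_reflect_real[of "p/2" 0 "\<lambda>t. f (- t)"] by simp
  finally show ?thesis by (simp add: Henstock_Kurzweil_Integration.integral_add int int')
qed

lemma integral_periodic_reflect:
  fixes f :: "real \<Rightarrow> real"
  assumes f: "continuous_on UNIV f" "\<And>t. f (t + p) = f t" and p: "0 < p"
  shows "integral {0..p} (\<lambda>t. f (- t)) = integral {0..p} f"
proof -
  have "integral {0..p} (\<lambda>t. f (- t)) = integral {0..p/2} (\<lambda>t. f (- t) + f (- (- t)))"
  proof (rule integral_periodic_symmetric[OF _ _ p])
    show "continuous_on UNIV (\<lambda>t. f (- t))"
      by (intro continuous_intros continuous_on_compose2[OF f(1)]) auto
    show "f (- (t + p)) = f (- t)" for t using f(2)[of "- (t + p)"] by simp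
  qed
  then show ?thesis using integral_periodic_symmetric[OF f p] by (simp add: add.commute)
qed

section \<open>Functions reproduced by the Poisson kernel\<close>

definition polar :: "(complex \<Rightarrow> 'a) \<Rightarrow> real \<Rightarrow> real \<Rightarrow> 'a" where
  "polar u r t = u (of_real r * cis t)"

text \<open>The only property of harmonic functions that the analytic part relies on. It makes sense for
  values in any normed space, so that it applies to a coordinate and to the whole map.\<close>

definition poisson_reproducing :: "(complex \<Rightarrow> 'a::real_normed_vector) \<Rightarrow> bool" where
  "poisson_reproducing u \<longleftrightarrow> continuous_on (ball 0 1) u \<and>
     (\<forall>\<rho> r \<theta>. 0 \<le> \<rho> \<longrightarrow> \<rho> < 1 \<longrightarrow> 0 \<le> r \<longrightarrow> r < 1 \<longrightarrow>
        ((\<lambda>t. poisson r t *\<^sub>R polar u \<rho> (\<theta> + t)) has_integral (2 * pi) *\<^sub>R polar u (r * \<rho>) \<theta>) {0..2 * pi})"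

lemma continuous_poisson: "\<bar>r\<bar> < 1 \<Longrightarrow> continuous_on A (poisson r)"
  unfolding poisson_def using poisson_denom_pos[of r]
  by (intro continuous_intros) (auto simp: less_imp_neq[THEN not_sym])

lemma poisson_periodic [simp]: "poisson r (t + 2 * pi) = poisson r t"
  and poisson_even [simp]: "poisson r (- t) = poisson r t"
  by (simp_all add: poisson_def)

lemma polar_periodic [simp]: "polar u r (t + 2 * pi) = polar u r t"
proof -
  have "cis (t + 2 * pi) = cis t" by (simp add: complex_eq_iff)
  then show ?thesis by (simp add: polar_def)
qed

lemma continuous_polar2:
  assumes "continuous_on (ball 0 1) u"
  shows "continuous_on ({0..<1} \<times> UNIV) (\<lambda>(r, t). polar u r t)"
  unfolding polar_def case_prod_beta
  by (intro continuous_on_compose2[OF assms] continuous_intros) (auto simp: norm_mult)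

lemma continuous_polar:
  assumes "continuous_on (ball 0 1) u" "0 \<le> r" "r < 1"
  shows "continuous_on A (polar u r)"
  unfolding polar_def
  by (intro continuous_on_compose2[OF assms(1)] continuous_intros) (use assms in \<open>auto simp: norm_mult\<close>)

lemma continuous_polar_radial:
  assumes "continuous_on (ball 0 1) u"
  shows "continuous_on {0..<1} (\<lambda>r. polar u r t)"
  unfolding polar_def
  by (intro continuous_on_compose2[OF assms(1)] continuous_intros) (auto simp: norm_mult)

lemma poisson_integral_polar:
  assumes "poisson_reproducing u" "0 \<le> \<rho>" "\<rho> < 1" "0 \<le> r" "r < 1"
  shows "integral {0..2 * pi} (\<lambda>t. poisson r t *\<^sub>R polar u \<rho> (\<theta> + t)) = (2 * pi) *\<^sub>R polar u (r * \<rho>) \<theta>"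
  using assms by (intro integral_unique) (auto simp: poisson_reproducing_def)

lemma poisson_reproducing_Re:
  assumes "F holomorphic_on ball 0 1" "\<And>z. z \<in> ball 0 1 \<Longrightarrow> u z = Re (F z)"
  shows "poisson_reproducing u"
proof -
  have "continuous_on (ball 0 1) (\<lambda>z. Re (F z))"
    by (intro continuous_intros holomorphic_on_imp_continuous_on assms)
  then have 1: "continuous_on (ball 0 1) u"
    by (rule continuous_on_eq) (simp add: assms(2))
  have "((\<lambda>t. poisson r t *\<^sub>R polar u \<rho> (\<theta> + t)) has_integral (2 * pi) *\<^sub>R polar u (r * \<rho>) \<theta>) {0..2 * pi}"
    if "0 \<le> \<rho>" "\<rho> < 1" "0 \<le> r" "r < 1" for \<rho> r \<theta>
  proof -
    have "r * \<rho> < 1" using that mult_strict_mono[of r 1 \<rho> 1] by simp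
    then have "polar u (r * \<rho>) \<theta> = Re (F (of_real (r * \<rho>) * cis \<theta>))"
      "polar u \<rho> t = Re (F (of_real \<rho> * cis t))" for t
      using that by (auto simp: polar_def norm_mult intro!: assms(2))
    then show ?thesis using poisson_formula[OF assms(1) that(1,2), of r \<theta>] that by simp
  qed
  with 1 show ?thesis by (simp add: poisson_reproducing_def)
qed

lemma has_integral_poisson:
  assumes "0 \<le> r" "r < 1"
  shows "(poisson r has_integral 2 * pi) {0..2 * pi}"
  using poisson_formula[of "\<lambda>_. 1" 0 r 0] assms by simp

section \<open>Mean squares on circles\<close>

text \<open>Both sides are the double integral of \<open>k(t) f(x) g(x - t)\<close>: translate by a period-invariant
  shift on one side, and use that the kernel is even on the other.\<close>

lemma even_convolution_selfadjoint:
  fixes k f g :: "real \<Rightarrow> real"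
  assumes k: "continuous_on UNIV k" "\<And>t. k (t + p) = k t" "\<And>t. k (- t) = k t"
    and f: "continuous_on UNIV f" "\<And>t. f (t + p) = f t"
    and g: "continuous_on UNIV g" "\<And>t. g (t + p) = g t" and p: "0 < p"
  shows "integral {0..p} (\<lambda>x. integral {0..p} (\<lambda>t. k t * f (x + t)) * g x) =
         integral {0..p} (\<lambda>x. f x * integral {0..p} (\<lambda>t. k t * g (x + t)))"
proof -
  note c = continuous_on_compose2[OF k(1)] continuous_on_compose2[OF f(1)] continuous_on_compose2[OF g(1)]
  have "integral {0..p} (\<lambda>x. integral {0..p} (\<lambda>t. k t * f (x + t)) * g x) =
        integral {0..p} (\<lambda>x. integral {0..p} (\<lambda>t. k t * f (x + t) * g x))"
    by simp
  also have "\<dots> = integral {0..p} (\<lambda>t. integral {0..p} (\<lambda>x. k t * f (x + t) * g x))"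
    unfolding box_real[symmetric]
    by (rule integral_swap_continuous) (auto simp: case_prod_beta intro!: continuous_intros c)
  also have "\<dots> = integral {0..p} (\<lambda>t. integral {0..p} (\<lambda>x. k t * f x * g (x - t)))"
  proof (rule integral_cong)
    fix t
    have "integral {0..p} (\<lambda>x. k t * f (x + t) * g (x + t - t)) = integral {0..p} (\<lambda>x. k t * f x * g (x - t))"
    proof (rule integral_periodic_shift[OF _ _ p])
      show "continuous_on UNIV (\<lambda>x. k t * f x * g (x - t))" by (auto intro!: continuous_intros c)
      show "k t * f (x + p) * g (x + p - t) = k t * f x * g (x - t)" for x
        using g(2)[of "x - t"] f(2)[of x] by (simp add: algebra_simps)
    qed
    then show "integral {0..p} (\<lambda>x. k t * f (x + t) * g x) = integral {0..p} (\<lambda>x. k t * f x * g (x - t))"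
      by simp
  qed
  also have "\<dots> = integral {0..p} (\<lambda>x. integral {0..p} (\<lambda>t. k t * f x * g (x - t)))"
    unfolding box_real[symmetric]
    by (rule integral_swap_continuous) (auto simp: case_prod_beta intro!: continuous_intros c)
  also have "\<dots> = integral {0..p} (\<lambda>x. f x * integral {0..p} (\<lambda>t. k t * g (x + t)))"
  proof (rule integral_cong)
    fix x
    have "integral {0..p} (\<lambda>t. k (- t) * g (x + (- t))) = integral {0..p} (\<lambda>t. k t * g (x + t))"
    proof (rule integral_periodic_reflect[OF _ _ p])
      show "continuous_on UNIV (\<lambda>t. k t * g (x + t))" by (auto intro!: continuous_intros c)
      show "k (t + p) * g (x + (t + p)) = k t * g (x + t)" for t
        using g(2)[of "x + t"] k(2)[of t] by (simp add: algebra_simps)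
    qed
    moreover have "integral {0..p} (\<lambda>t. k t * f x * g (x - t)) = integral {0..p} (\<lambda>t. f x * (k (- t) * g (x + (- t))))"
      by (rule integral_cong) (simp add: k(3) algebra_simps)
    ultimately show "integral {0..p} (\<lambda>t. k t * f x * g (x - t)) = f x * integral {0..p} (\<lambda>t. k t * g (x + t))"
      by simp
  qed
  finally show ?thesis .
qed

text \<open>The squared mean square norm of \<open>u\<close> on the circle of radius \<open>r\<close>. For \<open>u = Re (\<Sum>a\<^sub>n z\<^sup>n)\<close> it is, up to
  a constant term, \<open>\<pi> \<Sum>\<bar>a\<^sub>n\<bar>\<^sup>2 r\<^sup>2\<^sup>n\<close>; the next lemmas extract from the Poisson formula what this
  expansion would show.\<close>

definition circle_energy :: "(complex \<Rightarrow> real) \<Rightarrow> real \<Rightarrow> real" where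
  "circle_energy u r = integral {0..2 * pi} (\<lambda>t. (polar u r t)\<^sup>2)"

lemma mult_less_one:
  fixes s \<rho> :: real
  assumes "0 \<le> s" "s < 1" "0 \<le> \<rho>" "\<rho> < 1"
  shows "0 \<le> s * \<rho>" "s * \<rho> < 1"
  using assms mult_strict_mono[of s 1 \<rho> 1] by auto

text \<open>Passing from radius \<open>\<rho>\<close> to \<open>s \<rho>\<close> is convolution with the even Poisson kernel of parameter \<open>s\<close>, and
  such a convolution is self-adjoint. Hence the inner product of \<open>u\<close> on two circles depends only on
  the product of the radii.\<close>

lemma circle_product_scaling:
  fixes u :: "complex \<Rightarrow> real"
  assumes u: "poisson_reproducing u" and s: "0 \<le> s" "s < 1"
    and r: "0 \<le> \<rho>" "\<rho> < 1" "0 \<le> \<sigma>" "\<sigma> < 1"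
  shows "integral {0..2 * pi} (\<lambda>t. polar u (s * \<rho>) t * polar u \<sigma> t) =
         integral {0..2 * pi} (\<lambda>t. polar u \<rho> t * polar u (s * \<sigma>) t)"
proof -
  have c: "continuous_on (ball 0 1) u" using u by (simp add: poisson_reproducing_def)
  have "(2 * pi) * integral {0..2 * pi} (\<lambda>t. polar u (s * \<rho>) t * polar u \<sigma> t) =
      integral {0..2 * pi} (\<lambda>x. integral {0..2 * pi} (\<lambda>t. poisson s t * polar u \<rho> (x + t)) * polar u \<sigma> x)"
    using poisson_integral_polar[OF u r(1,2) s] by (simp add: mult.assoc)
  also have "\<dots> = integral {0..2 * pi} (\<lambda>x. polar u \<rho> x * integral {0..2 * pi} (\<lambda>t. poisson s t * polar u \<sigma> (x + t)))"
    using s r by (intro even_convolution_selfadjoint continuous_poisson continuous_polar c) auto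
  also have "\<dots> = (2 * pi) * integral {0..2 * pi} (\<lambda>t. polar u \<rho> t * polar u (s * \<sigma>) t)"
  proof -
    have "(\<lambda>x. polar u \<rho> x * integral {0..2 * pi} (\<lambda>t. poisson s t * polar u \<sigma> (x + t))) =
        (\<lambda>x. (2 * pi) * (polar u \<rho> x * polar u (s * \<sigma>) x))"
      using poisson_integral_polar[OF u r(3,4) s] by (simp add: fun_eq_iff)
    then show ?thesis by simp
  qed
  finally show ?thesis by simp
qed

text \<open>In the expanded square, the mixed term pairs the radii \<open>r\<close> and \<open>s\<^sup>2 r\<close>. Their product is that of
  \<open>s r\<close> with itself, so the mixed term is again an energy.\<close>

lemma circle_energy_difference:
  fixes u :: "complex \<Rightarrow> real"
  assumes u: "poisson_reproducing u" and s: "0 \<le> s" "s < 1" and r: "0 \<le> r" "r < 1"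
  shows "integral {0..2 * pi} (\<lambda>t. (polar u r t - polar u (s\<^sup>2 * r) t)\<^sup>2) =
    circle_energy u r - 2 * circle_energy u (s * r) + circle_energy u (s\<^sup>2 * r)"
proof -
  have c: "continuous_on (ball 0 1) u" using u by (simp add: poisson_reproducing_def)
  note sr = mult_less_one[OF s r] and ssr = mult_less_one[OF s mult_less_one[OF s r]]
  have s2: "s\<^sup>2 * r = s * (s * r)" by (simp add: power2_eq_square)
  have int: "(\<lambda>t. polar u a t * polar u b t) integrable_on {0..2 * pi}"
    if "0 \<le> a" "a < 1" "0 \<le> b" "b < 1" for a b
    using that by (intro integrable_continuous_interval continuous_intros continuous_polar c)
  have "integral {0..2 * pi} (\<lambda>t. (polar u r t - polar u (s\<^sup>2 * r) t)\<^sup>2) =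
    integral {0..2 * pi} (\<lambda>t. polar u r t * polar u r t - 2 * (polar u r t * polar u (s * (s * r)) t)
       + polar u (s\<^sup>2 * r) t * polar u (s\<^sup>2 * r) t)"
    by (simp add: power2_eq_square algebra_simps)
  also have "\<dots> = integral {0..2 * pi} (\<lambda>t. polar u r t * polar u r t)
      - 2 * integral {0..2 * pi} (\<lambda>t. polar u r t * polar u (s * (s * r)) t)
      + integral {0..2 * pi} (\<lambda>t. polar u (s\<^sup>2 * r) t * polar u (s\<^sup>2 * r) t)"
    using int r ssr unfolding s2
    by (subst Henstock_Kurzweil_Integration.integral_add, simp_all add: integrable_diff integrable_on_mult_right
        Henstock_Kurzweil_Integration.integral_diff)
  also have "integral {0..2 * pi} (\<lambda>t. polar u r t * polar u (s * (s * r)) t) = circle_energy u (s * r)"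
    using circle_product_scaling[OF u s r sr] by (simp add: circle_energy_def power2_eq_square)
  finally show ?thesis by (simp add: circle_energy_def power2_eq_square)
qed

text \<open>The differences \<open>E(s\<^sup>k r) - E(s\<^sup>k\<^sup>+\<^sup>1 r)\<close> decrease in \<open>k\<close>, since the second differences are integrals of
  squares, and they tend to \<open>0\<close> because \<open>E\<close> is continuous at \<open>0\<close>. So the first of them is
  nonnegative.\<close>

lemma circle_energy_mono:
  fixes u :: "complex \<Rightarrow> real"
  assumes u: "poisson_reproducing u" and s: "0 \<le> s" "s < 1" and r: "0 \<le> r" "r < 1"
  shows "circle_energy u (s * r) \<le> circle_energy u r"
proof -
  have c: "continuous_on (ball 0 1) u" using u by (simp add: poisson_reproducing_def)
  define a where "a = (\<lambda>k. circle_energy u (s ^ k * r))"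
  have pow: "0 \<le> s ^ k * r" "s ^ k * r < 1" for k
    using s r mult_mono[of "s ^ k" 1 r r] by (auto simp: power_le_one)
  have "continuous_on {0..<1} (circle_energy u)"
  proof -
    have "continuous_on {0..<1} (\<lambda>r. integral (cbox 0 (2 * pi)) (\<lambda>t. (polar u r t)\<^sup>2))"
    proof (rule integral_continuous_on_param)
      have "continuous_on ({0..<1} \<times> cbox 0 (2 * pi)) (\<lambda>(r, t). polar u r t)"
        by (rule continuous_on_subset[OF continuous_polar2[OF c]]) auto
      then show "continuous_on ({0..<1} \<times> cbox 0 (2 * pi)) (\<lambda>(r, t). (polar u r t)\<^sup>2)"
        unfolding case_prod_beta by (intro continuous_intros)
    qed
    then show ?thesis by (simp add: circle_energy_def)
  qed
  moreover have "(\<lambda>k. s ^ k * r) \<longlonglongrightarrow> 0"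
    using tendsto_mult_left_zero[OF LIMSEQ_power_zero[of s], of r] s by simp
  ultimately have lim: "a \<longlonglongrightarrow> circle_energy u 0"
    unfolding a_def by (rule continuous_on_tendsto_compose) (use pow in auto)
  have "decseq (\<lambda>k. a k - a (Suc k))"
  proof (rule decseq_SucI)
    fix k
    have "0 \<le> integral {0..2 * pi} (\<lambda>t. (polar u (s ^ k * r) t - polar u (s\<^sup>2 * (s ^ k * r)) t)\<^sup>2)"
      by (rule integral_nonneg)
         (use pow[of k] pow[of "Suc (Suc k)"] in \<open>auto simp: power2_eq_square mult.assoc intro!: integrable_continuous_interval continuous_intros continuous_polar c\<close>)
    then show "a (Suc k) - a (Suc (Suc k)) \<le> a k - a (Suc k)"
      unfolding circle_energy_difference[OF u s pow[of k]] a_def by (simp add: power2_eq_square mult.assoc)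
  qed
  moreover have "(\<lambda>k. a k - a (Suc k)) \<longlonglongrightarrow> circle_energy u 0 - circle_energy u 0"
    by (intro tendsto_intros lim LIMSEQ_Suc)
  ultimately have "0 \<le> a 0 - a (Suc 0)" using decseq_ge by fastforce
  then show ?thesis by (simp add: a_def)
qed

section \<open>The maximal inequality\<close>

text \<open>The Hardy-Littlewood inequality. Each point of \<open>E\<close> is the centre of an interval on which the mean
  of \<open>f\<close> exceeds \<open>l\<close>; the Vitali covering lemma selects disjoint ones whose fivefold enlargements
  cover \<open>E\<close>, and disjointness bounds the sum of their lengths by the integral of \<open>f\<close>. The interval
  of integration \<open>[-\<pi>, 3\<pi>]\<close> contains all intervals of radius at most \<open>\<pi>\<close> centred in \<open>[0, 2\<pi>]\<close>.\<close>

lemma weak_type_maximal_inequality: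
  fixes f :: "real \<Rightarrow> real"
  assumes f: "continuous_on UNIV f" "\<And>x. 0 \<le> f x" and l: "0 < l"
    and E: "E \<subseteq> {0..2 * pi}"
      "\<And>x. x \<in> E \<Longrightarrow> \<exists>t. 0 < t \<and> t \<le> pi \<and> l * (2 * t) < integral {x - t..x + t} f"
  obtains A where "A \<in> lmeasurable" "E \<subseteq> A" "measure lebesgue A \<le> 5 / l * integral {- pi..3 * pi} f"
proof (cases "E = {}")
  case True
  have "0 \<le> integral {- pi..3 * pi} f"
    by (intro integral_nonneg f integrable_continuous_interval continuous_on_subset[OF f(1)]) auto
  then show ?thesis using l True by (intro that[of "{}"]) auto
next
  case False
  obtain r where r: "\<And>x. x \<in> E \<Longrightarrow> 0 < r x \<and> r x \<le> pi"
    "\<And>x. x \<in> E \<Longrightarrow> l * (2 * r x) < integral {x - r x..x + r x} f"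
    using E(2) by metis
  obtain C where C: "countable C" "C \<subseteq> E" "pairwise (\<lambda>i j. disjnt (cball i (r i)) (cball j (r j))) C"
    "\<And>i. i \<in> E \<Longrightarrow> \<exists>j. j \<in> C \<and> \<not> disjnt (cball i (r i)) (cball j (r j)) \<and> cball i (r i) \<subseteq> ball j (5 * r j)"
    using Vitali_covering_lemma_cballs_balls[of E r pi "\<lambda>x. x", OF r(1)] by blast
  have "C \<noteq> {}" using C(4) False by blast
  then have fni: "from_nat_into C i \<in> C" for i by (rule from_nat_into)
  define S where "S = (\<lambda>i. ball (from_nat_into C i) (5 * r (from_nat_into C i)))"
  have bound: "measure lebesgue (\<Union>i\<le>n. S i) \<le> 5 / l * integral {- pi..3 * pi} f" for n
  proof -
    define D where "D = from_nat_into C ` {..n}"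
    have D: "finite D" "D \<subseteq> C" using fni by (auto simp: D_def)
    have "(\<Union>i\<le>n. S i) = (\<Union>j\<in>D. ball j (5 * r j))" by (simp add: S_def D_def)
    then have "measure lebesgue (\<Union>i\<le>n. S i) \<le> (\<Sum>j\<in>D. measure lebesgue (ball j (5 * r j)))"
      using measure_UNION_le[OF D(1), of "\<lambda>j. ball j (5 * r j)" lebesgue] by simp
    also have "\<dots> \<le> (\<Sum>j\<in>D. 5 / l * integral (cball j (r j)) f)"
    proof (rule sum_mono)
      fix j assume "j \<in> D"
      then have j: "0 < r j" "l * (2 * r j) < integral {j - r j..j + r j} f" using D C r by blast+
      have "measure lebesgue (ball j (5 * r j)) = 10 * r j"
        using j by (simp add: ball_eq_greaterThanLessThan)
      also have "\<dots> \<le> 5 / l * integral {j - r j..j + r j} f"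
        using j l by (simp add: field_simps)
      finally show "measure lebesgue (ball j (5 * r j)) \<le> 5 / l * integral (cball j (r j)) f"
        by (simp add: cball_eq_atLeastAtMost)
    qed
    also have "\<dots> = 5 / l * (\<Sum>j\<in>D. integral (cball j (r j)) f)"
      by (simp add: sum_distrib_left)
    also have "(\<Sum>j\<in>D. integral (cball j (r j)) f) \<le> integral {- pi..3 * pi} f"
    proof -
      have U: "(f has_integral (\<Sum>j\<in>D. integral (cball j (r j)) f)) (\<Union>j\<in>D. cball j (r j))"
      proof (rule has_integral_UN[OF D(1)])
        show "(f has_integral integral (cball j (r j)) f) (cball j (r j))" for j
          unfolding cball_eq_atLeastAtMost
          by (intro integrable_integral integrable_continuous_interval continuous_on_subset[OF f(1)]) auto
        show "pairwise (\<lambda>i i'. negligible (cball i (r i) \<inter> cball i' (r i'))) D"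
          using pairwise_subset[OF C(3) D(2)] by (auto simp: pairwise_def disjnt_def)
      qed
      have "integral (\<Union>j\<in>D. cball j (r j)) f \<le> integral {- pi..3 * pi} f"
      proof (rule integral_subset_le)
        show "(\<Union>j\<in>D. cball j (r j)) \<subseteq> {- pi..3 * pi}"
        proof (intro UN_least)
          fix j assume "j \<in> D"
          then have "j \<in> E" using D C by blast
          then show "cball j (r j) \<subseteq> {- pi..3 * pi}"
            using E(1) r(1)[of j] by (auto simp: cball_eq_atLeastAtMost)
        qed
        show "f integrable_on (\<Union>j\<in>D. cball j (r j))" using U by blast
        show "f integrable_on {- pi..3 * pi}"
          by (intro integrable_continuous_interval continuous_on_subset[OF f(1)]) auto
      qed (use f in auto)
      then show ?thesis using U by (simp add: integral_unique)
    qed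
    finally show ?thesis using l by (simp add: divide_right_mono)
  qed
  have meas: "S i \<in> lmeasurable" for i by (simp add: S_def)
  show ?thesis
  proof (rule that[of "\<Union>i. S i"])
    show "(\<Union>i. S i) \<in> lmeasurable" by (rule fmeasurable_countable_Union[OF meas bound])
    show "measure lebesgue (\<Union>i. S i) \<le> 5 / l * integral {- pi..3 * pi} f"
      by (rule measure_countable_Union_le[OF meas bound])
    show "E \<subseteq> (\<Union>i. S i)"
    proof
      fix x assume x: "x \<in> E"
      then obtain j where "j \<in> C" "x \<in> ball j (5 * r j)"
        using C(4)[OF x] r(1)[OF x] by (meson centre_in_cball less_imp_le subsetD)
      then show "x \<in> (\<Union>i. S i)"
        using from_nat_into_surj[OF C(1), of j] by (auto simp: S_def)
    qed
  qed
qed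

text \<open>The Poisson kernel is even and decreases on \<open>[0, \<pi>]\<close>, so it is a mixture of normalized indicator
  functions of centred intervals. In the proof this becomes an integration by parts: with
  \<open>H(t)\<close> the integral of \<open>l - f\<close> over \<open>[x - t, x + t]\<close>, which is nonnegative by hypothesis, the
  integral of \<open>P\<^sub>r H'\<close> equals a nonnegative boundary term minus that of \<open>P\<^sub>r' H \<le> 0\<close>.\<close>

lemma poisson_average_le_centered_averages:
  fixes f :: "real \<Rightarrow> real"
  assumes f: "continuous_on UNIV f" "\<And>t. f (t + 2 * pi) = f t"
    and r: "0 \<le> r" "r < 1"
    and avg: "\<And>t. 0 < t \<Longrightarrow> t \<le> pi \<Longrightarrow> integral {x - t..x + t} f \<le> l * (2 * t)"
  shows "integral {0..2 * pi} (\<lambda>t. poisson r t * f (x + t)) \<le> 2 * pi * l"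
proof -
  define g where "g = (\<lambda>t. l - f (x + t))"
  have cg: "continuous_on A g" for A
    unfolding g_def by (intro continuous_intros continuous_on_compose2[OF f(1)]) auto
  have cp: "continuous_on A (poisson r)" for A using continuous_poisson r by simp
  have int: "(\<lambda>t. poisson r t * g t) integrable_on {a..b}" for a b
    by (intro integrable_continuous_interval continuous_intros cg cp)
  have int': "(\<lambda>t. poisson r t * f (x + t)) integrable_on {a..b}" for a b
    by (intro integrable_continuous_interval continuous_intros cp continuous_on_compose2[OF f(1)]) auto
  have sym: "integral {0..2 * pi} (\<lambda>t. poisson r t * g t) = integral {0..pi} (\<lambda>t. poisson r t * (g t + g (- t)))"
  proof -
    have "integral {0..2 * pi} (\<lambda>t. poisson r t * g t) =
      integral {0..2 * pi / 2} (\<lambda>t. poisson r t * g t + poisson r (- t) * g (- t))"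
    proof (rule integral_periodic_symmetric)
      show "continuous_on UNIV (\<lambda>t. poisson r t * g t)" by (intro continuous_intros cg cp)
      show "poisson r (t + 2 * pi) * g (t + 2 * pi) = poisson r t * g t" for t
        using f(2)[of "x + t"] by (simp add: g_def add.assoc)
    qed simp
    then show ?thesis by (simp add: distrib_left)
  qed
  define H where "H = (\<lambda>t. integral {- t..t} g)"
  have H_ge: "0 \<le> H t" if "0 \<le> t" "t \<le> pi" for t
  proof (cases "t = 0")
    case False
    have "H t = integral {- t..t} (\<lambda>t. l) - integral {- t..t} (\<lambda>t. f (x + t))"
      unfolding H_def g_def
      by (intro Henstock_Kurzweil_Integration.integral_diff integrable_continuous_interval continuous_intros continuous_on_compose2[OF f(1)]) auto
    also have "integral {- t..t} (\<lambda>t. f (x + t)) = integral {x - t..x + t} f"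
      using integral_shift_real_ivl[of "x - t" x "x + t" f] by (simp add: add.commute)
    finally show ?thesis using avg[of t] that False by (simp add: mult_ac)
  qed (simp add: H_def)
  have H_deriv: "(H has_real_derivative g t + g (- t)) (at t within {0..pi})" if t: "t \<in> {0..pi}" for t
  proof -
    define K where "K = (\<lambda>t. integral {- pi..t} g)"
    have K: "(K has_real_derivative g s) (at s within {- pi..pi})" if "s \<in> {- pi..pi}" for s
      unfolding K_def using that by (intro integral_has_real_derivative cg)
    have 1: "(K has_real_derivative g t) (at t within {0..pi})"
      by (rule DERIV_subset[OF K]) (use t in auto)
    have "((K \<circ> uminus) has_real_derivative g (- t) * (- 1)) (at t within {0..pi})"
    proof (rule DERIV_image_chain)
      show "(uminus has_real_derivative - 1) (at t within {0..pi})"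
        by (auto intro!: derivative_eq_intros)
      show "(K has_real_derivative g (- t)) (at (- t) within uminus ` {0..pi})"
        by (rule DERIV_subset[OF K]) (use t in auto)
    qed
    from DERIV_diff[OF 1 this] have "((\<lambda>t. K t - K (- t)) has_real_derivative g t + g (- t)) (at t within {0..pi})"
      by (simp add: o_def)
    moreover have "K s - K (- s) = H s" if "s \<in> {0..pi}" for s
    proof -
      have "K (- s) + H s = K s"
        unfolding K_def H_def using that
        by (intro Henstock_Kurzweil_Integration.integral_combine integrable_continuous_interval cg) auto
      then show ?thesis by simp
    qed
    ultimately show ?thesis
      using has_field_derivative_transform_within[OF _ zero_less_one t] by blast
  qed
  define P' where "P' = (\<lambda>t. - ((1 - r\<^sup>2) * (2 * r * sin t)) / (1 - 2 * r * cos t + r\<^sup>2)\<^sup>2)"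
  have P_deriv: "(poisson r has_real_derivative P' t) (at t within A)" for t A
    unfolding poisson_def P'_def using poisson_denom_pos[of r t] r
    by (auto intro!: derivative_eq_intros simp: power2_eq_square)
  have P'_le: "P' t \<le> 0" if "t \<in> {0..pi}" for t
    using that r sin_ge_zero[of t] unfolding P'_def
    by (intro divide_nonpos_nonneg) (auto intro!: mult_nonneg_nonneg simp: abs_square_le_1)
  have cP': "continuous_on A P'" for A
    unfolding P'_def using poisson_denom_pos[of r] r
    by (intro continuous_intros) (auto simp: less_imp_neq[THEN not_sym])
  have cH: "continuous_on {0..pi} H"
    using H_deriv by (rule DERIV_continuous_on)
  have "((\<lambda>t. poisson r t * (g t + g (- t)) + P' t * H t) has_integral poisson r pi * H pi - poisson r 0 * H 0) {0..pi}"
  proof (rule fundamental_theorem_of_calculus)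
    fix t assume t: "t \<in> {0..pi}"
    from DERIV_mult[OF P_deriv H_deriv[OF t]]
    show "((\<lambda>t. poisson r t * H t) has_vector_derivative poisson r t * (g t + g (- t)) + P' t * H t) (at t within {0..pi})"
      by (simp add: has_real_derivative_iff_has_vector_derivative add.commute mult.commute)
  qed simp
  then have "integral {0..pi} (\<lambda>t. poisson r t * (g t + g (- t)) + P' t * H t) = poisson r pi * H pi"
    by (simp add: integral_unique H_def)
  moreover have "integral {0..pi} (\<lambda>t. poisson r t * (g t + g (- t)) + P' t * H t) \<le>
      integral {0..pi} (\<lambda>t. poisson r t * (g t + g (- t)))"
  proof (rule integral_le)
    show "(\<lambda>t. poisson r t * (g t + g (- t)) + P' t * H t) integrable_on {0..pi}"
      "(\<lambda>t. poisson r t * (g t + g (- t))) integrable_on {0..pi}"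
      by (auto intro!: integrable_continuous_interval continuous_intros cp cg cP' cH continuous_on_compose2[OF cg])
    show "poisson r t * (g t + g (- t)) + P' t * H t \<le> poisson r t * (g t + g (- t))" if "t \<in> {0..pi}" for t
      using P'_le[OF that] H_ge[of t] that by (simp add: mult_nonpos_nonneg)
  qed
  moreover have "0 \<le> poisson r pi * H pi"
    using H_ge[of pi] poisson_nonneg[of r pi] r by simp
  ultimately have "0 \<le> integral {0..2 * pi} (\<lambda>t. poisson r t * g t)" using sym by linarith
  also have "integral {0..2 * pi} (\<lambda>t. poisson r t * g t) =
      integral {0..2 * pi} (\<lambda>t. poisson r t * l) - integral {0..2 * pi} (\<lambda>t. poisson r t * f (x + t))"
    unfolding g_def right_diff_distrib
    by (intro Henstock_Kurzweil_Integration.integral_diff int' integrable_continuous_interval continuous_intros cp)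
  also have "integral {0..2 * pi} (\<lambda>t. poisson r t * l) = 2 * pi * l"
    using integral_unique[OF has_integral_poisson[OF r]] by simp
  finally show ?thesis by simp
qed

section \<open>Radial limits of bounded harmonic functions\<close>

text \<open>For \<open>t < \<rho>\<close>, the difference of \<open>u\<close> at \<open>t e\<^sup>i\<^sup>x\<close> and \<open>R\<^sup>2 t e\<^sup>i\<^sup>x\<close> is a Poisson average of the difference \<open>d\<close>
  of \<open>u\<close> on the circles of radius \<open>\<rho>\<close> and \<open>R\<^sup>2 \<rho>\<close>. Hence \<open>X\<close> lies in the exceptional set of the
  maximal inequality for \<open>\<bar>d\<bar>\<close>.
  By the Cauchy-Schwarz inequality the integral of \<open>\<bar>d\<bar>\<close> is controlled by its mean square, and
  this is a difference of energies.\<close>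

lemma radial_oscillation_set:
  fixes u :: "complex \<Rightarrow> real"
  assumes u: "poisson_reproducing u" and R: "0 \<le> R" "R < 1" and \<rho>: "0 \<le> \<rho>" "\<rho> < 1" and l: "0 < l"
  defines "X \<equiv> {x \<in> {0..2 * pi}. \<exists>t\<in>{0..<\<rho>}. l < \<bar>polar u t x - polar u (R\<^sup>2 * t) x\<bar>}"
  shows "X \<in> lmeasurable"
    "measure lebesgue X \<le> 10 / l * sqrt (2 * pi * (circle_energy u \<rho> - circle_energy u (R\<^sup>2 * \<rho>)))"
proof -
  have c: "continuous_on (ball 0 1) u" using u by (simp add: poisson_reproducing_def)
  have R2: "0 \<le> R\<^sup>2" "R\<^sup>2 < 1" using R mult_less_one[OF R R] by (auto simp: power2_eq_square)
  note R\<rho> = mult_less_one[OF R2 \<rho>]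
  have "open {x. l < \<bar>polar u t x - polar u (R\<^sup>2 * t) x\<bar>}" if "t \<in> {0..<\<rho>}" for t
    using that mult_less_one[OF R2, of t] \<rho>
    by (intro open_Collect_less continuous_intros continuous_polar c) auto
  then have "open (\<Union>t\<in>{0..<\<rho>}. {x. l < \<bar>polar u t x - polar u (R\<^sup>2 * t) x\<bar>})" by blast
  then have "(\<Union>t\<in>{0..<\<rho>}. {x. l < \<bar>polar u t x - polar u (R\<^sup>2 * t) x\<bar>}) \<in> sets lebesgue"
    by (simp add: borel_open)
  then have "{0..2 * pi} \<inter> (\<Union>t\<in>{0..<\<rho>}. {x. l < \<bar>polar u t x - polar u (R\<^sup>2 * t) x\<bar>}) \<in> lmeasurable"
    by (intro fmeasurable_Int_fmeasurable) auto
  moreover have "{0..2 * pi} \<inter> (\<Union>t\<in>{0..<\<rho>}. {x. l < \<bar>polar u t x - polar u (R\<^sup>2 * t) x\<bar>}) = X"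
    by (auto simp: X_def)
  ultimately show X: "X \<in> lmeasurable" by simp
  define d where "d = (\<lambda>x. polar u \<rho> x - polar u (R\<^sup>2 * \<rho>) x)"
  have cd: "continuous_on A d" for A
    unfolding d_def using \<rho> R\<rho> by (intro continuous_intros continuous_polar c)
  have dper: "d (t + 2 * pi) = d t" for t by (simp add: d_def)
  have "\<exists>t. 0 < t \<and> t \<le> pi \<and> l * (2 * t) < integral {x - t..x + t} (\<lambda>x. \<bar>d x\<bar>)" if x: "x \<in> X" for x
  proof (rule ccontr)
    assume "\<not> ?thesis"
    then have avg: "integral {x - t..x + t} (\<lambda>x. \<bar>d x\<bar>) \<le> l * (2 * t)" if "0 < t" "t \<le> pi" for t
      using that by force
    obtain t where t: "0 \<le> t" "t < \<rho>" "l < \<bar>polar u t x - polar u (R\<^sup>2 * t) x\<bar>"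
      using x by (auto simp: X_def)
    define r where "r = t / \<rho>"
    have r: "0 \<le> r" "r < 1" "r * \<rho> = t" "r * (R\<^sup>2 * \<rho>) = R\<^sup>2 * t" using t by (auto simp: r_def)
    have "2 * pi * \<bar>polar u t x - polar u (R\<^sup>2 * t) x\<bar> =
      \<bar>integral {0..2 * pi} (\<lambda>s. poisson r s * polar u \<rho> (x + s)) -
       integral {0..2 * pi} (\<lambda>s. poisson r s * polar u (R\<^sup>2 * \<rho>) (x + s))\<bar>"
      using poisson_integral_polar[OF u \<rho> r(1,2), of x] poisson_integral_polar[OF u R\<rho> r(1,2), of x]
      unfolding r(3,4) by (simp add: abs_mult flip: right_diff_distrib)
    also have "\<dots> = \<bar>integral {0..2 * pi} (\<lambda>s. poisson r s * d (x + s))\<bar>"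
      unfolding d_def right_diff_distrib using \<rho> R\<rho> r
      by (subst Henstock_Kurzweil_Integration.integral_diff)
         (auto intro!: integrable_continuous_interval continuous_intros continuous_poisson
            continuous_on_compose2[OF continuous_polar[OF c, of _ UNIV]])
    also have "\<dots> \<le> integral {0..2 * pi} (\<lambda>s. poisson r s * \<bar>d (x + s)\<bar>)"
    proof -
      have "norm (integral {0..2 * pi} (\<lambda>s. poisson r s * d (x + s))) \<le> integral {0..2 * pi} (\<lambda>s. poisson r s * \<bar>d (x + s)\<bar>)"
        using r poisson_nonneg[of r]
        by (intro integral_norm_bound_integral)
           (auto intro!: integrable_continuous_interval continuous_intros continuous_poisson
            continuous_on_compose2[OF cd[of UNIV]] simp: abs_mult)
      then show ?thesis by simp
    qed
    also have "\<dots> \<le> 2 * pi * l"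
      by (rule poisson_average_le_centered_averages[where f = "\<lambda>x. \<bar>d x\<bar>"])
         (use avg r dper in \<open>auto intro!: continuous_intros cd\<close>)
    finally show False using t(3) by simp
  qed
  moreover have "X \<subseteq> {0..2 * pi}" by (auto simp: X_def)
  ultimately obtain A where A: "A \<in> lmeasurable" "X \<subseteq> A"
    "measure lebesgue A \<le> 5 / l * integral {- pi..3 * pi} (\<lambda>x. \<bar>d x\<bar>)"
    using weak_type_maximal_inequality[of "\<lambda>x. \<bar>d x\<bar>" l X] l
    by (metis abs_ge_zero continuous_on_rabs cd)
  have "measure lebesgue X \<le> measure lebesgue A"
    using A X by (intro measure_mono_fmeasurable) auto
  also note A(3)
  also have "integral {- pi..3 * pi} (\<lambda>x. \<bar>d x\<bar>) = 2 * integral {0..2 * pi} (\<lambda>x. \<bar>d x\<bar>)"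
  proof -
    have ca: "continuous_on A (\<lambda>x. \<bar>d x\<bar>)" for A by (intro continuous_intros cd)
    have "integral {- pi..3 * pi} (\<lambda>x. \<bar>d x\<bar>) = integral {- pi..pi} (\<lambda>x. \<bar>d x\<bar>) + integral {pi..3 * pi} (\<lambda>x. \<bar>d x\<bar>)"
      by (rule Henstock_Kurzweil_Integration.integral_combine[symmetric])
         (auto intro!: integrable_continuous_interval ca)
    also have "integral {- pi..pi} (\<lambda>x. \<bar>d x\<bar>) = integral {0..2 * pi} (\<lambda>x. \<bar>d (x + (- pi))\<bar>)"
      using integral_shift_real_ivl[of "- pi" "- pi" pi "\<lambda>x. \<bar>d x\<bar>"] by simp
    also have "\<dots> = integral {0..2 * pi} (\<lambda>x. \<bar>d x\<bar>)"
      by (rule integral_periodic_shift[where f = "\<lambda>x. \<bar>d x\<bar>"]) (use ca dper in auto)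
    also have "integral {pi..3 * pi} (\<lambda>x. \<bar>d x\<bar>) = integral {0..2 * pi} (\<lambda>x. \<bar>d (x + pi)\<bar>)"
      using integral_shift_real_ivl[of pi pi "3 * pi" "\<lambda>x. \<bar>d x\<bar>"] by simp
    also have "\<dots> = integral {0..2 * pi} (\<lambda>x. \<bar>d x\<bar>)"
      by (rule integral_periodic_shift[where f = "\<lambda>x. \<bar>d x\<bar>"]) (use ca dper in auto)
    finally show ?thesis by simp
  qed
  also have "integral {0..2 * pi} (\<lambda>x. \<bar>d x\<bar>) \<le>
      sqrt (2 * pi * (circle_energy u \<rho> - circle_energy u (R\<^sup>2 * \<rho>)))"
  proof (rule real_le_rsqrt)
    have "(integral {0..2 * pi} (\<lambda>x. \<bar>d x\<bar>))\<^sup>2 \<le> 2 * pi * integral {0..2 * pi} (\<lambda>x. (d x)\<^sup>2)"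
    proof -
      define m where "m = integral {0..2 * pi} (\<lambda>x. \<bar>d x\<bar>)"
      define D where "D = integral {0..2 * pi} (\<lambda>x. (d x)\<^sup>2)"
      \<comment> \<open>The Cauchy-Schwarz inequality, as nonnegativity of a variance.\<close>
      have "0 \<le> integral {0..2 * pi} (\<lambda>x. (2 * pi * \<bar>d x\<bar> - m)\<^sup>2)"
        by (intro integral_nonneg integrable_continuous_interval continuous_intros cd) auto
      also have "\<dots> = integral {0..2 * pi} (\<lambda>x. (2 * pi)\<^sup>2 * (d x)\<^sup>2 - (4 * pi * m) * \<bar>d x\<bar> + m\<^sup>2)"
        by (simp add: power2_diff power_mult_distrib algebra_simps)
      also have "\<dots> = (2 * pi)\<^sup>2 * D - (4 * pi * m) * m + 2 * pi * m\<^sup>2"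
        unfolding D_def m_def
        by (subst Henstock_Kurzweil_Integration.integral_add Henstock_Kurzweil_Integration.integral_diff,
            (intro integrable_continuous_interval continuous_intros cd)+)+ simp
      also have "\<dots> = 2 * pi * (2 * pi * D - m\<^sup>2)" by (simp add: power2_eq_square algebra_simps)
      finally show ?thesis
        unfolding m_def[symmetric] D_def[symmetric] by (simp add: zero_le_mult_iff) (metis pi_gt_zero not_le)
    qed
    also have "integral {0..2 * pi} (\<lambda>x. (d x)\<^sup>2) \<le> circle_energy u \<rho> - circle_energy u (R\<^sup>2 * \<rho>)"
    proof -
      have "circle_energy u (R * (R * \<rho>)) \<le> circle_energy u (R * \<rho>)"
        by (rule circle_energy_mono[OF u R mult_less_one[OF R \<rho>]])
      then show ?thesis
        using circle_energy_difference[OF u R \<rho>] by (simp add: d_def power2_eq_square mult.assoc)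
    qed
    finally show "(integral {0..2 * pi} (\<lambda>x. \<bar>d x\<bar>))\<^sup>2 \<le> 2 * pi * (circle_energy u \<rho> - circle_energy u (R\<^sup>2 * \<rho>))"
      by simp
  qed
  finally show "measure lebesgue X \<le> 10 / l * sqrt (2 * pi * (circle_energy u \<rho> - circle_energy u (R\<^sup>2 * \<rho>)))"
    using l by (simp add: divide_right_mono mult_left_mono)
qed

lemma circle_energy_mono':
  fixes u :: "complex \<Rightarrow> real"
  assumes u: "poisson_reproducing u" and ab: "0 \<le> a" "a \<le> b" "b < 1"
  shows "circle_energy u a \<le> circle_energy u b"
proof (cases "a = b")
  case False
  then have b: "0 < b" "0 \<le> a / b" "a / b < 1" using ab by auto
  then show ?thesis using circle_energy_mono[OF u b(2,3), of b] ab by simp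
qed simp

lemma cauchy_at_left_imp_limit:
  fixes f :: "real \<Rightarrow> real"
  assumes "\<And>e. 0 < e \<Longrightarrow> \<exists>d<1. \<forall>s t. d < s \<and> s < 1 \<and> d < t \<and> t < 1 \<longrightarrow> \<bar>f s - f t\<bar> \<le> e"
  shows "\<exists>L. (f \<longlongrightarrow> L) (at_left 1)"
proof -
  define a where "a = (\<lambda>n. 1 - 1 / real (Suc n))"
  have a1: "a n < 1" for n by (simp add: a_def)
  have ad: "\<exists>N. \<forall>n\<ge>N. d < a n" if d: "d < 1" for d
  proof -
    obtain N where N: "inverse (real (Suc N)) < 1 - d" using reals_Archimedean[of "1 - d"] d by auto
    have "d < a n" if "N \<le> n" for n
    proof -
      have "inverse (real (Suc n)) \<le> inverse (real (Suc N))" using that by simp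
      then show ?thesis using N by (simp add: a_def inverse_eq_divide)
    qed
    then show ?thesis by blast
  qed
  have "Cauchy (\<lambda>n. f (a n))"
  proof (rule metric_CauchyI)
    fix e :: real assume "0 < e"
    then obtain d where d: "d < 1" "\<And>s t. d < s \<Longrightarrow> s < 1 \<Longrightarrow> d < t \<Longrightarrow> t < 1 \<Longrightarrow> \<bar>f s - f t\<bar> \<le> e / 2"
      using assms[of "e / 2"] by auto
    obtain N where "\<forall>n\<ge>N. d < a n" using ad d(1) by blast
    then have "\<bar>f (a m) - f (a n)\<bar> \<le> e / 2" if "N \<le> m" "N \<le> n" for m n
      using that by (intro d(2) a1) auto
    then have "\<forall>m\<ge>N. \<forall>n\<ge>N. dist (f (a m)) (f (a n)) < e"
      using \<open>0 < e\<close> by (fastforce simp: dist_real_def)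
    then show "\<exists>M. \<forall>m\<ge>M. \<forall>n\<ge>M. dist (f (a m)) (f (a n)) < e" by blast
  qed
  then obtain L where L: "(\<lambda>n. f (a n)) \<longlonglongrightarrow> L"
    using Cauchy_convergent_iff convergent_def by blast
  have "(f \<longlongrightarrow> L) (at_left 1)"
  proof (rule tendstoI)
    fix e :: real assume e: "0 < e"
    then obtain d where d: "d < 1" "\<And>s t. d < s \<Longrightarrow> s < 1 \<Longrightarrow> d < t \<Longrightarrow> t < 1 \<Longrightarrow> \<bar>f s - f t\<bar> \<le> e / 2"
      using assms[of "e / 2"] by auto
    obtain N where N: "\<forall>n\<ge>N. d < a n" using ad d(1) by blast
    have "dist (f s) L < e" if s: "d < s" "s < 1" for s
    proof -
      have "(\<lambda>n. \<bar>f s - f (a n)\<bar>) \<longlonglongrightarrow> \<bar>f s - L\<bar>" by (intro tendsto_intros L)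
      moreover have "\<forall>\<^sub>F n in sequentially. \<bar>f s - f (a n)\<bar> \<le> e / 2"
      proof -
        have "\<bar>f s - f (a n)\<bar> \<le> e / 2" if "N \<le> n" for n
          using N that s a1 by (intro d(2)) auto
        then show ?thesis by (auto simp: eventually_sequentially)
      qed
      ultimately have "\<bar>f s - L\<bar> \<le> e / 2" by (rule tendsto_upperbound) simp
      then show ?thesis using e by (simp add: dist_real_def)
    qed
    then show "\<forall>\<^sub>F s in at_left 1. dist (f s) L < e"
      unfolding eventually_at_left[OF d(1)] using d(1) by blast
  qed
  then show ?thesis by blast
qed

text \<open>The energies increase to a finite limit, so their differences near radius \<open>1\<close> are small. Hence for
  every \<open>l\<close> there are \<open>R < 1\<close> for which \<open>\<bar>u(t e\<^sup>i\<^sup>x) - u(R\<^sup>2 t e\<^sup>i\<^sup>x)\<bar> \<le> l\<close> holds for all \<open>t\<close>, outside a set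
  of \<open>x\<close> of arbitrarily small measure. As \<open>t\<close> tends to \<open>1\<close>, the second value converges by the
  continuity of \<open>u\<close> inside the disk, so the oscillation of the first one at \<open>1\<close> is at most of order
  \<open>l\<close>.\<close>

proposition fatou_radial_limits:
  fixes u :: "complex \<Rightarrow> real"
  assumes u: "poisson_reproducing u" and M: "\<And>z. z \<in> ball 0 1 \<Longrightarrow> \<bar>u z\<bar> \<le> M"
  obtains N where "negligible N"
    "\<And>x. x \<in> {0..2 * pi} \<Longrightarrow> x \<notin> N \<Longrightarrow> \<exists>L. ((\<lambda>r. polar u r x) \<longlongrightarrow> L) (at_left 1)"
proof -
  have c: "continuous_on (ball 0 1) u" using u by (simp add: poisson_reproducing_def)
  \<comment> \<open>The set of \<open>radial_oscillation_set\<close>; it increases with \<open>\<rho>\<close>, and \<open>\<rho> = 1\<close> is reached as a limit.\<close>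
  define X where "X = (\<lambda>l R \<rho>. {x \<in> {0..2 * pi}. \<exists>t\<in>{0..<\<rho>}. l < \<bar>polar u t x - polar u (R\<^sup>2 * t) x\<bar>})"
  have E_bound: "circle_energy u r \<le> integral {0..2 * pi} (\<lambda>t. M\<^sup>2)" if r: "r \<in> {0..<1}" for r
    unfolding circle_energy_def
  proof (rule integral_le)
    show "(\<lambda>t. (polar u r t)\<^sup>2) integrable_on {0..2 * pi}"
      using r by (intro integrable_continuous_interval continuous_intros continuous_polar c) auto
    show "(polar u r t)\<^sup>2 \<le> M\<^sup>2" for t
      using M[of "of_real r * cis t"] r by (auto simp: polar_def norm_mult intro!: abs_le_square_iff[THEN iffD1])
  qed auto
  have bdd: "bdd_above (circle_energy u ` {0..<1})"
    by (rule bdd_aboveI2[OF E_bound])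
  define N1 where "N1 = (SUP r\<in>{0..<1}. circle_energy u r)"
  have small: "\<exists>R\<in>{0..<1}. X l R 1 \<in> lmeasurable \<and> measure lebesgue (X l R 1) \<le> e" if l: "0 < l" and e: "0 < e" for l e
  proof -
    define \<epsilon> where "\<epsilon> = (e * l / 10)\<^sup>2 / (2 * pi)"
    have \<epsilon>: "0 < \<epsilon>" using l e by (simp add: \<epsilon>_def)
    then have "N1 - \<epsilon> < N1" by simp
    then obtain r0 where r0: "r0 \<in> {0..<1}" "N1 - \<epsilon> < circle_energy u r0"
      unfolding N1_def using less_cSUP_iff[OF _ bdd] by auto
    \<comment> \<open>The cube root ensures \<open>r0 \<le> R\<^sup>2 \<rho>\<close> for all \<open>\<rho> \<ge> R\<close>.\<close>
    define R where "R = root 3 r0"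
    have R: "0 \<le> R" "R < 1" "R ^ 3 = r0" using r0 by (auto simp: R_def)
    have bound: "measure lebesgue (X l R \<rho>) \<le> e" if \<rho>: "R \<le> \<rho>" "\<rho> < 1" for \<rho>
    proof -
      have "r0 \<le> R\<^sup>2 * \<rho>" using R \<rho> mult_left_mono[of R \<rho> "R\<^sup>2"] by (simp add: power3_eq_cube power2_eq_square)
      moreover have "R\<^sup>2 * \<rho> < 1" using R \<rho> mult_less_one[of R "R * \<rho>"] mult_less_one[of R \<rho>] by (simp add: power2_eq_square mult.assoc)
      ultimately have "circle_energy u r0 \<le> circle_energy u (R\<^sup>2 * \<rho>)"
        using r0 by (intro circle_energy_mono'[OF u]) auto
      moreover have "circle_energy u \<rho> \<le> N1"
        unfolding N1_def using R \<rho> by (intro cSUP_upper bdd) auto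
      ultimately have le: "circle_energy u \<rho> - circle_energy u (R\<^sup>2 * \<rho>) \<le> \<epsilon>" using r0 by linarith
      have "measure lebesgue (X l R \<rho>) \<le> 10 / l * sqrt (2 * pi * (circle_energy u \<rho> - circle_energy u (R\<^sup>2 * \<rho>)))"
        unfolding X_def using R \<rho> l by (intro radial_oscillation_set u) auto
      also have "\<dots> \<le> 10 / l * sqrt (2 * pi * \<epsilon>)"
        using le l by (intro mult_left_mono real_sqrt_le_mono) auto
      also have "\<dots> = e" using l e by (simp add: \<epsilon>_def)
      finally show ?thesis .
    qed
    define \<rho> where "\<rho> = (\<lambda>n. 1 - (1 - R) / real (Suc n))"
    have \<rho>: "R \<le> \<rho> n" "\<rho> n < 1" "\<rho> n \<le> \<rho> (Suc n)" for n
    proof -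
      have "(1 - R) / real (Suc n) \<le> (1 - R) / 1" using R by (intro divide_left_mono) auto
      then show "R \<le> \<rho> n" by (simp add: \<rho>_def)
      show "\<rho> n < 1" using R by (simp add: \<rho>_def)
      show "\<rho> n \<le> \<rho> (Suc n)" unfolding \<rho>_def using R by (intro diff_left_mono divide_left_mono) auto
    qed
    have meas: "X l R (\<rho> n) \<in> lmeasurable" for n
      unfolding X_def using R \<rho>[of n] l by (intro radial_oscillation_set u) auto
    have nest: "X l R (\<rho> n) \<subseteq> X l R (\<rho> (Suc n))" for n
      unfolding X_def using \<rho>(3)[of n] by fastforce
    have U: "(\<Union>n. X l R (\<rho> n)) = X l R 1"
    proof
      show "(\<Union>n. X l R (\<rho> n)) \<subseteq> X l R 1"
      proof -
        have "{0..<\<rho> n} \<subseteq> {0..<1}" for n using \<rho>(2)[of n] by auto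
        then show ?thesis unfolding X_def by blast
      qed
      show "X l R 1 \<subseteq> (\<Union>n. X l R (\<rho> n))"
      proof
        fix x assume "x \<in> X l R 1"
        then obtain t where t: "x \<in> {0..2 * pi}" "0 \<le> t" "t < 1" "l < \<bar>polar u t x - polar u (R\<^sup>2 * t) x\<bar>"
          by (auto simp: X_def)
        obtain n where "inverse (real (Suc n)) < 1 - t" using reals_Archimedean[of "1 - t"] t by auto
        moreover have "(1 - R) / real (Suc n) \<le> 1 / real (Suc n)" using R by (intro divide_right_mono) auto
        ultimately have "t < \<rho> n" by (simp add: \<rho>_def inverse_eq_divide)
        then have "x \<in> X l R (\<rho> n)" using t by (auto simp: X_def)
        then show "x \<in> (\<Union>n. X l R (\<rho> n))" by blast
      qed
    qed
    note lim = measure_nested_Union[where S = "\<lambda>n. X l R (\<rho> n)" and B = e, OF meas bound[OF \<rho>(1,2)] nest, unfolded U]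
    have "X l R 1 \<in> lmeasurable"
      using measurable_nested_Union[where S = "\<lambda>n. X l R (\<rho> n)" and B = e, OF meas bound[OF \<rho>(1,2)] nest] by (simp add: U)
    moreover have "measure lebesgue (X l R 1) \<le> e"
      by (rule LIMSEQ_le_const2[OF lim]) (use bound \<rho> in blast)
    ultimately show ?thesis using R by auto
  qed
  define N where "N = (\<Union>m::nat. \<Inter>R\<in>{0..<1}. X (1 / Suc m) R 1)"
  have "negligible (\<Inter>R\<in>{0..<1}. X l R 1)" if "0 < l" for l
    unfolding negligible_outer_le using small[OF that] by (meson INT_lower)
  then have "negligible N" unfolding N_def by (intro negligible_Union_nat) auto
  moreover have "\<exists>L. ((\<lambda>r. polar u r x) \<longlongrightarrow> L) (at_left 1)" if x: "x \<in> {0..2 * pi}" "x \<notin> N" for x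
  proof (rule cauchy_at_left_imp_limit)
    fix e :: real assume e: "0 < e"
    obtain m where m: "inverse (real (Suc m)) < e / 4" using reals_Archimedean[of "e / 4"] e by auto
    have "\<exists>R\<in>{0..<1}. x \<notin> X (1 / Suc m) R 1"
      using x(2) unfolding N_def by blast
    then obtain R where R: "0 \<le> R" "R < 1" "x \<notin> X (1 / Suc m) R 1" by auto
    have le: "\<bar>polar u t x - polar u (R\<^sup>2 * t) x\<bar> \<le> e / 4" if "0 \<le> t" "t < 1" for t
    proof -
      have "\<bar>polar u t x - polar u (R\<^sup>2 * t) x\<bar> \<le> 1 / Suc m"
        using R(3) x(1) that by (force simp: X_def)
      then show ?thesis using m by (simp add: inverse_eq_divide)
    qed
    have R2: "0 \<le> R\<^sup>2" "R\<^sup>2 < 1" using R mult_less_one[OF R(1,2) R(1,2)] by (auto simp: power2_eq_square)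
    have "continuous_on {0..1} (\<lambda>t. polar u (R\<^sup>2 * t) x)"
      by (intro continuous_on_compose2[OF continuous_polar_radial[OF c]] continuous_intros)
         (use R2 mult_left_mono[of _ 1 "R\<^sup>2"] in force)
    from this[unfolded continuous_on_def, THEN bspec, of 1]
    have "((\<lambda>t. polar u (R\<^sup>2 * t) x) \<longlongrightarrow> polar u (R\<^sup>2 * 1) x) (at 1 within {0..1})"
      by simp
    then have "((\<lambda>t. polar u (R\<^sup>2 * t) x) \<longlongrightarrow> polar u (R\<^sup>2 * 1) x) (at_left 1)"
      by (simp add: at_within_Icc_at_left)
    from tendstoD[OF this, of "e / 4"] e
    obtain d where d: "d < 1" "\<And>t. d < t \<Longrightarrow> t < 1 \<Longrightarrow> \<bar>polar u (R\<^sup>2 * t) x - polar u (R\<^sup>2) x\<bar> < e / 4"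
      unfolding eventually_at_left[OF zero_less_one] by (auto simp: dist_real_def)
    have "\<bar>polar u s x - polar u t x\<bar> \<le> e" if st: "max d 0 < s" "s < 1" "max d 0 < t" "t < 1" for s t
    proof -
      have "\<bar>polar u (R\<^sup>2 * s) x - polar u (R\<^sup>2) x\<bar> < e / 4" "\<bar>polar u (R\<^sup>2 * t) x - polar u (R\<^sup>2) x\<bar> < e / 4"
        "\<bar>polar u s x - polar u (R\<^sup>2 * s) x\<bar> \<le> e / 4" "\<bar>polar u t x - polar u (R\<^sup>2 * t) x\<bar> \<le> e / 4"
        using d(2)[of s] d(2)[of t] le[of s] le[of t] st by auto
      then show ?thesis unfolding abs_le_iff abs_less_iff by linarith
    qed
    then show "\<exists>d<1. \<forall>s t. d < s \<and> s < 1 \<and> d < t \<and> t < 1 \<longrightarrow> \<bar>polar u s x - polar u t x\<bar> \<le> e"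
      using d(1) by (intro exI[of _ "max d 0"]) auto
  qed
  ultimately show ?thesis using that by blast
qed

section \<open>A discrete Riesz-Fejer inequality\<close>

text \<open>The argument of \<open>1 - x e\<^sup>-\<^sup>i\<^sup>t\<close>, that is, half of the periodic part of a primitive of the Poisson
  kernel.\<close>

definition kernel_angle :: "real \<Rightarrow> real \<Rightarrow> real" where
  "kernel_angle x t = arctan (x * sin t / (1 - x * cos t))"

lemma one_minus_cos_pos:
  fixes x t :: real
  assumes "0 \<le> x" "x < 1"
  shows "0 < 1 - x * cos t"
proof -
  have "x * cos t \<le> x * 1" using assms by (intro mult_left_mono) auto
  then show ?thesis using assms by simp
qed

lemma divide_by_one_plus_square:
  fixes c :: real
  assumes "c \<noteq> 0"
  shows "(a / (c * c)) / (1 + (b / c)\<^sup>2) = a / (c\<^sup>2 + b\<^sup>2)"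
proof -
  have "1 + (b / c)\<^sup>2 = (c\<^sup>2 + b\<^sup>2) / (c * c)"
    using assms by (simp add: field_simps power2_eq_square)
  then show ?thesis using assms by simp
qed

lemma kernel_angle_deriv:
  assumes "0 \<le> x" "x < 1"
  shows "(kernel_angle x has_real_derivative (poisson x t - 1) / 2) (at t)"
proof -
  let ?c = "1 - x * cos t" and ?D = "1 - 2 * x * cos t + x\<^sup>2"
  have c: "?c > 0" by (rule one_minus_cos_pos[OF assms])
  have D: "?D > 0" using poisson_denom_pos[of x t] assms by simp
  have sc: "(sin t)\<^sup>2 = 1 - (cos t)\<^sup>2" by (simp add: sin_squared_eq)
  have D2: "?c\<^sup>2 + (x * sin t)\<^sup>2 = ?D"
    by (simp add: power_mult_distrib sc) (simp add: power2_eq_square algebra_simps)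
  have "(kernel_angle x has_real_derivative
      ((x * cos t * ?c - x * sin t * (x * sin t)) / (?c * ?c)) / (1 + (x * sin t / ?c)\<^sup>2)) (at t)"
    unfolding kernel_angle_def using c
    by (auto intro!: derivative_eq_intros simp: divide_simps)
  also have "((x * cos t * ?c - x * sin t * (x * sin t)) / (?c * ?c)) / (1 + (x * sin t / ?c)\<^sup>2) =
     (x * cos t * ?c - x * sin t * (x * sin t)) / (?c\<^sup>2 + (x * sin t)\<^sup>2)"
    using c by (intro divide_by_one_plus_square) simp
  also have "x * cos t * ?c - x * sin t * (x * sin t) = x * cos t - x\<^sup>2"
    using sc by (simp add: power2_eq_square algebra_simps) (simp add: algebra_simps flip: distrib_left)
  also have "(x * cos t - x\<^sup>2) / (?c\<^sup>2 + (x * sin t)\<^sup>2) = (poisson x t - 1) / 2"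
    unfolding D2 poisson_def using D by (simp add: field_simps)
  finally show ?thesis .
qed

lemma kernel_angle_periodic [simp]: "kernel_angle x (t + 2 * pi) = kernel_angle x t"
  by (simp add: kernel_angle_def)

lemma continuous_kernel_angle:
  assumes "0 \<le> x" "x < 1"
  shows "continuous_on A (kernel_angle x)"
  using kernel_angle_deriv[OF assms] by (meson DERIV_isCont continuous_at_imp_continuous_on)

lemma kernel_angle_mono:
  assumes "0 \<le> x" "x \<le> y" "y < 1"
  shows "0 \<le> sin t \<Longrightarrow> kernel_angle x t \<le> kernel_angle y t"
    and "sin t \<le> 0 \<Longrightarrow> kernel_angle y t \<le> kernel_angle x t"
proof -
  let ?f = "\<lambda>x. x / (1 - x * cos t)"
  have "0 < 1 - x * cos t" "0 < 1 - y * cos t"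
    using one_minus_cos_pos assms by auto
  then have le: "?f x \<le> ?f y" using assms by (simp add: divide_simps) (simp add: algebra_simps)
  show "kernel_angle x t \<le> kernel_angle y t" if "0 \<le> sin t"
    unfolding kernel_angle_def using mult_right_mono[OF le that] by (intro arctan_monotone') simp
  show "kernel_angle y t \<le> kernel_angle x t" if "sin t \<le> 0"
    unfolding kernel_angle_def using mult_right_mono_neg[OF le that] by (intro arctan_monotone') simp
qed

text \<open>For fixed \<open>t\<close> the angle is monotone in \<open>x\<close>, starts from \<open>0\<close> and stays within a quarter turn. This is
  the source of the factor one half in the final estimate.\<close>

lemma kernel_angle_variation:
  assumes x: "mono x" "\<And>i. x i \<in> {0..<1}"
  shows "(\<Sum>j<m. \<bar>kernel_angle (x (Suc j)) t - kernel_angle (x j) t\<bar>) \<le> pi / 2"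
proof -
  have x': "0 \<le> x j" "x j \<le> x (Suc j)" "x j < 1" for j
    using x by (auto simp: mono_def)
  define s where "s = (if 0 \<le> sin t then 1 else (-1::real))"
  have "\<bar>kernel_angle (x (Suc j)) t - kernel_angle (x j) t\<bar> = s * kernel_angle (x (Suc j)) t - s * kernel_angle (x j) t" for j
    using kernel_angle_mono[OF x'(1)[of j] x'(2)[of j] x'(3)[of "Suc j"], of t] by (auto simp: s_def)
  then have "(\<Sum>j<m. \<bar>kernel_angle (x (Suc j)) t - kernel_angle (x j) t\<bar>) = s * kernel_angle (x m) t - s * kernel_angle (x 0) t"
    by (simp add: sum_lessThan_telescope[of "\<lambda>j. s * kernel_angle (x j) t"])
  also have "\<dots> \<le> pi / 2"
  proof -
    have k0: "kernel_angle 0 t = 0" by (simp add: kernel_angle_def)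
    have "0 \<le> s * kernel_angle (x 0) t"
      using kernel_angle_mono[of 0 "x 0" t] x'(1,3)[of 0] by (auto simp: s_def k0)
    moreover have "s * kernel_angle (x m) t \<le> pi / 2"
      using arctan_bounded[of "x m * sin t / (1 - x m * cos t)"] by (auto simp: s_def kernel_angle_def)
    ultimately show ?thesis by linarith
  qed
  finally show ?thesis .
qed

text \<open>A difference quotient is used in place of the derivative because integration by parts then becomes
  a translation of the variable and needs no derivative of the harmonic map.\<close>

lemma difference_quotient_uniform:
  fixes B :: "real \<Rightarrow> real"
  assumes B: "\<And>t. (B has_real_derivative B' t) (at t)" and B': "continuous_on UNIV B'" and e: "0 < e"
  obtains d where "0 < d"
    "\<And>h t. 0 < h \<Longrightarrow> h < d \<Longrightarrow> t \<in> {0..2 * pi} \<Longrightarrow> \<bar>B' t - (B t - B (t - h)) / h\<bar> \<le> e"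
proof -
  have "uniformly_continuous_on {-1..2 * pi} B'"
    by (rule compact_uniformly_continuous[OF continuous_on_subset[OF B']]) auto
  then obtain d where d: "0 < d" "\<And>s t. s \<in> {-1..2 * pi} \<Longrightarrow> t \<in> {-1..2 * pi} \<Longrightarrow> dist t s < d \<Longrightarrow> dist (B' t) (B' s) < e"
    using e unfolding uniformly_continuous_on_def by metis
  show ?thesis
  proof (rule that[of "min d 1"])
    fix h t assume h: "0 < h" "h < min d 1" and t: "t \<in> {0..2 * pi}"
    have "\<exists>z>t - h. z < t \<and> B t - B (t - h) = (t - (t - h)) * B' z"
      using h by (intro MVT2 B) auto
    then obtain z where z: "t - h < z" "z < t" "B t - B (t - h) = h * B' z" by auto
    then have "dist (B' t) (B' z) < e" using h t by (intro d(2)) (auto simp: dist_real_def)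
    then show "\<bar>B' t - (B t - B (t - h)) / h\<bar> \<le> e" using z h by (simp add: dist_real_def)
  qed (use d in auto)
qed

text \<open>By the Poisson formula, the difference of \<open>u\<close> at the points \<open>\<rho> y\<close> and \<open>\<rho> x\<close> of the real axis is the
  integral of \<open>u\<close> over the circle of radius \<open>\<rho>\<close> against a multiple of the derivative of
  \<open>K = kernel_angle y - kernel_angle x\<close>. Replacing this derivative by a difference quotient costs at most
  \<open>e\<close> pointwise, and moving the translation by \<open>h\<close> from \<open>K\<close> to \<open>u\<close> leaves the increments of \<open>u\<close>.\<close>

lemma chord_estimate:
  fixes u :: "complex \<Rightarrow> 'a::euclidean_space"
  assumes u: "poisson_reproducing u" and M: "\<And>z. z \<in> ball 0 1 \<Longrightarrow> norm (u z) \<le> M"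
    and xy: "0 \<le> x" "x < 1" "0 \<le> y" "y < 1" and \<rho>: "0 \<le> \<rho>" "\<rho> < 1" and h: "0 < h"
    and B: "\<And>t. t \<in> {0..2 * pi} \<Longrightarrow>
      \<bar>(poisson y t - poisson x t) / 2 - ((kernel_angle y t - kernel_angle x t) - (kernel_angle y (t - h) - kernel_angle x (t - h))) / h\<bar> \<le> e"
  shows "pi * norm (polar u (y * \<rho>) 0 - polar u (x * \<rho>) 0) \<le>
     1 / h * integral {0..2 * pi} (\<lambda>t. \<bar>kernel_angle y t - kernel_angle x t\<bar> * norm (polar u \<rho> (t + h) - polar u \<rho> t)) + 2 * pi * e * M"
proof -
  have c: "continuous_on (ball 0 1) u" using u by (simp add: poisson_reproducing_def)
  define T where "T = polar u \<rho>"
  define K where "K = (\<lambda>t. kernel_angle y t - kernel_angle x t)"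
  have cT: "continuous_on A T" for A unfolding T_def by (rule continuous_polar[OF c \<rho>])
  have cK: "continuous_on A K" for A
    unfolding K_def by (intro continuous_intros continuous_kernel_angle xy)
  note cs = continuous_on_compose2[OF cT[of UNIV]] continuous_on_compose2[OF cK[of UNIV]]
  have cP: "continuous_on A (poisson x)" "continuous_on A (poisson y)" for A
    using continuous_poisson xy by auto
  have TM: "norm (T t) \<le> M" for t
    using M[of "of_real \<rho> * cis t"] \<rho> by (simp add: T_def polar_def norm_mult)
  have Tper: "T (t + 2 * pi) = T t" and Kper: "K (t + 2 * pi) = K t" for t
    by (simp_all add: T_def K_def)
  let ?Q = "\<lambda>t. (K t - K (t - h)) / h" and ?P = "\<lambda>t. (poisson y t - poisson x t) / 2"
  have "((\<lambda>t. (1 / 2) *\<^sub>R (poisson y t *\<^sub>R T t - poisson x t *\<^sub>R T t)) has_integral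
      (1 / 2) *\<^sub>R ((2 * pi) *\<^sub>R polar u (y * \<rho>) 0 - (2 * pi) *\<^sub>R polar u (x * \<rho>) 0)) {0..2 * pi}"
  proof (intro has_integral_cmul has_integral_diff)
    have "((\<lambda>t. poisson r t *\<^sub>R T (0 + t)) has_integral (2 * pi) *\<^sub>R polar u (r * \<rho>) 0) {0..2 * pi}"
      if "0 \<le> r" "r < 1" for r
      using u \<rho> that unfolding poisson_reproducing_def T_def by blast
    then show "((\<lambda>t. poisson x t *\<^sub>R T t) has_integral (2 * pi) *\<^sub>R polar u (x * \<rho>) 0) {0..2 * pi}"
      "((\<lambda>t. poisson y t *\<^sub>R T t) has_integral (2 * pi) *\<^sub>R polar u (y * \<rho>) 0) {0..2 * pi}"
      using xy by simp_all
  qed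
  moreover have "(\<lambda>t. (1 / 2) *\<^sub>R (poisson y t *\<^sub>R T t - poisson x t *\<^sub>R T t)) = (\<lambda>t. ?P t *\<^sub>R T t)"
    by (simp add: fun_eq_iff flip: scaleR_diff_left)
  ultimately have "integral {0..2 * pi} (\<lambda>t. ?P t *\<^sub>R T t) = pi *\<^sub>R (polar u (y * \<rho>) 0 - polar u (x * \<rho>) 0)"
    by (simp add: integral_unique flip: scaleR_diff_right)
  moreover have "integral {0..2 * pi} (\<lambda>t. (?P t - ?Q t) *\<^sub>R T t) =
      integral {0..2 * pi} (\<lambda>t. ?P t *\<^sub>R T t) - integral {0..2 * pi} (\<lambda>t. ?Q t *\<^sub>R T t)"
    unfolding scaleR_diff_left
    by (rule Henstock_Kurzweil_Integration.integral_diff)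
       (use h in \<open>auto intro!: integrable_continuous_interval continuous_intros cT cP cs\<close>)
  ultimately have "pi *\<^sub>R (polar u (y * \<rho>) 0 - polar u (x * \<rho>) 0) =
      integral {0..2 * pi} (\<lambda>t. ?Q t *\<^sub>R T t) + integral {0..2 * pi} (\<lambda>t. (?P t - ?Q t) *\<^sub>R T t)"
    by simp
  then have "norm (pi *\<^sub>R (polar u (y * \<rho>) 0 - polar u (x * \<rho>) 0)) \<le>
     norm (integral {0..2 * pi} (\<lambda>t. ?Q t *\<^sub>R T t)) + norm (integral {0..2 * pi} (\<lambda>t. (?P t - ?Q t) *\<^sub>R T t))"
    by (simp only: norm_triangle_ineq)
  then have "pi * norm (polar u (y * \<rho>) 0 - polar u (x * \<rho>) 0) \<le>
     norm (integral {0..2 * pi} (\<lambda>t. ?Q t *\<^sub>R T t)) + norm (integral {0..2 * pi} (\<lambda>t. (?P t - ?Q t) *\<^sub>R T t))"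
    by simp
  also have "norm (integral {0..2 * pi} (\<lambda>t. (?P t - ?Q t) *\<^sub>R T t)) \<le> integral {0..2 * pi} (\<lambda>t. e * M)"
  proof (rule integral_norm_bound_integral)
    show "norm ((?P t - ?Q t) *\<^sub>R T t) \<le> e * M" if "t \<in> {0..2 * pi}" for t
      using mult_mono[OF B[OF that] TM[of t]] B[OF that] by (simp add: K_def)
  qed (use h in \<open>auto intro!: integrable_continuous_interval continuous_intros cT cP cs\<close>)
  also have "integral {0..2 * pi} (\<lambda>t. e * M) = 2 * pi * e * M" by simp
  also have "integral {0..2 * pi} (\<lambda>t. ?Q t *\<^sub>R T t) =
      (1 / h) *\<^sub>R (integral {0..2 * pi} (\<lambda>t. K t *\<^sub>R T t) - integral {0..2 * pi} (\<lambda>t. K (t - h) *\<^sub>R T t))"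
  proof -
    have "(\<lambda>t. ?Q t *\<^sub>R T t) = (\<lambda>t. (1 / h) *\<^sub>R (K t *\<^sub>R T t - K (t - h) *\<^sub>R T t))"
      by (simp add: fun_eq_iff flip: scaleR_diff_left)
    then have "integral {0..2 * pi} (\<lambda>t. ?Q t *\<^sub>R T t) = (1 / h) *\<^sub>R integral {0..2 * pi} (\<lambda>t. K t *\<^sub>R T t - K (t - h) *\<^sub>R T t)"
      by simp
    also have "integral {0..2 * pi} (\<lambda>t. K t *\<^sub>R T t - K (t - h) *\<^sub>R T t) =
       integral {0..2 * pi} (\<lambda>t. K t *\<^sub>R T t) - integral {0..2 * pi} (\<lambda>t. K (t - h) *\<^sub>R T t)"
      by (rule Henstock_Kurzweil_Integration.integral_diff)
         (auto intro!: integrable_continuous_interval continuous_intros cT cK cs)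
    finally show ?thesis .
  qed
  also have "integral {0..2 * pi} (\<lambda>t. K (t - h) *\<^sub>R T t) = integral {0..2 * pi} (\<lambda>t. K t *\<^sub>R T (t + h))"
  proof -
    have "integral {0..2 * pi} (\<lambda>t. K (t + (- h)) *\<^sub>R T (t + (- h) + h)) = integral {0..2 * pi} (\<lambda>t. K t *\<^sub>R T (t + h))"
    proof (rule integral_periodic_shift[where f = "\<lambda>t. K t *\<^sub>R T (t + h)"])
      show "continuous_on UNIV (\<lambda>t. K t *\<^sub>R T (t + h))" by (auto intro!: continuous_intros cs)
      show "K (t + 2 * pi) *\<^sub>R T (t + 2 * pi + h) = K t *\<^sub>R T (t + h)" for t
        using Tper[of "t + h"] Kper[of t] by (simp add: algebra_simps)
    qed simp
    then show ?thesis by simp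
  qed
  also have "integral {0..2 * pi} (\<lambda>t. K t *\<^sub>R T t) - integral {0..2 * pi} (\<lambda>t. K t *\<^sub>R T (t + h)) =
      integral {0..2 * pi} (\<lambda>t. K t *\<^sub>R (T t - T (t + h)))"
    unfolding scaleR_diff_right
    by (rule Henstock_Kurzweil_Integration.integral_diff[symmetric])
       (auto intro!: integrable_continuous_interval continuous_intros cT cs)
  also have "norm ((1 / h) *\<^sub>R integral {0..2 * pi} (\<lambda>t. K t *\<^sub>R (T t - T (t + h)))) =
      1 / h * norm (integral {0..2 * pi} (\<lambda>t. K t *\<^sub>R (T t - T (t + h))))"
    using h by simp
  also have "norm (integral {0..2 * pi} (\<lambda>t. K t *\<^sub>R (T t - T (t + h)))) \<le>
      integral {0..2 * pi} (\<lambda>t. \<bar>K t\<bar> * norm (T (t + h) - T t))"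
    by (rule integral_norm_bound_integral)
       (auto intro!: integrable_continuous_interval continuous_intros cT cs simp: norm_minus_commute)
  finally show ?thesis using h by (simp add: K_def T_def divide_right_mono)
qed

text \<open>Sum the estimate of a chord over a partition of the radius; the kernel angles then add up to at
  most \<open>\<pi>/2\<close>. What matters for the limit \<open>\<rho> \<rightarrow> 1\<close> is that \<open>d\<close> is chosen independently of \<open>\<rho>\<close>.\<close>

lemma riesz_fejer_discrete:
  fixes u :: "complex \<Rightarrow> 'a::euclidean_space"
  assumes u: "poisson_reproducing u" and M: "\<And>z. z \<in> ball 0 1 \<Longrightarrow> norm (u z) \<le> M"
    and x: "mono x" "\<And>i. x i \<in> {0..<1}" and e: "0 < e"
  shows "\<exists>d>0. \<forall>h \<rho>. 0 < h \<and> h < d \<and> 0 \<le> \<rho> \<and> \<rho> < 1 \<longrightarrow>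
      (\<Sum>j<m. norm (polar u (x (Suc j) * \<rho>) 0 - polar u (x j * \<rho>) 0)) \<le>
      1 / (2 * h) * integral {0..2 * pi} (\<lambda>t. norm (polar u \<rho> (t + h) - polar u \<rho> t)) + e"
proof -
  have c: "continuous_on (ball 0 1) u" using u by (simp add: poisson_reproducing_def)
  have x': "0 \<le> x j" "x j < 1" for j using x(2)[of j] by auto
  have M0: "0 \<le> M" by (rule order_trans[OF norm_ge_zero M[of 0]]) simp
  define D0 where "D0 = 2 * (M + 1) * (real m + 1)"
  have D0: "0 < D0" using M0 by (simp add: D0_def)
  define \<eta> where "\<eta> = e / D0"
  have \<eta>: "0 < \<eta>" "\<eta> * D0 = e" using e D0 by (auto simp: \<eta>_def)
  define K where "K = (\<lambda>j t. kernel_angle (x (Suc j)) t - kernel_angle (x j) t)"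
  have "\<exists>d>0. \<forall>h t. 0 < h \<and> h < d \<and> t \<in> {0..2 * pi} \<longrightarrow>
      \<bar>(poisson (x (Suc j)) t - poisson (x j) t) / 2 - (K j t - K j (t - h)) / h\<bar> \<le> \<eta>" for j
  proof -
    have 1: "(K j has_real_derivative (poisson (x (Suc j)) t - poisson (x j) t) / 2) (at t)" for t
      using DERIV_diff[OF kernel_angle_deriv[OF x'(1)[of "Suc j"] x'(2)[of "Suc j"], of t]
          kernel_angle_deriv[OF x'(1)[of j] x'(2)[of j], of t]]
      by (simp add: K_def diff_divide_distrib)
    have 2: "continuous_on UNIV (\<lambda>t. (poisson (x (Suc j)) t - poisson (x j) t) / 2)"
      using x' by (intro continuous_intros continuous_poisson) auto
    from difference_quotient_uniform[OF 1 2 \<eta>(1)] show ?thesis by metis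
  qed
  then obtain D where D: "\<And>j. 0 < D j"
    "\<And>j h t. 0 < h \<Longrightarrow> h < D j \<Longrightarrow> t \<in> {0..2 * pi} \<Longrightarrow>
      \<bar>(poisson (x (Suc j)) t - poisson (x j) t) / 2 - (K j t - K j (t - h)) / h\<bar> \<le> \<eta>"
    by metis
  define d where "d = Min (insert 1 (D ` {..<m}))"
  have d: "0 < d" "\<And>j. j < m \<Longrightarrow> d \<le> D j" unfolding d_def using D(1) by auto
  show ?thesis
  proof (rule exI[of _ d], intro conjI allI impI, rule d(1))
    fix h \<rho> :: real assume "0 < h \<and> h < d \<and> 0 \<le> \<rho> \<and> \<rho> < 1"
    then have h: "0 < h" "h < d" and \<rho>: "0 \<le> \<rho>" "\<rho> < 1" by auto
    define w where "w = (\<lambda>t. norm (polar u \<rho> (t + h) - polar u \<rho> t))"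
    have cK: "continuous_on A (K j)" for A j
      unfolding K_def by (intro continuous_intros continuous_kernel_angle x')
    have cw: "continuous_on A w" for A
      unfolding w_def by (intro continuous_intros continuous_on_compose2[OF continuous_polar[OF c \<rho>, of UNIV]]) auto
    have "pi * (\<Sum>j<m. norm (polar u (x (Suc j) * \<rho>) 0 - polar u (x j * \<rho>) 0)) \<le>
      (\<Sum>j<m. 1 / h * integral {0..2 * pi} (\<lambda>t. \<bar>K j t\<bar> * w t) + 2 * pi * \<eta> * M)"
      unfolding sum_distrib_left
    proof (rule sum_mono)
      fix j assume "j \<in> {..<m}"
      then show "pi * norm (polar u (x (Suc j) * \<rho>) 0 - polar u (x j * \<rho>) 0) \<le>
          1 / h * integral {0..2 * pi} (\<lambda>t. \<bar>K j t\<bar> * w t) + 2 * pi * \<eta> * M"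
        unfolding K_def w_def
        using d(2)[of j] h D(2)[of h j, unfolded K_def] by (intro chord_estimate u M x' \<rho> h(1)) auto
    qed
    also have "\<dots> = 1 / h * integral {0..2 * pi} (\<lambda>t. (\<Sum>j<m. \<bar>K j t\<bar>) * w t) + real m * (2 * pi * \<eta> * M)"
      unfolding sum_distrib_right
      by (subst integral_sum)
         (auto intro!: integrable_continuous_interval continuous_intros cK cw simp: sum.distrib sum_distrib_left)
    also have "integral {0..2 * pi} (\<lambda>t. (\<Sum>j<m. \<bar>K j t\<bar>) * w t) \<le> integral {0..2 * pi} (\<lambda>t. pi / 2 * w t)"
    proof (rule integral_le)
      show "(\<Sum>j<m. \<bar>K j t\<bar>) * w t \<le> pi / 2 * w t" for t
        using kernel_angle_variation[OF x, of t m] by (intro mult_right_mono) (auto simp: K_def w_def)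
    qed (auto intro!: integrable_continuous_interval continuous_intros cK cw)
    also have "integral {0..2 * pi} (\<lambda>t. pi / 2 * w t) = pi / 2 * integral {0..2 * pi} w" by simp
    also have "real m * (2 * pi * \<eta> * M) \<le> pi * e"
    proof -
      have "real m * (2 * \<eta> * M) \<le> (real m + 1) * (2 * \<eta> * (M + 1))"
        using \<eta>(1) M0 by (intro mult_mono) auto
      also have "\<dots> = \<eta> * D0" by (simp add: D0_def mult_ac)
      also note \<eta>(2)
      finally show ?thesis using mult_left_mono[of _ _ pi] by (simp add: mult_ac)
    qed
    finally have "pi * (\<Sum>j<m. norm (polar u (x (Suc j) * \<rho>) 0 - polar u (x j * \<rho>) 0)) \<le>
        pi * (1 / (2 * h) * integral {0..2 * pi} w + e)"
      using h by (simp add: mult_left_mono divide_right_mono algebra_simps)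
    then show "(\<Sum>j<m. norm (polar u (x (Suc j) * \<rho>) 0 - polar u (x j * \<rho>) 0)) \<le>
      1 / (2 * h) * integral {0..2 * pi} (\<lambda>t. norm (polar u \<rho> (t + h) - polar u \<rho> t)) + e"
      unfolding w_def by simp
  qed
qed

lemma integral_split_periods:
  fixes g :: "real \<Rightarrow> real"
  assumes g: "continuous_on UNIV g" and h: "0 \<le> h"
  shows "integral {0..real n * h} g = integral {0..h} (\<lambda>t. \<Sum>k<n. g (t + real k * h))"
proof (induction n)
  case (Suc n)
  have int: "g integrable_on {a..b}" for a b
    by (rule integrable_continuous_interval[OF continuous_on_subset[OF g]]) simp
  have "integral {0..real (Suc n) * h} g = integral {0..real n * h} g + integral {real n * h..real (Suc n) * h} g"
    using h by (intro Henstock_Kurzweil_Integration.integral_combine[symmetric] int) (auto intro: mult_right_mono)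
  also have "integral {real n * h..real (Suc n) * h} g = integral {0..h} (\<lambda>t. g (t + real n * h))"
    using integral_shift_real_ivl[of "real n * h" "real n * h" "real (Suc n) * h" g] by (simp add: algebra_simps)
  finally show ?case
    unfolding Suc.IH
    by (subst (asm) Henstock_Kurzweil_Integration.integral_add[symmetric])
       (auto intro!: integrable_continuous_interval continuous_intros continuous_on_compose2[OF g])
qed simp

text \<open>With \<open>h = 2\<pi>/n\<close>, the integral of the increments over the whole circle is the integral over
  \<open>[0, h]\<close> of the perimeters of inscribed \<open>n\<close>-gons. These are bounded and their limits are at most \<open>l\<close>
  almost everywhere, so dominated convergence for their excess over \<open>l\<close> applies.\<close>

proposition radial_image_length:
  fixes u :: "complex \<Rightarrow> 'a::euclidean_space"
  assumes u: "poisson_reproducing u" and M: "\<And>z. z \<in> ball 0 1 \<Longrightarrow> norm (u z) \<le> M"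
    and polygon: "\<And>n. 0 < n \<Longrightarrow> \<exists>N. negligible N \<and> (\<forall>t\<in>{0..2 * pi / real n} - N. \<exists>S\<le>l.
        ((\<lambda>r. \<Sum>k<n. norm (polar u r (t + real (Suc k) * (2 * pi / real n)) - polar u r (t + real k * (2 * pi / real n)))) \<longlongrightarrow> S) (at_left 1))"
    and x: "mono x" "\<And>i. x i \<in> {0..<1}"
  shows "(\<Sum>j<m. norm (polar u (x (Suc j)) 0 - polar u (x j) 0)) \<le> l / 2"
proof (rule field_le_epsilon)
  fix e :: real assume e: "0 < e"
  have c: "continuous_on (ball 0 1) u" using u by (simp add: poisson_reproducing_def)
  have M0: "0 \<le> M" by (rule order_trans[OF norm_ge_zero M[of 0]]) simp
  obtain d where d': "0 < d \<and> (\<forall>h \<rho>. 0 < h \<and> h < d \<and> 0 \<le> \<rho> \<and> \<rho> < 1 \<longrightarrow>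
      (\<Sum>j<m. norm (polar u (x (Suc j) * \<rho>) 0 - polar u (x j * \<rho>) 0)) \<le>
      1 / (2 * h) * integral {0..2 * pi} (\<lambda>t. norm (polar u \<rho> (t + h) - polar u \<rho> t)) + e)"
    using riesz_fejer_discrete[OF u M x e, of m] by (rule exE)
  then have d: "0 < d"
    "\<And>h \<rho>. 0 < h \<Longrightarrow> h < d \<Longrightarrow> 0 \<le> \<rho> \<Longrightarrow> \<rho> < 1 \<Longrightarrow>
      (\<Sum>j<m. norm (polar u (x (Suc j) * \<rho>) 0 - polar u (x j * \<rho>) 0)) \<le>
      1 / (2 * h) * integral {0..2 * pi} (\<lambda>t. norm (polar u \<rho> (t + h) - polar u \<rho> t)) + e"
    by simp_all
  obtain n where n: "2 * pi / d < real n" using reals_Archimedean2 by blast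
  have n0: "0 < n" using n d(1) by (metis divide_pos_pos gr0I less_asym of_nat_0 two_pi_pos)
  define h where "h = 2 * pi / real n"
  have h: "0 < h" "h < d" "real n * h = 2 * pi" using n n0 d(1) by (auto simp: h_def field_simps)
  define S where "S = (\<lambda>r t. \<Sum>k<n. norm (polar u r (t + real (Suc k) * h) - polar u r (t + real k * h)))"
  obtain N where N': "negligible N \<and> (\<forall>t\<in>{0..h} - N. \<exists>s\<le>l. ((\<lambda>r. S r t) \<longlongrightarrow> s) (at_left 1))"
    using polygon[OF n0, folded h_def] unfolding S_def by (rule exE)
  then have N: "negligible N" "\<And>t. t \<in> {0..h} - N \<Longrightarrow> \<exists>s\<le>l. ((\<lambda>r. S r t) \<longlongrightarrow> s) (at_left 1)"
    by blast+
  define \<rho> where "\<rho> = (\<lambda>i. 1 - 1 / real (Suc i))"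
  have \<rho>: "0 \<le> \<rho> i" "\<rho> i < 1" for i by (auto simp: \<rho>_def)
  have "\<rho> \<longlonglongrightarrow> 1 - 0" unfolding \<rho>_def by (intro tendsto_intros LIMSEQ_Suc lim_1_over_n)
  then have \<rho>1: "\<rho> \<longlonglongrightarrow> 1" by simp
  then have \<rho>lim: "filterlim \<rho> (at_left 1) sequentially"
    using \<rho>(2) less_imp_neq[OF \<rho>(2)] by (auto simp: filterlim_at)
  have cS: "continuous_on A (S (\<rho> i))" for A i
    unfolding S_def
    by (intro continuous_intros continuous_on_compose2[OF continuous_polar[OF c \<rho>, of UNIV]]) auto
  have SM: "norm (S (\<rho> i) t) \<le> real n * (2 * M)" for i t
  proof -
    have pM: "norm (polar u (\<rho> i) s) \<le> M" for s
      using M[of "of_real (\<rho> i) * cis s"] \<rho>[of i] by (simp add: polar_def norm_mult)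
    have "norm (polar u (\<rho> i) (t + real (Suc k) * h) - polar u (\<rho> i) (t + real k * h)) \<le> M + M" for k
      by (rule order_trans[OF norm_triangle_ineq4 add_mono[OF pM pM]])
    then have "norm (polar u (\<rho> i) (t + real (Suc k) * h) - polar u (\<rho> i) (t + real k * h)) \<le> 2 * M" for k
      by (simp only: mult_2)
    then have "S (\<rho> i) t \<le> (\<Sum>k<n. 2 * M)" unfolding S_def by (intro sum_mono)
    moreover have "0 \<le> S (\<rho> i) t" unfolding S_def by (intro sum_nonneg) auto
    ultimately show ?thesis by simp
  qed
  have "(\<lambda>i. integral ({0..h} - N) (\<lambda>t. max (S (\<rho> i) t - l) 0)) \<longlonglongrightarrow> integral ({0..h} - N) (\<lambda>t. 0)"
  proof (rule dominated_convergence)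
    have "(\<lambda>t. max (S (\<rho> i) t - l) 0) integrable_on {0..h}" for i
      by (intro integrable_continuous_interval continuous_intros cS)
    then show "(\<lambda>t. max (S (\<rho> i) t - l) 0) integrable_on {0..h} - N" for i
      by (rule integrable_spike_set) (auto intro: negligible_subset[OF N(1)])
    have "(\<lambda>t. real n * (2 * M) + \<bar>l\<bar>) integrable_on {0..h}" by (rule integrable_const_ivl)
    then show "(\<lambda>t. real n * (2 * M) + \<bar>l\<bar>) integrable_on {0..h} - N"
      by (rule integrable_spike_set) (auto intro: negligible_subset[OF N(1)])
    show "norm (max (S (\<rho> i) t - l) 0) \<le> real n * (2 * M) + \<bar>l\<bar>" for i t
      using SM[of i t] by (auto simp: max_def)
    show "(\<lambda>i. max (S (\<rho> i) t - l) 0) \<longlonglongrightarrow> 0" if t: "t \<in> {0..h} - N" for t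
    proof -
      obtain s where s: "s \<le> l" "((\<lambda>r. S r t) \<longlongrightarrow> s) (at_left 1)" using N(2)[OF t] by blast
      have "(\<lambda>i. max (S (\<rho> i) t - l) 0) \<longlonglongrightarrow> max (s - l) 0"
        by (intro tendsto_intros filterlim_compose[OF s(2) \<rho>lim])
      then show ?thesis using s(1) by (simp add: max_def)
    qed
  qed
  then have lim0: "(\<lambda>i. integral {0..h} (\<lambda>t. max (S (\<rho> i) t - l) 0)) \<longlonglongrightarrow> 0"
  proof -
    have "integral ({0..h} - N) f = integral {0..h} f" for f :: "real \<Rightarrow> real"
      by (rule integral_subset_negligible) (auto intro: negligible_subset[OF N(1)])
    then show ?thesis using \<open>(\<lambda>i. integral ({0..h} - N) (\<lambda>t. max (S (\<rho> i) t - l) 0)) \<longlonglongrightarrow> integral ({0..h} - N) (\<lambda>t. 0)\<close> by simp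
  qed
  have le: "(\<Sum>j<m. norm (polar u (x (Suc j) * \<rho> i) 0 - polar u (x j * \<rho> i) 0)) \<le>
      1 / (2 * h) * (h * l + integral {0..h} (\<lambda>t. max (S (\<rho> i) t - l) 0)) + e" for i
  proof -
    have "integral {0..2 * pi} (\<lambda>t. norm (polar u (\<rho> i) (t + h) - polar u (\<rho> i) t)) = integral {0..h} (S (\<rho> i))"
    proof -
      have "continuous_on UNIV (\<lambda>t. norm (polar u (\<rho> i) (t + h) - polar u (\<rho> i) t))"
        by (intro continuous_intros continuous_on_compose2[OF continuous_polar[OF c \<rho>, of UNIV]]) auto
      from integral_split_periods[OF this, of h n] h show ?thesis
        unfolding S_def by (simp add: algebra_simps)
    qed
    also have "\<dots> \<le> integral {0..h} (\<lambda>t. l + max (S (\<rho> i) t - l) 0)"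
      by (rule integral_le) (auto intro!: integrable_continuous_interval continuous_intros cS)
    also have "\<dots> = integral {0..h} (\<lambda>t. l) + integral {0..h} (\<lambda>t. max (S (\<rho> i) t - l) 0)"
      by (rule Henstock_Kurzweil_Integration.integral_add)
         (auto intro!: integrable_continuous_interval continuous_intros cS)
    also have "integral {0..h} (\<lambda>t. l) = h * l" using h by simp
    finally have "1 / (2 * h) * integral {0..2 * pi} (\<lambda>t. norm (polar u (\<rho> i) (t + h) - polar u (\<rho> i) t)) \<le>
      1 / (2 * h) * (h * l + integral {0..h} (\<lambda>t. max (S (\<rho> i) t - l) 0))"
      using h by (intro mult_left_mono) auto
    then show ?thesis using d(2)[OF h(1,2) \<rho>, of i] by linarith
  qed
  have "(\<lambda>i. 1 / (2 * h) * (h * l + integral {0..h} (\<lambda>t. max (S (\<rho> i) t - l) 0)) + e) \<longlonglongrightarrow> 1 / (2 * h) * (h * l + 0) + e"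
    by (intro tendsto_intros lim0)
  moreover have "(\<lambda>i. \<Sum>j<m. norm (polar u (x (Suc j) * \<rho> i) 0 - polar u (x j * \<rho> i) 0)) \<longlonglongrightarrow>
      (\<Sum>j<m. norm (polar u (x (Suc j)) 0 - polar u (x j) 0))"
  proof -
    have "(\<lambda>i. polar u (x j * \<rho> i) 0) \<longlonglongrightarrow> polar u (x j) 0" for j
    proof (rule continuous_on_tendsto_compose[OF continuous_polar_radial[OF c, of 0]])
      show "(\<lambda>i. x j * \<rho> i) \<longlonglongrightarrow> x j" using tendsto_mult_left[OF \<rho>1, of "x j"] by simp
      show "x j \<in> {0..<1}" by (rule x)
      show "\<forall>\<^sub>F i in sequentially. x j * \<rho> i \<in> {0..<1}"
        using x(2)[of j] \<rho> mult_less_one[of "x j"] by auto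
    qed
    then show ?thesis by (intro tendsto_intros)
  qed
  ultimately have "(\<Sum>j<m. norm (polar u (x (Suc j)) 0 - polar u (x j) 0)) \<le> 1 / (2 * h) * (h * l + 0) + e"
    using le by (intro LIMSEQ_le) auto
  then show "(\<Sum>j<m. norm (polar u (x (Suc j)) 0 - polar u (x j) 0)) \<le> l / 2 + e" using h by simp
qed

section \<open>Boundary order of homeomorphisms of the disk\<close>

abbreviation left_half_plane :: "complex set" where
  "left_half_plane \<equiv> {w. Re w < 0}"

lemma convex_left_half_plane: "convex left_half_plane"
  by (rule convex_halfspace_Re_lt)

text \<open>The kernel of the exponential map is discrete. All lifts through \<open>exp\<close> below are compared by means of
  this lemma.\<close>

lemma exp_eq_1_continuous_imp_const:
  fixes q :: "'a::topological_space \<Rightarrow> complex"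
  assumes "connected S" "continuous_on S q" "\<And>w. w \<in> S \<Longrightarrow> exp (q w) = 1"
  obtains m :: int where "\<And>w. w \<in> S \<Longrightarrow> q w = of_int m * (2 * of_real pi * \<i>)"
proof -
  have int: "\<exists>m::int. q w = of_int m * (2 * of_real pi * \<i>)" if w: "w \<in> S" for w
  proof -
    obtain n :: int where "Re (q w) = 0" "Im (q w) = of_int (2 * n) * pi"
      using assms(3)[OF w] exp_eq_1 by blast
    then show ?thesis by (intro exI[of _ n]) (simp add: complex_eq_iff)
  qed
  have "q constant_on S"
  proof (rule continuous_discrete_range_constant[OF assms(1,2)])
    fix x assume x: "x \<in> S"
    have "1 \<le> norm (q y - q x)" if y: "y \<in> S" "q y \<noteq> q x" for y
    proof -
      obtain m n :: int where mn: "q x = of_int m * (2 * of_real pi * \<i>)" "q y = of_int n * (2 * of_real pi * \<i>)"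
        using int x y by blast
      then have "n \<noteq> m" using y by auto
      then have "1 \<le> \<bar>real_of_int (n - m)\<bar>" by linarith
      moreover have "norm (q y - q x) = \<bar>real_of_int (n - m)\<bar> * (2 * pi)"
        unfolding mn left_diff_distrib[symmetric] of_int_diff[symmetric]
        by (simp add: norm_mult del: of_int_diff)
      ultimately show ?thesis
        using pi_ge_two mult_mono[of 1 "\<bar>real_of_int (n - m)\<bar>" 1 "2 * pi"] by simp
    qed
    then show "\<exists>e>0. \<forall>y. y \<in> S \<and> q y \<noteq> q x \<longrightarrow> e \<le> norm (q y - q x)"
      by (intro exI[of _ 1]) auto
  qed
  then obtain c where c: "\<And>w. w \<in> S \<Longrightarrow> q w = c" by (auto simp: constant_on_def)
  show ?thesis
  proof (cases "S = {}")
    case False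
    then obtain w where "w \<in> S" by blast
    then show ?thesis using int c that by metis
  qed (use that in auto)
qed

text \<open>The half plane is the universal cover of the punctured disk by \<open>exp\<close>; the integer \<open>d\<close> is the degree of
  \<open>f\<close> on the punctured disk.\<close>

lemma lift_through_exp:
  assumes f: "continuous_on (ball 0 1) f" "\<And>z. z \<in> ball 0 1 - {0} \<Longrightarrow> f z \<in> ball 0 1 - {0}"
  obtains g :: "complex \<Rightarrow> complex" and d :: int
  where "continuous_on left_half_plane g" "\<And>w. w \<in> left_half_plane \<Longrightarrow> exp (g w) = f (exp w)"
    "\<And>w. w \<in> left_half_plane \<Longrightarrow> g w \<in> left_half_plane"
    "\<And>w k. w \<in> left_half_plane \<Longrightarrow> g (w + of_int k * (2 * of_real pi * \<i>)) = g w + of_int (k * d) * (2 * of_real pi * \<i>)"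
proof -
  let ?H = left_half_plane and ?p = "2 * of_real pi * \<i>"
  have "continuous_on ?H (\<lambda>w. f (exp w))"
    by (intro continuous_on_compose2[OF f(1)] continuous_intros) auto
  moreover have "contractible ?H"
    by (rule convex_imp_contractible[OF convex_left_half_plane])
  moreover have "f (exp w) \<noteq> 0" if "w \<in> ?H" for w
    using f(2)[of "exp w"] that by simp
  ultimately obtain g where g: "continuous_on ?H g" "\<And>w. w \<in> ?H \<Longrightarrow> f (exp w) = exp (g w)"
    using continuous_logarithm_on_contractible by blast
  have gH: "g w \<in> ?H" if "w \<in> ?H" for w
    using f(2)[of "exp w"] that g(2)[OF that] by simp
  have per: "exp (w + ?p) = exp w" for w
    using exp_plus_2pin[of w 1] by (simp add: mult_ac)
  have "continuous_on ?H (\<lambda>w. g (w + ?p) - g w)"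
    by (intro continuous_intros continuous_on_compose2[OF g(1)]) (auto intro: g(1))
  moreover have "exp (g (w + ?p) - g w) = 1" if "w \<in> ?H" for w
    using that per g(2)[of w] g(2)[of "w + ?p"] f(2)[of "exp w"] by (simp add: exp_diff)
  ultimately obtain d :: int where d: "\<And>w. w \<in> ?H \<Longrightarrow> g (w + ?p) - g w = of_int d * ?p"
    using exp_eq_1_continuous_imp_const[OF convex_connected[OF convex_left_half_plane]] by blast
  have "g (w + of_int k * ?p) = g w + of_int (k * d) * ?p" if w: "w \<in> ?H" for w k
  proof (induction k rule: int_induct[where k = 0])
    case base
    show ?case by simp
  next
    case (step1 i)
    have "w + of_int i * ?p \<in> ?H" using w by simp
    from d[OF this] step1 show ?case by (simp add: algebra_simps)
  next
    case (step2 i)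
    have "w + of_int (i - 1) * ?p \<in> ?H" using w by simp
    from d[OF this] step2 show ?case by (simp add: algebra_simps)
  qed
  with g gH show ?thesis using that[of g d] by metis
qed

text \<open>Lift the inverse as well. The composition of the two lifts differs from the identity by a constant
  in the kernel of \<open>exp\<close>; this makes \<open>g\<close> injective, and the degrees of the two maps have product \<open>1\<close>.\<close>

proposition lift_disc_homeomorphism:
  assumes h: "homeomorphism (ball 0 1) (ball 0 1) h k" "h 0 = 0"
  obtains g :: "complex \<Rightarrow> complex" and d :: int
  where "continuous_on left_half_plane g" "\<And>w. w \<in> left_half_plane \<Longrightarrow> exp (g w) = h (exp w)"
    "\<And>w. w \<in> left_half_plane \<Longrightarrow> g w \<in> left_half_plane" "inj_on g left_half_plane"
    "\<And>w. w \<in> left_half_plane \<Longrightarrow> g (w + 2 * of_real pi * \<i>) = g w + of_int d * (2 * of_real pi * \<i>)"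
    "d = 1 \<or> d = -1"
proof -
  let ?H = left_half_plane and ?p = "2 * of_real pi * \<i>"
  have k0: "k 0 = 0" using homeomorphism_apply1[OF h(1), of 0] h(2) by simp
  have hb: "h z \<in> ball 0 1 - {0}" if z: "z \<in> ball 0 1 - {0}" for z
  proof -
    have "h z \<in> ball 0 1" using z homeomorphism_image1[OF h(1)] by blast
    moreover have "h z \<noteq> 0" using z homeomorphism_apply1[OF h(1), of z] k0 by auto
    ultimately show ?thesis by blast
  qed
  have kb: "k z \<in> ball 0 1 - {0}" if z: "z \<in> ball 0 1 - {0}" for z
  proof -
    have "k z \<in> ball 0 1" using z homeomorphism_image2[OF h(1)] by blast
    moreover have "k z \<noteq> 0" using z homeomorphism_apply2[OF h(1), of z] h(2) by auto
    ultimately show ?thesis by blast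
  qed
  obtain g d where g: "continuous_on ?H g" "\<And>w. w \<in> ?H \<Longrightarrow> exp (g w) = h (exp w)" "\<And>w. w \<in> ?H \<Longrightarrow> g w \<in> ?H"
    "\<And>w k. w \<in> ?H \<Longrightarrow> g (w + of_int k * ?p) = g w + of_int (k * d) * ?p"
    using lift_through_exp[OF homeomorphism_cont1[OF h(1)] hb] by blast
  obtain g' d' where g': "continuous_on ?H g'" "\<And>w. w \<in> ?H \<Longrightarrow> exp (g' w) = k (exp w)" "\<And>w. w \<in> ?H \<Longrightarrow> g' w \<in> ?H"
    "\<And>w k. w \<in> ?H \<Longrightarrow> g' (w + of_int k * ?p) = g' w + of_int (k * d') * ?p"
    using lift_through_exp[OF homeomorphism_cont2[OF h(1)] kb] by blast
  have "continuous_on ?H (\<lambda>w. g' (g w) - w)"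
    by (intro continuous_intros continuous_on_compose2[OF g'(1) g(1)]) (use g(3) in blast)
  moreover have "exp (g' (g w) - w) = 1" if "w \<in> ?H" for w
    using that g(2)[OF that] g'(2)[OF g(3)[OF that]] homeomorphism_apply1[OF h(1), of "exp w"]
    by (simp add: exp_diff)
  ultimately obtain m :: int where m: "\<And>w. w \<in> ?H \<Longrightarrow> g' (g w) - w = of_int m * ?p"
    using exp_eq_1_continuous_imp_const[OF convex_connected[OF convex_left_half_plane]] by blast
  have inj: "inj_on g ?H"
  proof (rule inj_onI)
    fix x y assume "x \<in> ?H" "y \<in> ?H" "g x = g y"
    then have "g' (g x) - x = g' (g x) - y" using m[of x] m[of y] by simp
    then show "x = y" by simp
  qed
  have "d * d' = 1"
  proof -
    let ?w = "-1 :: complex"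
    have w: "?w \<in> ?H" "?w + ?p \<in> ?H" by auto
    have "g' (g (?w + ?p)) = g' (g ?w + of_int d * ?p)" using g(4)[OF w(1), of 1] by simp
    also have "\<dots> = g' (g ?w) + of_int (d * d') * ?p" by (rule g'(4)[OF g(3)[OF w(1)]])
    finally have "of_int (d * d') * ?p = g' (g (?w + ?p)) - g' (g ?w)" by simp
    also have "\<dots> = ?p"
      unfolding m[OF w(1), unfolded diff_eq_eq] m[OF w(2), unfolded diff_eq_eq] by simp
    finally have "(of_int (d * d') :: complex) = 1" by simp
    then show ?thesis by (metis of_int_eq_1_iff)
  qed
  then have "d = 1 \<or> d = -1" by (auto simp: zmult_eq_1_iff)
  then show ?thesis
    using that[OF g(1-3) inj] g(4)[of _ 1] by simp
qed

lemma path_extend_limit: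
  fixes f :: "real \<Rightarrow> 'a::t2_space"
  assumes "continuous_on {0<..1} f" "(f \<longlongrightarrow> L) (at_right 0)"
  shows "path (\<lambda>t. if t = 0 then L else f t)"
  unfolding path_def
proof (rule continuous_on_IccI)
  let ?f = "\<lambda>t. if t = 0 then L else f t"
  show "(?f \<longlongrightarrow> ?f 0) (at_right 0)"
    using assms(2) by (auto intro: Lim_transform_eventually simp: eventually_at_filter)
  have "(f \<longlongrightarrow> f 1) (at_left 1)"
  proof -
    have "continuous_on {1/2..1} f" by (rule continuous_on_subset[OF assms(1)]) auto
    then have "(f \<longlongrightarrow> f 1) (at 1 within {1/2..1})" by (simp add: continuous_on_def)
    then show ?thesis by (simp add: at_within_Icc_at_left)
  qed
  then have "(?f \<longlongrightarrow> f 1) (at_left 1)"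
    by (rule Lim_transform_eventually)
       (auto simp: eventually_at_left[OF zero_less_one] intro!: exI[of _ 0])
  then show "(?f \<longlongrightarrow> ?f 1) (at_left 1)" by simp
  show "?f \<midarrow>x\<rightarrow> ?f x" if "0 < x" "x < 1" for x
  proof -
    have "continuous_on {0<..<1} f" by (rule continuous_on_subset[OF assms(1)]) auto
    then have "f \<midarrow>x\<rightarrow> f x" using that by (auto simp: continuous_on_eq_continuous_at isCont_def)
    moreover have "\<forall>\<^sub>F t in at x. f t = ?f t"
      by (rule eventually_mono[OF eventually_at_in_open'[OF open_greaterThan[of 0]]]) (use that in auto)
    ultimately show ?thesis using that by (auto intro: Lim_transform_eventually)
  qed
qed simp

lemma ray_path:
  fixes g :: "complex \<Rightarrow> complex"
  assumes g: "continuous_on left_half_plane g"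
    and lim: "((\<lambda>x. g (Complex x a)) \<longlongrightarrow> L) (at_left 0)" and X: "0 < X"
  defines "p \<equiv> \<lambda>t. if t = 0 then L else g (Complex (- t * X) a)"
  shows "path p" "pathstart p = L" "pathfinish p = g (Complex (- X) a)"
    "path_image p \<subseteq> insert L (g ` {w \<in> left_half_plane. Im w = a})"
proof -
  show "path p"
    unfolding p_def
  proof (rule path_extend_limit)
    have "continuous_on {0<..1} (\<lambda>t. Complex (- t * X) a)"
      unfolding Complex_eq by (intro continuous_intros)
    then show "continuous_on {0<..1} (\<lambda>t. g (Complex (- t * X) a))"
      by (rule continuous_on_compose2[OF g]) (use X in auto)
    have "filterlim (\<lambda>t. - t * X) (at_left 0) (at_right 0)"
      using X by real_asymp
    from filterlim_compose[OF lim this]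
    show "((\<lambda>t. g (Complex (- t * X) a)) \<longlongrightarrow> L) (at_right 0)" .
  qed
  show "pathstart p = L" "pathfinish p = g (Complex (- X) a)"
    by (simp_all add: p_def pathstart_def pathfinish_def)
  show "path_image p \<subseteq> insert L (g ` {w \<in> left_half_plane. Im w = a})"
    using X by (auto simp: p_def path_image_def)
qed

text \<open>Suppose that \<open>\<beta> < \<alpha>\<close>. A path goes from \<open>\<beta>\<close> inwards along the image of ray \<open>b\<close>, then
  across to the image of the ray of angle \<open>a + 2\<pi>\<close> and out to \<open>\<alpha> + 2\<pi>\<close>, all within the image of the
  points of angle greater than \<open>a\<close>. The image of ray \<open>a\<close> starts in between at \<open>\<alpha>\<close> and runs to infinity on
  the left, where it can be led around that path to a point of the axis above \<open>\<alpha> + 2\<pi>\<close>. Interlaced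
  end points on one side of a rectangle force a common point, against injectivity.\<close>

proposition lifted_rays_ordered:
  fixes g :: "complex \<Rightarrow> complex"
  assumes g: "continuous_on left_half_plane g" "inj_on g left_half_plane"
      "\<And>w. w \<in> left_half_plane \<Longrightarrow> g w \<in> left_half_plane"
      "\<And>w. w \<in> left_half_plane \<Longrightarrow> g (w + 2 * of_real pi * \<i>) = g w + 2 * of_real pi * \<i>"
    and deep: "\<And>M. \<exists>X>0. Re (g (Complex (- X) a)) < M"
    and lim: "((\<lambda>x. g (Complex x a)) \<longlongrightarrow> Complex 0 \<alpha>) (at_left 0)"
      "((\<lambda>x. g (Complex x b)) \<longlongrightarrow> Complex 0 \<beta>) (at_left 0)"
    and ab: "a < b" "b \<le> a + 2 * pi"
  shows "\<alpha> \<le> \<beta>"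
proof (rule ccontr)
  assume "\<not> \<alpha> \<le> \<beta>"
  then have less: "\<beta> < \<alpha>" by simp
  let ?H = left_half_plane and ?c = "a + 2 * pi"
  have "((\<lambda>x. g (Complex x a) + 2 * of_real pi * \<i>) \<longlongrightarrow> Complex 0 \<alpha> + 2 * of_real pi * \<i>) (at_left 0)"
    by (intro tendsto_intros lim)
  moreover have "\<forall>\<^sub>F x in at_left 0. g (Complex x a) + 2 * of_real pi * \<i> = g (Complex x ?c)"
  proof -
    have "\<forall>\<^sub>F x in at_left 0. x < (0::real)" by (simp add: eventually_at_filter)
    then show ?thesis
    proof eventually_elim
      case (elim x)
      then show ?case using g(4)[of "Complex x a"] by (simp add: complex_eq_iff Complex_eq algebra_simps)
    qed
  qed
  ultimately have lim3: "((\<lambda>x. g (Complex x ?c)) \<longlongrightarrow> Complex 0 (\<alpha> + 2 * pi)) (at_left 0)"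
    by (auto intro: Lim_transform_eventually simp: Complex_eq algebra_simps)
  \<comment> \<open>A path from the end of ray b to the end of the translate of ray a, avoiding ray a.\<close>
  define p1 where "p1 = (\<lambda>t. if t = 0 then Complex 0 \<beta> else g (Complex (- t * 1) b))"
  define p3 where "p3 = (\<lambda>t. if t = 0 then Complex 0 (\<alpha> + 2 * pi) else g (Complex (- t * 1) ?c))"
  define p2 where "p2 = g \<circ> linepath (Complex (- 1) b) (Complex (- 1) ?c)"
  define p where "p = p1 +++ p2 +++ reversepath p3"
  note p1 = ray_path[OF g(1) lim(2) zero_less_one, folded p1_def]
  note p3 = ray_path[OF g(1) lim3 zero_less_one, folded p3_def]
  have seg: "Re w = -1 \<and> b \<le> Im w \<and> Im w \<le> ?c" if w: "w \<in> closed_segment (Complex (- 1) b) (Complex (- 1) ?c)" for w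
  proof -
    obtain u where u: "0 \<le> u" "u \<le> 1" "w = (1 - u) *\<^sub>R Complex (- 1) b + u *\<^sub>R Complex (- 1) ?c"
      using w by (auto simp: in_segment)
    have "Im w = (1 - u) * b + u * ?c" using u(3) by simp
    then have "Im w = b + u * (?c - b)" by (simp add: algebra_simps)
    moreover have "0 \<le> u * (?c - b)" "u * (?c - b) \<le> 1 * (?c - b)"
      by (rule mult_nonneg_nonneg mult_right_mono; use u ab in linarith)+
    ultimately show ?thesis using u by simp
  qed
  have p2: "path p2" "pathstart p2 = g (Complex (- 1) b)" "pathfinish p2 = g (Complex (- 1) ?c)"
    "path_image p2 \<subseteq> g ` {w \<in> ?H. a < Im w}"
  proof -
    show "path p2"
      unfolding p2_def using seg
      by (intro path_continuous_image continuous_on_subset[OF g(1)]) auto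
    show "path_image p2 \<subseteq> g ` {w \<in> ?H. a < Im w}"
      unfolding p2_def path_image_compose using seg ab by fastforce
  qed (simp_all add: p2_def pathstart_compose pathfinish_compose)
  have p: "path p" "pathstart p = Complex 0 \<beta>" "pathfinish p = Complex 0 (\<alpha> + 2 * pi)"
    using p1 p2 p3 by (auto simp: p_def)
  have imp: "path_image p \<subseteq> {Complex 0 \<beta>, Complex 0 (\<alpha> + 2 * pi)} \<union> g ` {w \<in> ?H. a < Im w}"
  proof -
    have "path_image p \<subseteq> path_image p1 \<union> (path_image p2 \<union> path_image p3)"
      unfolding p_def using p1 p2 p3 by (simp add: path_image_join)
    also have "\<dots> \<subseteq> {Complex 0 \<beta>, Complex 0 (\<alpha> + 2 * pi)} \<union> g ` {w \<in> ?H. a < Im w}"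
    proof -
      have "{w \<in> ?H. Im w = b} \<subseteq> {w \<in> ?H. a < Im w}" "{w \<in> ?H. Im w = ?c} \<subseteq> {w \<in> ?H. a < Im w}"
        using ab pi_gt_zero by auto
      then show ?thesis using p1(4) p2(4) p3(4) by blast
    qed
    finally show ?thesis .
  qed
  obtain B where B: "\<And>z. z \<in> path_image p \<Longrightarrow> norm z \<le> B"
    using compact_imp_bounded[OF compact_path_image[OF p(1)]] by (auto simp: bounded_iff)
  obtain X where X: "X > 0" "Re (g (Complex (- X) a)) < - B" using deep by blast
  \<comment> \<open>Ray a, continued to the far left of that path and around it back to the imaginary axis.\<close>
  define q where "q = g (Complex (- X) a)"
  define c1 where "c1 = (\<lambda>t. if t = 0 then Complex 0 \<alpha> else g (Complex (- t * X) a))"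
  define c where "c = c1 +++ linepath q (Complex (Re q) (B + 1)) +++ linepath (Complex (Re q) (B + 1)) (Complex 0 (B + 1))"
  note c1 = ray_path[OF g(1) lim(1) X(1), folded c1_def q_def]
  have qH: "Re q < 0" using g(3)[of "Complex (- X) a"] X by (simp add: q_def)
  have c: "path c" "pathstart c = Complex 0 \<alpha>" "pathfinish c = Complex 0 (B + 1)"
    using c1 by (auto simp: c_def)
  have seg1: "Re w = Re q" if w: "w \<in> closed_segment q (Complex (Re q) (B + 1))" for w
  proof -
    obtain u where "w = (1 - u) *\<^sub>R q + u *\<^sub>R Complex (Re q) (B + 1)"
      using w unfolding in_segment by blast
    then have "Re w = (1 - u) * Re q + u * Re q" by simp
    then show ?thesis by (simp add: algebra_simps)
  qed
  have seg2: "Im w = B + 1 \<and> Re w \<le> 0" if w: "w \<in> closed_segment (Complex (Re q) (B + 1)) (Complex 0 (B + 1))" for w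
  proof -
    obtain u where u: "0 \<le> u" "u \<le> 1"
      "w = (1 - u) *\<^sub>R Complex (Re q) (B + 1) + u *\<^sub>R Complex 0 (B + 1)"
      using w unfolding in_segment by blast
    then have "Re w = (1 - u) * Re q" "Im w = (1 - u) * (B + 1) + u * (B + 1)" by simp_all
    moreover have "(1 - u) * Re q \<le> 0" using u(1,2) qH by (simp add: mult_nonneg_nonpos)
    ultimately show ?thesis by (simp add: left_diff_distrib)
  qed
  have imc: "path_image c \<subseteq> insert (Complex 0 \<alpha>) (g ` {w \<in> ?H. Im w = a}) \<union>
      {w. Re w = Re q} \<union> {w. Im w = B + 1 \<and> Re w \<le> 0}"
  proof -
    have "path_image c \<subseteq> path_image c1 \<union> (closed_segment q (Complex (Re q) (B + 1)) \<union>
       closed_segment (Complex (Re q) (B + 1)) (Complex 0 (B + 1)))"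
      unfolding c_def using c1 by (simp add: path_image_join)
    moreover have "closed_segment q (Complex (Re q) (B + 1)) \<subseteq> {w. Re w = Re q}"
      using seg1 by blast
    moreover have "closed_segment (Complex (Re q) (B + 1)) (Complex 0 (B + 1)) \<subseteq> {w. Im w = B + 1 \<and> Re w \<le> 0}"
      using seg2 by blast
    ultimately show ?thesis using c1(4) by blast
  qed
  have disj: "path_image p \<inter> path_image c = {}"
  proof -
    have False if z: "z \<in> path_image p" "z \<in> path_image c" for z
    proof -
      have n: "\<bar>Re z\<bar> \<le> B" "\<bar>Im z\<bar> \<le> B"
        using B[OF z(1)] abs_Re_le_cmod[of z] abs_Im_le_cmod[of z] by auto
      then have "z = Complex 0 \<alpha> \<or> z \<in> g ` {w \<in> ?H. Im w = a}"
        using imc z(2) X(2) by (auto simp: q_def)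
      moreover have False if za: "z = Complex 0 \<alpha>"
      proof -
        have "Re z < 0" if "z \<in> g ` {w \<in> ?H. a < Im w}" using that g(3) by auto
        then have "z \<notin> g ` {w \<in> ?H. a < Im w}" using za by auto
        then have "z = Complex 0 \<beta> \<or> z = Complex 0 (\<alpha> + 2 * pi)" using imp z(1) by blast
        then show False using za less by auto
      qed
      moreover have False if za: "z \<in> g ` {w \<in> ?H. Im w = a}"
      proof -
        obtain w where w: "w \<in> ?H" "Im w = a" "z = g w" using za by blast
        then have "Re z < 0" using g(3)[of w] by simp
        then have "z \<noteq> Complex 0 \<beta>" "z \<noteq> Complex 0 (\<alpha> + 2 * pi)" by auto
        then obtain w' where "w' \<in> ?H" "a < Im w'" "z = g w'" using imp z(1) by blast
        then show False using w g(2) by (metis inj_onD less_irrefl)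
      qed
      ultimately show False by blast
    qed
    then show ?thesis by blast
  qed
  have ReH: "Re z \<le> 0" if "z \<in> path_image p \<union> path_image c" for z
  proof -
    have neg: "Re z < 0" if "z \<in> g ` ?H" using that g(3) by auto
    have "z = Complex 0 \<beta> \<or> z = Complex 0 (\<alpha> + 2 * pi) \<or> z \<in> g ` ?H" if "z \<in> path_image p"
      using imp that by blast
    moreover have "z = Complex 0 \<alpha> \<or> z \<in> g ` ?H \<or> Re z = Re q \<or> Re z \<le> 0" if "z \<in> path_image c"
      using imc that by blast
    ultimately show ?thesis using that neg qH by auto
  qed
  define \<xi> :: "complex \<Rightarrow> real^2" where "\<xi> = (\<lambda>z. vector [Im z, - Re z])"
  have lin: "linear \<xi>"
    by (rule linearI) (simp_all add: \<xi>_def vec_eq_iff forall_2)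
  have inj: "inj \<xi>"
    by (rule injI) (simp add: \<xi>_def vec_eq_iff forall_2 complex_eq_iff)
  have comp: "path (\<xi> \<circ> r)" if "path r" for r
    using that linear_continuous_on[OF lin[unfolded linear_conv_bounded_linear]] by (rule path_continuous_image)
  have "bounded (path_image p \<union> path_image c)"
    using compact_path_image[OF p(1)] compact_path_image[OF c(1)] by (simp add: compact_imp_bounded)
  then obtain D where D: "\<And>z. z \<in> path_image p \<union> path_image c \<Longrightarrow> norm z \<le> D"
    unfolding bounded_iff by blast
  have box: "\<xi> z \<in> cbox (vector [- D, 0]) (vector [D, D])" if z: "z \<in> path_image p \<union> path_image c" for z
    using D[OF z] ReH[OF z] abs_Re_le_cmod[of z] abs_Im_le_cmod[of z]
    by (auto simp: \<xi>_def mem_box_cart forall_2)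
  have "\<bar>Im (Complex 0 (\<alpha> + 2 * pi))\<bar> \<le> B"
    using B[of "Complex 0 (\<alpha> + 2 * pi)"] pathfinish_in_path_image[of p] p(3) abs_Im_le_cmod order_trans by metis
  then have ltB: "\<alpha> + 2 * pi < B + 1" by simp
  obtain z where "z \<in> path_image (\<xi> \<circ> p)" "z \<in> path_image (\<xi> \<circ> c)"
  proof (rule fashoda_interlace[of "\<xi> \<circ> p" "\<xi> \<circ> c" "vector [- D, 0]" "vector [D, D]"])
    show "path (\<xi> \<circ> p)" "path (\<xi> \<circ> c)" using comp p(1) c(1) by auto
    show "path_image (\<xi> \<circ> p) \<subseteq> cbox (vector [- D, 0]) (vector [D, D])"
      "path_image (\<xi> \<circ> c) \<subseteq> cbox (vector [- D, 0]) (vector [D, D])"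
      using box by (auto simp: path_image_compose)
  qed (use less ltB pi_gt_zero in \<open>auto simp: pathstart_compose pathfinish_compose p c \<xi>_def\<close>)
  then show False using disj inj by (auto simp: path_image_compose inj_eq)
qed

section \<open>Length of closed curves and inscribed polygons\<close>

lemma path_length_nonneg: "0 \<le> path_length g"
  unfolding path_length_def
  by (rule SUP_upper2[of "(0, \<lambda>_. 0)"]) (auto simp: mono_def zero_ereal_def)

text \<open>The length of the curve restricted to \<open>[0, t]\<close>, as a function of \<open>t\<close>: a partition of \<open>[0, s]\<close>
  continued by the points \<open>s\<close> and \<open>t\<close> is a partition of \<open>[0, t]\<close>.\<close>

lemma variation_function_unit_interval:
  fixes \<gamma> :: "real \<Rightarrow> 'a::metric_space"
  assumes len: "path_length \<gamma> = ereal l"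
  obtains v where "v 0 \<ge> 0" "v 1 \<le> l"
    "\<And>s t. 0 \<le> s \<Longrightarrow> s \<le> t \<Longrightarrow> t \<le> 1 \<Longrightarrow> dist (\<gamma> s) (\<gamma> t) \<le> v t - v s"
proof -
  define A where "A = (\<lambda>x. {(n, t). mono t \<and> range t \<subseteq> {0..x}} :: (nat \<times> (nat \<Rightarrow> real)) set)"
  define \<sigma> where "\<sigma> = (\<lambda>(n, t). \<Sum>i<n. dist (\<gamma> (t i)) (\<gamma> (t (Suc i :: nat))))"
  define v where "v = (\<lambda>x. SUP a\<in>A x. \<sigma> a)"
  have bound: "\<sigma> a \<le> l" if "a \<in> A x" "x \<le> 1" for a x
  proof -
    have "ereal (\<sigma> a) \<le> path_length \<gamma>"
      unfolding path_length_def using that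
      by (intro SUP_upper2[of a]) (auto simp: \<sigma>_def A_def subset_iff)
    then show ?thesis by (simp add: len)
  qed
  then have bdd: "bdd_above (\<sigma> ` A x)" if "x \<le> 1" for x
    using that by (auto intro!: bdd_aboveI)
  have ne: "(0, \<lambda>_. 0) \<in> A x" if "0 \<le> x" for x
    using that by (auto simp: A_def mono_def)
  show ?thesis
  proof
    show "v 0 \<ge> 0"
      unfolding v_def by (rule cSUP_upper2[OF bdd ne]) (auto simp: \<sigma>_def)
    show "v 1 \<le> l"
      unfolding v_def using ne[of 1] bound by (intro cSUP_least) auto
    fix s t :: real assume st: "0 \<le> s" "s \<le> t" "t \<le> 1"
    have "v s \<le> v t - dist (\<gamma> s) (\<gamma> t)"
      unfolding v_def
    proof (rule cSUP_least)
      show "A s \<noteq> {}" using ne[OF st(1)] by blast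
      fix a assume "a \<in> A s"
      then obtain n w where a: "a = (n, w)" "mono w" "\<And>i. w i \<in> {0..s}"
        by (auto simp: A_def image_subset_iff)
      define w' where "w' = (\<lambda>i. if i \<le> n then w i else if i = Suc n then s else t)"
      have "mono w'"
        using a st by (intro mono_iff_le_Suc[THEN iffD2] allI) (auto simp: w'_def mono_iff_le_Suc le_Suc_eq)
      moreover have "range w' \<subseteq> {0..t}"
        using a(3) st by (auto simp: w'_def) (use order_trans in blast)
      ultimately have "\<sigma> (Suc (Suc n), w') \<le> (SUP a\<in>A t. \<sigma> a)"
        by (intro cSUP_upper bdd st) (auto simp: A_def)
      moreover have "\<sigma> (Suc (Suc n), w') = \<sigma> (n, w) + dist (\<gamma> (w n)) (\<gamma> s) + dist (\<gamma> s) (\<gamma> t)"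
      proof -
        have "(\<Sum>i<n. dist (\<gamma> (w' i)) (\<gamma> (w' (Suc i)))) = (\<Sum>i<n. dist (\<gamma> (w i)) (\<gamma> (w (Suc i))))"
          by (rule sum.cong) (auto simp: w'_def)
        then show ?thesis by (simp add: \<sigma>_def) (simp add: w'_def)
      qed
      ultimately show "\<sigma> a \<le> (SUP a\<in>A t. \<sigma> a) - dist (\<gamma> s) (\<gamma> t)"
        using zero_le_dist[of "\<gamma> (w n)" "\<gamma> s"] unfolding a(1) by linarith
    qed
    then show "dist (\<gamma> s) (\<gamma> t) \<le> v t - v s" by simp
  qed
qed

text \<open>Extended quasi-periodically to the line, the variation function bounds the perimeter of a closed
  polygon with vertices in cyclic order by a telescoping sum, wherever on the curve the
  first vertex lies.\<close>

lemma variation_function_periodic: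
  fixes \<gamma> :: "real \<Rightarrow> 'a::metric_space"
  assumes len: "path_length \<gamma> = ereal l" and per: "\<And>t. \<gamma> (t + 1) = \<gamma> t"
  obtains v where "\<And>t. v (t + 1) = v t + l"
    "\<And>s t. s \<le> t \<Longrightarrow> dist (\<gamma> s) (\<gamma> t) \<le> v t - v s"
proof -
  obtain v0 where v0: "v0 0 \<ge> 0" "v0 1 \<le> l"
    "\<And>s t. 0 \<le> s \<Longrightarrow> s \<le> t \<Longrightarrow> t \<le> 1 \<Longrightarrow> dist (\<gamma> s) (\<gamma> t) \<le> v0 t - v0 s"
    using variation_function_unit_interval[OF len] by metis
  define v where "v = (\<lambda>t. v0 (frac t) + l * of_int \<lfloor>t\<rfloor>)"
  have l0: "0 \<le> l" using v0(3)[of 0 1] v0(1,2) zero_le_dist[of "\<gamma> 0" "\<gamma> 1"] by linarith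
  have \<gamma>_frac: "\<gamma> t = \<gamma> (frac t)" for t
    using periodic_add_int[of \<gamma> 1 "frac t" "\<lfloor>t\<rfloor>", OF per] by (simp add: frac_def)
  show ?thesis
  proof
    show "v (t + 1) = v t + l" for t
      by (simp add: v_def frac_def algebra_simps)
    fix s t :: real assume st: "s \<le> t"
    have fr: "0 \<le> frac s" "frac s \<le> 1" "0 \<le> frac t" "frac t \<le> 1"
      by (auto simp: frac_lt_1 less_imp_le)
    show "dist (\<gamma> s) (\<gamma> t) \<le> v t - v s"
    proof (cases "\<lfloor>s\<rfloor> = \<lfloor>t\<rfloor>")
      case True
      then have "frac s \<le> frac t" using st by (simp add: frac_def)
      then have "dist (\<gamma> (frac s)) (\<gamma> (frac t)) \<le> v0 (frac t) - v0 (frac s)"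
        by (intro v0) (auto simp: fr)
      then show ?thesis using True \<gamma>_frac[of s] \<gamma>_frac[of t] by (simp add: v_def)
    next
      case False
      then have "\<lfloor>s\<rfloor> + 1 \<le> \<lfloor>t\<rfloor>" using floor_mono[OF st] by linarith
      then have "l * (of_int \<lfloor>s\<rfloor> + 1) \<le> l * of_int \<lfloor>t\<rfloor>"
        by (metis l0 mult_left_mono of_int_1 of_int_add of_int_le_iff)
      moreover have "dist (\<gamma> (frac s)) (\<gamma> 1) \<le> v0 1 - v0 (frac s)"
        "dist (\<gamma> 0) (\<gamma> (frac t)) \<le> v0 (frac t) - v0 0"
        by (intro v0; simp add: fr)+
      moreover have "dist (\<gamma> (frac s)) (\<gamma> (frac t)) \<le> dist (\<gamma> (frac s)) (\<gamma> 1) + dist (\<gamma> 0) (\<gamma> (frac t))"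
        using per[of 0] dist_triangle[of "\<gamma> (frac s)" "\<gamma> (frac t)" "\<gamma> 1"] by simp
      ultimately show ?thesis
        using v0(1,2) \<gamma>_frac[of s] \<gamma>_frac[of t] by (simp add: v_def algebra_simps)
    qed
  qed
qed

section \<open>Boundary correspondence of a parametrized Jordan surface\<close>

text \<open>Once \<open>exp (p x)\<close> is close to \<open>\<zeta>\<close>, \<open>p\<close> agrees with a continuous branch of the logarithm near \<open>\<zeta>\<close>, up to
  a constant.\<close>

lemma lift_limit:
  fixes p :: "real \<Rightarrow> complex"
  assumes p: "continuous_on {..<0} p" and lim: "((\<lambda>x. exp (p x)) \<longlongrightarrow> \<zeta>) (at_left 0)" and \<zeta>: "norm \<zeta> = 1"
  obtains \<alpha> where "(p \<longlongrightarrow> Complex 0 \<alpha>) (at_left 0)" "cis \<alpha> = \<zeta>"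
proof -
  have \<zeta>0: "\<zeta> \<noteq> 0" using \<zeta> by auto
  define q where "q = (\<lambda>x. exp (p x) / \<zeta>)"
  have "(q \<longlongrightarrow> \<zeta> / \<zeta>) (at_left 0)" unfolding q_def by (intro tendsto_intros lim \<zeta>0)
  then have q1: "(q \<longlongrightarrow> 1) (at_left 0)" using \<zeta>0 by simp
  then have "\<forall>\<^sub>F x in at_left 0. dist (q x) 1 < 1" by (rule tendstoD) simp
  then obtain b where b: "b < 0" "\<And>x. b < x \<Longrightarrow> x < 0 \<Longrightarrow> dist (q x) 1 < 1"
    unfolding eventually_at_left[of "-1" "0::real", simplified] by blast
  have q_slit: "q x \<notin> \<real>\<^sub>\<le>\<^sub>0" if x: "b < x" "x < 0" for x
  proof
    assume "q x \<in> \<real>\<^sub>\<le>\<^sub>0"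
    then have "Re (q x) \<le> 0" by (simp add: complex_nonpos_Reals_iff)
    moreover have "\<bar>Re (q x - 1)\<bar> \<le> norm (q x - 1)" by (rule abs_Re_le_cmod)
    ultimately show False using b(2)[OF x] by (simp add: dist_norm)
  qed
  define D where "D = (\<lambda>x. p x - Ln (q x) - \<i> * of_real (Arg \<zeta>))"
  have "continuous_on {b<..<0} p" by (rule continuous_on_subset[OF p]) auto
  then have "continuous_on {b<..<0} D"
    unfolding D_def q_def using q_slit \<zeta>0 by (intro continuous_intros) (auto simp: q_def)
  moreover have "exp (D x) = 1" if x: "x \<in> {b<..<0}" for x
  proof -
    have "q x \<noteq> 0" using q_slit[of x] x by auto
    then have "exp (Ln (q x)) = exp (p x) / \<zeta>" by (simp add: q_def)
    moreover have "exp (\<i> * of_real (Arg \<zeta>)) = \<zeta>"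
      using Arg_eq[OF \<zeta>0] \<zeta> by simp
    ultimately show ?thesis using \<zeta>0 by (simp add: D_def exp_diff)
  qed
  ultimately obtain m :: int where m: "\<And>x. x \<in> {b<..<0} \<Longrightarrow> D x = of_int m * (2 * of_real pi * \<i>)"
    using exp_eq_1_continuous_imp_const[of "{b<..<0}" D] by (metis connected_Ioo)
  define \<alpha> where "\<alpha> = Arg \<zeta> + of_int m * (2 * pi)"
  have "((\<lambda>x. Ln (q x) + \<i> * of_real \<alpha>) \<longlongrightarrow> Ln 1 + \<i> * of_real \<alpha>) (at_left 0)"
    by (intro tendsto_intros q1) auto
  moreover have "\<forall>\<^sub>F x in at_left 0. Ln (q x) + \<i> * of_real \<alpha> = p x"
    unfolding eventually_at_left[OF b(1)]
  proof (intro exI[of _ b] conjI allI impI b(1))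
    fix x assume "b < x" "x < 0"
    then show "Ln (q x) + \<i> * of_real \<alpha> = p x"
      using m[of x] by (simp add: D_def \<alpha>_def algebra_simps)
  qed
  ultimately have "(p \<longlongrightarrow> Complex 0 \<alpha>) (at_left 0)"
    by (auto intro: Lim_transform_eventually simp: Complex_eq)
  moreover have "cis \<alpha> = \<zeta>"
  proof -
    have "cis \<alpha> = cis (Arg \<zeta>) * cis (2 * pi * of_int m)" by (simp add: \<alpha>_def cis_mult mult_ac)
    also have "cis (Arg \<zeta>) = \<zeta>" using Arg_eq[OF \<zeta>0] \<zeta> by (simp add: cis_conv_exp)
    finally show ?thesis by simp
  qed
  ultimately show ?thesis using that by blast
qed

text \<open>Precomposing \<open>\<Phi>\<close> with such a map moves any given interior point of the surface over the origin and
  leaves the boundary parametrization, hence the length of the boundary curve, unchanged.\<close>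

lemma disc_homeomorphism_rel_boundary:
  fixes p :: complex
  assumes "norm p < 1"
  obtains f g where "homeomorphism (cball 0 1) (cball 0 1) f g" "f 0 = p"
    "\<And>z. norm z = 1 \<Longrightarrow> f z = z" "f ` ball 0 1 = ball 0 1"
proof -
  obtain f g where fg: "homeomorphism (cball 0 1 \<inter> UNIV) (cball 0 1 \<inter> UNIV) f g"
    "f 0 = p" "\<And>z. z \<in> sphere 0 1 \<Longrightarrow> f z = z"
    using homeomorphism_moving_point_1[of UNIV "0 :: complex" p 1] assms by (auto simp: dist_norm)
  then have h: "homeomorphism (cball 0 1) (cball 0 1) f g" by simp
  have fs: "f z = z" if "norm z = 1" for z using fg(3) that by simp
  have gs: "g z = z" if "norm z = 1" for z
    using homeomorphism_apply1[OF h, of z] fs[OF that] that by simp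
  have "f z \<in> ball 0 1" if z: "z \<in> ball 0 1" for z
  proof -
    have "f z \<in> f ` cball 0 1" using z by (intro imageI) auto
    then have "f z \<in> cball 0 1" using homeomorphism_image1[OF h] by blast
    moreover have "norm (f z) \<noteq> 1"
      using gs[of "f z"] homeomorphism_apply1[OF h, of z] z by auto
    ultimately show ?thesis by simp
  qed
  moreover have "w \<in> f ` ball 0 1" if w: "w \<in> ball 0 1" for w
  proof -
    have "g w \<in> cball 0 1" using homeomorphism_image2[OF h] w by auto
    moreover have "f (g w) = w" using homeomorphism_apply2[OF h, of w] w by simp
    moreover have "norm (g w) \<noteq> 1" using fs[of "g w"] \<open>f (g w) = w\<close> w by auto
    ultimately show ?thesis by (intro image_eqI[of _ _ "g w"]) auto
  qed
  ultimately have "f ` ball 0 1 = ball 0 1" by blast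
  then show ?thesis using that[OF h fg(2) fs] by blast
qed

lemma poisson_reproducing_vec:
  fixes u :: "complex \<Rightarrow> real ^ 'n"
  assumes "continuous_on (ball 0 1) u" "\<And>i. poisson_reproducing (\<lambda>z. u z $ i)"
  shows "poisson_reproducing u"
  unfolding poisson_reproducing_def
proof (intro conjI allI impI assms(1))
  fix \<rho> r \<theta> :: real assume r: "0 \<le> \<rho>" "\<rho> < 1" "0 \<le> r" "r < 1"
  show "((\<lambda>t. poisson r t *\<^sub>R polar u \<rho> (\<theta> + t)) has_integral (2 * pi) *\<^sub>R polar u (r * \<rho>) \<theta>) {0..2 * pi}"
    unfolding has_integral_componentwise_iff[where y = "(2 * pi) *\<^sub>R polar u (r * \<rho>) \<theta>"]
  proof
    fix b :: "real ^ 'n" assume "b \<in> Basis"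
    then obtain i where b: "b = axis i 1" by (auto simp: Basis_vec_def)
    have "((\<lambda>t. poisson r t *\<^sub>R polar (\<lambda>z. u z $ i) \<rho> (\<theta> + t)) has_integral
        (2 * pi) *\<^sub>R polar (\<lambda>z. u z $ i) (r * \<rho>) \<theta>) {0..2 * pi}"
      using assms(2)[of i] r by (auto simp: poisson_reproducing_def)
    then show "((\<lambda>t. (poisson r t *\<^sub>R polar u \<rho> (\<theta> + t)) \<bullet> b) has_integral
        ((2 * pi) *\<^sub>R polar u (r * \<rho>) \<theta>) \<bullet> b) {0..2 * pi}"
      by (simp add: b inner_axis polar_def)
  qed
qed

locale disc_parametrization =
  fixes \<Phi> :: "complex \<Rightarrow> real ^ 'n" and \<Psi> :: "real ^ 'n \<Rightarrow> complex" and \<tau> :: "complex \<Rightarrow> real ^ 'n" and \<sigma>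
  assumes \<Phi>: "homeomorphism (cball 0 1) (\<Phi> ` cball 0 1) \<Phi> \<Psi>"
    and \<tau>: "homeomorphism (ball 0 1) (\<Phi> ` ball 0 1) \<tau> \<sigma>"
begin

definition landing :: "real set" where
  "landing = {t. \<exists>L. ((\<lambda>r. polar \<tau> r t) \<longlongrightarrow> L) (at_left 1)}"

lemma disc_map: "homeomorphism (ball 0 1) (ball 0 1) (\<Psi> \<circ> \<tau>) (\<sigma> \<circ> \<Phi>)"
proof (rule homeomorphism_compose[OF \<tau>])
  show "homeomorphism (\<Phi> ` ball 0 1) (ball 0 1) \<Psi> \<Phi>"
    by (rule homeomorphism_symD, rule homeomorphism_of_subsets[OF \<Phi>]) (use ball_subset_cball in auto)
qed

lemma landing_periodic: "t \<in> landing \<Longrightarrow> t + 2 * pi \<in> landing"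
  by (simp add: landing_def)

lemma \<tau>_in: "z \<in> ball 0 1 \<Longrightarrow> \<tau> z \<in> \<Phi> ` ball 0 1"
  using homeomorphism_image1[OF \<tau>] by blast

lemma \<Phi>_\<Psi>_\<tau>: "z \<in> ball 0 1 \<Longrightarrow> \<Phi> (\<Psi> (\<tau> z)) = \<tau> z"
  using homeomorphism_apply2[OF \<Phi>] \<tau>_in ball_subset_cball by blast

text \<open>The limit lies in the compact surface, hence is of the form \<open>\<Phi> \<zeta>\<close>. If \<open>\<zeta>\<close> were an interior point, the
  inverse of the disk homeomorphism \<open>\<Psi> \<circ> \<tau>\<close> would map points converging to \<open>\<zeta>\<close> to points converging
  inside the disk, whereas these run along a radius to the unit circle.\<close>

lemma landing_point:
  assumes "t \<in> landing"
  obtains \<zeta> where "norm \<zeta> = 1" "((\<lambda>r. \<Psi> (polar \<tau> r t)) \<longlongrightarrow> \<zeta>) (at_left 1)"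
    "((\<lambda>r. polar \<tau> r t) \<longlongrightarrow> \<Phi> \<zeta>) (at_left 1)"
proof -
  obtain L where L: "((\<lambda>r. polar \<tau> r t) \<longlongrightarrow> L) (at_left 1)" using assms by (auto simp: landing_def)
  have ev: "\<forall>\<^sub>F r in at_left 1. r \<in> {0<..<(1::real)}"
    unfolding eventually_at_left[OF zero_less_one] by (auto intro!: exI[of _ 0])
  have inU: "of_real r * cis t \<in> ball 0 1" if "r \<in> {0<..<1}" for r
    using that by (simp add: norm_mult)
  have ev_in: "\<forall>\<^sub>F r in at_left 1. polar \<tau> r t \<in> \<Phi> ` cball 0 1"
    using ev by eventually_elim (use \<tau>_in inU ball_subset_cball in \<open>force simp: polar_def\<close>)
  have "closed (\<Phi> ` cball 0 1)"
    using homeomorphism_cont1[OF \<Phi>] by (intro compact_imp_closed compact_continuous_image) auto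
  then have LS: "L \<in> \<Phi> ` cball 0 1"
    by (rule Lim_in_closed_set[OF _ ev_in _ L]) (simp add: trivial_limit_at_left_real)
  have lim: "((\<lambda>r. \<Psi> (polar \<tau> r t)) \<longlongrightarrow> \<Psi> L) (at_left 1)"
    by (rule continuous_on_tendsto_compose[OF homeomorphism_cont2[OF \<Phi>] L LS ev_in])
  have \<Psi>L: "\<Psi> L \<in> cball 0 1" "\<Phi> (\<Psi> L) = L"
    using LS homeomorphism_image2[OF \<Phi>] homeomorphism_apply2[OF \<Phi>] by auto
  have "norm (\<Psi> L) = 1"
  proof (rule ccontr)
    assume "norm (\<Psi> L) \<noteq> 1"
    then have b: "\<Psi> L \<in> ball 0 1" using \<Psi>L(1) by simp
    have "\<forall>\<^sub>F r in at_left 1. \<Psi> (polar \<tau> r t) \<in> ball 0 1"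
      using ev by eventually_elim
        (use homeomorphism_image1[OF disc_map] inU in \<open>auto simp: polar_def o_def simp del: mem_ball_0\<close>)
    from continuous_on_tendsto_compose[OF homeomorphism_cont2[OF disc_map] lim b this]
    have "((\<lambda>r. (\<sigma> \<circ> \<Phi>) (\<Psi> (polar \<tau> r t))) \<longlongrightarrow> (\<sigma> \<circ> \<Phi>) (\<Psi> L)) (at_left 1)" .
    moreover have "\<forall>\<^sub>F r in at_left 1. (\<sigma> \<circ> \<Phi>) (\<Psi> (polar \<tau> r t)) = of_real r * cis t"
      using ev by eventually_elim
        (use homeomorphism_apply1[OF disc_map] inU in \<open>simp add: polar_def o_def\<close>)
    ultimately have "((\<lambda>r. of_real r * cis t) \<longlongrightarrow> (\<sigma> \<circ> \<Phi>) (\<Psi> L)) (at_left 1)"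
      by (rule Lim_transform_eventually)
    moreover have "((\<lambda>r. of_real r * cis t) \<longlongrightarrow> of_real 1 * cis t) (at_left 1)"
      by (intro tendsto_intros)
    ultimately have "(\<sigma> \<circ> \<Phi>) (\<Psi> L) = of_real 1 * cis t"
      by (rule tendsto_unique[rotated]) simp
    then have "norm ((\<sigma> \<circ> \<Phi>) (\<Psi> L)) = 1" by simp
    moreover have "(\<sigma> \<circ> \<Phi>) (\<Psi> L) \<in> ball 0 1" using b homeomorphism_image2[OF disc_map] by blast
    ultimately show False by simp
  qed
  then show ?thesis using that[OF _ lim] L \<Psi>L(2) by simp
qed

text \<open>Choose the angles \<open>\<alpha>\<close> of the landing points as imaginary parts of the limits of one lift. The sign \<open>s\<close>
  is the degree of \<open>\<Psi> \<circ> \<tau>\<close>; an orientation reversing map is reduced to an orientation preserving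
  one by complex conjugation.\<close>

lemma landing_angles:
  assumes 0: "\<Psi> (\<tau> 0) = 0"
  obtains \<alpha> :: "real \<Rightarrow> real" and s :: real where
    "\<And>t. t \<in> landing \<Longrightarrow> ((\<lambda>r. polar \<tau> r t) \<longlongrightarrow> \<Phi> (cis (\<alpha> t))) (at_left 1)"
    "\<And>t. t \<in> landing \<Longrightarrow> \<alpha> (t + 2 * pi) = \<alpha> t + s * (2 * pi)"
    "s = 1 \<or> s = -1"
    "\<And>a b. a \<in> landing \<Longrightarrow> b \<in> landing \<Longrightarrow> a < b \<Longrightarrow> b \<le> a + 2 * pi \<Longrightarrow> s * \<alpha> a \<le> s * \<alpha> b"
proof -
  define h where "h = \<Psi> \<circ> \<tau>"
  note hom = disc_map[folded h_def]
  have h0: "h 0 = 0" using 0 by (simp add: h_def)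
  obtain g and d :: int where g: "continuous_on left_half_plane g"
    "\<And>w. w \<in> left_half_plane \<Longrightarrow> exp (g w) = h (exp w)"
    "\<And>w. w \<in> left_half_plane \<Longrightarrow> g w \<in> left_half_plane" "inj_on g left_half_plane"
    "\<And>w. w \<in> left_half_plane \<Longrightarrow> g (w + 2 * of_real pi * \<i>) = g w + of_int d * (2 * of_real pi * \<i>)"
    "d = 1 \<or> d = -1"
    using lift_disc_homeomorphism[OF hom h0] by blast
  have expC: "exp (Complex x t) = of_real (exp x) * cis t" for x t by (simp add: exp_eq_polar)
  have "\<exists>\<alpha>. ((\<lambda>x. g (Complex x t)) \<longlongrightarrow> Complex 0 \<alpha>) (at_left 0) \<and> ((\<lambda>r. polar \<tau> r t) \<longlongrightarrow> \<Phi> (cis \<alpha>)) (at_left 1)"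
    if t: "t \<in> landing" for t
  proof -
    obtain \<zeta> where \<zeta>: "norm \<zeta> = 1" "((\<lambda>r. \<Psi> (polar \<tau> r t)) \<longlongrightarrow> \<zeta>) (at_left 1)"
      "((\<lambda>r. polar \<tau> r t) \<longlongrightarrow> \<Phi> \<zeta>) (at_left 1)"
      using landing_point[OF t] .
    have "filterlim exp (at_left (1::real)) (at_left 0)" by real_asymp
    from filterlim_compose[OF \<zeta>(2) this]
    have "((\<lambda>x. \<Psi> (polar \<tau> (exp x) t)) \<longlongrightarrow> \<zeta>) (at_left 0)" .
    moreover have "\<forall>\<^sub>F x in at_left 0. \<Psi> (polar \<tau> (exp x) t) = exp (g (Complex x t))"
    proof -
      have "\<forall>\<^sub>F x in at_left 0. x < (0::real)" by (simp add: eventually_at_filter)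
      then show ?thesis
        by eventually_elim (simp add: g(2) expC h_def polar_def)
    qed
    ultimately have "((\<lambda>x. exp (g (Complex x t))) \<longlongrightarrow> \<zeta>) (at_left 0)"
      by (rule Lim_transform_eventually)
    moreover have "continuous_on {..<0} (\<lambda>x. g (Complex x t))"
      unfolding Complex_eq by (intro continuous_on_compose2[OF g(1)] continuous_intros) auto
    ultimately obtain \<alpha> where "((\<lambda>x. g (Complex x t)) \<longlongrightarrow> Complex 0 \<alpha>) (at_left 0)" "cis \<alpha> = \<zeta>"
      using lift_limit \<zeta>(1) by metis
    then show ?thesis using \<zeta>(3) by blast
  qed
  then obtain \<alpha> where \<alpha>: "\<And>t. t \<in> landing \<Longrightarrow> ((\<lambda>x. g (Complex x t)) \<longlongrightarrow> Complex 0 (\<alpha> t)) (at_left 0)"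
    "\<And>t. t \<in> landing \<Longrightarrow> ((\<lambda>r. polar \<tau> r t) \<longlongrightarrow> \<Phi> (cis (\<alpha> t))) (at_left 1)"
    by metis
  have per: "\<alpha> (t + 2 * pi) = \<alpha> t + of_int d * (2 * pi)" if t: "t \<in> landing" for t
  proof -
    have "((\<lambda>x. g (Complex x t) + of_int d * (2 * of_real pi * \<i>)) \<longlongrightarrow> Complex 0 (\<alpha> t) + of_int d * (2 * of_real pi * \<i>)) (at_left 0)"
      by (intro tendsto_intros \<alpha> t)
    moreover have "\<forall>\<^sub>F x in at_left 0. g (Complex x t) + of_int d * (2 * of_real pi * \<i>) = g (Complex x (t + 2 * pi))"
    proof -
      have "\<forall>\<^sub>F x in at_left 0. x < (0::real)" by (simp add: eventually_at_filter)
      then show ?thesis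
      proof eventually_elim
        case (elim x)
        have "Complex x t + 2 * of_real pi * \<i> = Complex x (t + 2 * pi)" by (simp add: complex_eq_iff)
        then show ?case using g(5)[of "Complex x t"] elim by simp
      qed
    qed
    ultimately have "((\<lambda>x. g (Complex x (t + 2 * pi))) \<longlongrightarrow> Complex 0 (\<alpha> t) + of_int d * (2 * of_real pi * \<i>)) (at_left 0)"
      by (rule Lim_transform_eventually)
    from tendsto_unique[OF _ \<alpha>(1)[OF landing_periodic[OF t]] this]
    have "Complex 0 (\<alpha> (t + 2 * pi)) = Complex 0 (\<alpha> t) + of_int d * (2 * of_real pi * \<i>)" by simp
    from arg_cong[OF this, of Im] show ?thesis by simp
  qed
  have deep: "\<exists>X>0. Re (g (Complex (- X) a)) < M" for M a
  proof -
    have "isCont h 0"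
      using homeomorphism_cont1[OF hom] by (auto simp: continuous_on_eq_continuous_at)
    then obtain \<delta> where \<delta>: "\<delta> > 0" "\<And>z. dist z 0 < \<delta> \<Longrightarrow> dist (h z) 0 < exp M"
      unfolding continuous_at_eps_delta h0 using exp_gt_zero by metis
    \<comment> \<open>Any positive \<open>X\<close> with \<open>exp (- X) < \<delta>\<close>.\<close>
    define X where "X = max 1 (1 - ln \<delta>)"
    have X: "0 < X" "- X < ln \<delta>" by (auto simp: X_def)
    have "exp (- X) < \<delta>" using X(2) \<delta>(1) by (metis exp_less_mono exp_ln)
    then have "norm (h (exp (Complex (- X) a))) < exp M"
      using \<delta>(2)[of "exp (Complex (- X) a)"] by (simp add: dist_norm)
    also have "h (exp (Complex (- X) a)) = exp (g (Complex (- X) a))" using g(2) X by simp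
    finally show ?thesis using X by auto
  qed
  have mono: "of_int d * \<alpha> a \<le> of_int d * \<alpha> b"
    if ab: "a \<in> landing" "b \<in> landing" "a < b" "b \<le> a + 2 * pi" for a b
    using g(6)
  proof
    assume d: "d = 1"
    have "\<alpha> a \<le> \<alpha> b"
      by (rule lifted_rays_ordered[OF g(1,4,3) _ deep \<alpha>(1)[OF ab(1)] \<alpha>(1)[OF ab(2)] ab(3,4)])
         (use g(5) d in auto)
    then show ?thesis by (simp add: d)
  next
    assume d: "d = -1"
    have "- \<alpha> a \<le> - \<alpha> b"
    proof (rule lifted_rays_ordered[where g = "\<lambda>w. cnj (g w)" and a = a and b = b])
      show "continuous_on left_half_plane (\<lambda>w. cnj (g w))" by (intro continuous_intros g)
      show "inj_on (\<lambda>w. cnj (g w)) left_half_plane" using g(4) by (auto simp: inj_on_def)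
      show "cnj (g w) \<in> left_half_plane" if "w \<in> left_half_plane" for w using g(3)[OF that] by simp
      show "cnj (g (w + 2 * of_real pi * \<i>)) = cnj (g w) + 2 * of_real pi * \<i>" if "w \<in> left_half_plane" for w
        using g(5)[OF that] by (simp add: d)
      show "\<exists>X>0. Re (cnj (g (Complex (- X) a))) < M" for M using deep[of a M] by simp
      have "((\<lambda>x. cnj (g (Complex x t))) \<longlongrightarrow> cnj (Complex 0 (\<alpha> t))) (at_left 0)" if "t \<in> landing" for t
        by (intro tendsto_intros \<alpha> that)
      then show "((\<lambda>x. cnj (g (Complex x a))) \<longlongrightarrow> Complex 0 (- \<alpha> a)) (at_left 0)"
        "((\<lambda>x. cnj (g (Complex x b))) \<longlongrightarrow> Complex 0 (- \<alpha> b)) (at_left 0)"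
        using ab by (simp_all add: complex_cnj)
    qed (use ab in auto)
    then show ?thesis by (simp add: d)
  qed
  show ?thesis
    by (rule that[of \<alpha> "of_int d"]) (use \<alpha>(2) per mono g(6) in auto)
qed

text \<open>The landing points of the vertices of a rotated regular polygon follow each other in one sense
  around the boundary curve, so the increments of its variation function telescope to the length of
  one full turn. For a negative sense of rotation, the variation function is read backwards.\<close>

lemma landing_polygon:
  assumes 0: "\<Psi> (\<tau> 0) = 0" and len: "path_length (boundary_curve \<Phi>) = ereal l" and n: "0 < n"
    and t: "\<And>k. k < n \<Longrightarrow> t + real k * (2 * pi / real n) \<in> landing"
  shows "\<exists>S\<le>l. ((\<lambda>r. \<Sum>k<n. norm (polar \<tau> r (t + real (Suc k) * (2 * pi / real n)) -
      polar \<tau> r (t + real k * (2 * pi / real n)))) \<longlongrightarrow> S) (at_left 1)"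
proof -
  obtain \<alpha> :: "real \<Rightarrow> real" and s :: real where
    \<alpha>: "\<And>t. t \<in> landing \<Longrightarrow> ((\<lambda>r. polar \<tau> r t) \<longlongrightarrow> \<Phi> (cis (\<alpha> t))) (at_left 1)"
      "\<And>t. t \<in> landing \<Longrightarrow> \<alpha> (t + 2 * pi) = \<alpha> t + s * (2 * pi)"
    and s: "s = 1 \<or> s = -1"
    and mono: "\<And>a b. a \<in> landing \<Longrightarrow> b \<in> landing \<Longrightarrow> a < b \<Longrightarrow> b \<le> a + 2 * pi \<Longrightarrow> s * \<alpha> a \<le> s * \<alpha> b"
    using landing_angles[OF 0] by blast
  have per: "boundary_curve \<Phi> (t + 1) = boundary_curve \<Phi> t" for t
  proof -
    have "cis (2 * pi * (t + 1)) = cis (2 * pi * t)" by (simp add: complex_eq_iff distrib_left)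
    then show ?thesis by (simp add: boundary_curve_def)
  qed
  obtain v where v: "\<And>t. v (t + 1) = v t + l"
    "\<And>s t. s \<le> t \<Longrightarrow> dist (boundary_curve \<Phi> s) (boundary_curve \<Phi> t) \<le> v t - v s"
    using variation_function_periodic[OF len per] by metis
  define p where "p = (\<lambda>k. t + real k * (2 * pi / real n))"
  define q where "q = (\<lambda>k. \<alpha> (p k) / (2 * pi))"
  have pn: "p n = p 0 + 2 * pi" using n by (simp add: p_def)
  have pL: "p k \<in> landing" if "k \<le> n" for k
  proof (cases "k = n")
    case True
    then show ?thesis using landing_periodic[of "p 0"] t[of 0] n by (simp add: pn) (simp add: p_def)
  qed (use t[of k] that in \<open>auto simp: p_def\<close>)
  \<comment> \<open>For \<open>n = 1\<close> the step is a full turn, so the second inequality cannot be strict.\<close>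
  have step: "p k < p (Suc k)" "p (Suc k) \<le> p k + 2 * pi" for k
    using n by (auto simp: p_def field_simps)
  have q: "s * q k \<le> s * q (Suc k)" if "k < n" for k
    using mono[OF pL pL step, of k] that by (auto simp: q_def divide_right_mono)
  have qn: "q n = q 0 + s"
    using \<alpha>(2)[OF pL[of 0]] by (simp add: q_def pn add_divide_distrib)
  have bq: "boundary_curve \<Phi> (q k) = \<Phi> (cis (\<alpha> (p k)))" for k
    by (simp add: boundary_curve_def q_def)
  have "norm (\<Phi> (cis (\<alpha> (p (Suc k)))) - \<Phi> (cis (\<alpha> (p k)))) \<le> s * v (q (Suc k)) - s * v (q k)" if "k < n" for k
    using v(2)[of "q k" "q (Suc k)"] v(2)[of "q (Suc k)" "q k"] q[OF that] s
    unfolding bq by (auto simp: dist_norm norm_minus_commute)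
  then have "(\<Sum>k<n. norm (\<Phi> (cis (\<alpha> (p (Suc k)))) - \<Phi> (cis (\<alpha> (p k))))) \<le> (\<Sum>k<n. s * v (q (Suc k)) - s * v (q k))"
    by (intro sum_mono) auto
  also have "\<dots> = s * v (q n) - s * v (q 0)"
    by (rule sum_lessThan_telescope)
  also have "\<dots> = l"
    using s v(1)[of "q 0"] v(1)[of "q 0 - 1"] by (auto simp: qn)
  finally have "(\<Sum>k<n. norm (\<Phi> (cis (\<alpha> (p (Suc k)))) - \<Phi> (cis (\<alpha> (p k))))) \<le> l" .
  moreover have "((\<lambda>r. \<Sum>k<n. norm (polar \<tau> r (p (Suc k)) - polar \<tau> r (p k))) \<longlongrightarrow>
      (\<Sum>k<n. norm (\<Phi> (cis (\<alpha> (p (Suc k)))) - \<Phi> (cis (\<alpha> (p k)))))) (at_left 1)"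
    by (intro tendsto_intros \<alpha>(1) pL) auto
  ultimately show ?thesis unfolding p_def by blast
qed

end

section \<open>The diameter estimate\<close>

text \<open>All rotations of a regular \<open>n\<close>-gon have their vertices at landing angles, except for a null set
  of rotations: the union of \<open>n\<close> translates of the null set in Fatou's theorem.\<close>

lemma harmonic_surface_radial_length:
  fixes \<Phi> :: "complex \<Rightarrow> real ^ 'n"
  assumes hom\<Phi>: "homeomorphism (cball 0 1) (\<Phi> ` cball 0 1) \<Phi> \<Psi>"
    and hom\<tau>: "homeomorphism (ball 0 1) (\<Phi> ` ball 0 1) \<tau> \<sigma>"
    and F: "\<And>i. F i holomorphic_on ball 0 1" "\<And>i z. z \<in> ball 0 1 \<Longrightarrow> \<tau> z $ i = Re (F i z)"
    and len: "path_length (boundary_curve \<Phi>) = ereal l"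
    and x: "mono x" "\<And>i. x i \<in> {0..<1}"
  shows "(\<Sum>j<m. dist (\<tau> (of_real (x j))) (\<tau> (of_real (x (Suc j))))) \<le> l / 2"
proof -
  define p where "p = \<Psi> (\<tau> 0)"
  have \<tau>0: "\<tau> 0 \<in> \<Phi> ` ball 0 1" using homeomorphism_image1[OF hom\<tau>] by auto
  then obtain p' where "p' \<in> ball 0 1" "\<tau> 0 = \<Phi> p'" by blast
  then have p: "norm p < 1" using homeomorphism_apply1[OF hom\<Phi>, of p'] by (simp add: p_def)
  obtain f g where fg: "homeomorphism (cball 0 1) (cball 0 1) f g" "f 0 = p"
    "\<And>z. norm z = 1 \<Longrightarrow> f z = z" "f ` ball 0 1 = ball 0 1"
    using disc_homeomorphism_rel_boundary[OF p] by metis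
  have im: "(\<Phi> \<circ> f) ` cball 0 1 = \<Phi> ` cball 0 1" "(\<Phi> \<circ> f) ` ball 0 1 = \<Phi> ` ball 0 1"
    unfolding image_comp[symmetric] fg(4) homeomorphism_image1[OF fg(1)] by (rule refl)+
  interpret disc_parametrization "\<Phi> \<circ> f" "g \<circ> \<Psi>" \<tau> \<sigma>
  proof
    show "homeomorphism (cball 0 1) ((\<Phi> \<circ> f) ` cball 0 1) (\<Phi> \<circ> f) (g \<circ> \<Psi>)"
      unfolding im by (rule homeomorphism_compose[OF fg(1) hom\<Phi>])
    show "homeomorphism (ball 0 1) ((\<Phi> \<circ> f) ` ball 0 1) \<tau> \<sigma>"
      unfolding im by (rule hom\<tau>)
  qed
  have 0: "(g \<circ> \<Psi>) (\<tau> 0) = 0"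
    using homeomorphism_apply1[OF fg(1), of 0] fg(2) by (simp add: p_def)
  have bc: "boundary_curve (\<Phi> \<circ> f) = boundary_curve \<Phi>"
    by (rule ext) (simp add: boundary_curve_def fg(3))
  have c: "continuous_on (ball 0 1) \<tau>" by (rule homeomorphism_cont1[OF hom\<tau>])
  have pr: "poisson_reproducing (\<lambda>z. \<tau> z $ i)" for i
    by (rule poisson_reproducing_Re[OF F])
  then have u: "poisson_reproducing \<tau>" by (rule poisson_reproducing_vec[OF c])
  have "compact (\<Phi> ` cball 0 1)"
    using homeomorphism_cont1[OF hom\<Phi>] by (intro compact_continuous_image) auto
  then obtain M where "\<And>y. y \<in> \<Phi> ` cball 0 1 \<Longrightarrow> norm y \<le> M"
    using compact_imp_bounded bounded_iff by metis
  then have M: "norm (\<tau> z) \<le> M" if "z \<in> ball 0 1" for z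
    using homeomorphism_image1[OF hom\<tau>] that ball_subset_cball by blast
  have "\<exists>N. negligible N \<and> (\<forall>t. t \<in> {0..2 * pi} \<longrightarrow> t \<notin> N \<longrightarrow> (\<exists>L. ((\<lambda>r. polar (\<lambda>z. \<tau> z $ i) r t) \<longlongrightarrow> L) (at_left 1)))" for i
  proof -
    have "\<bar>\<tau> z $ i\<bar> \<le> M" if "z \<in> ball 0 1" for z
      using M[OF that] component_le_norm_cart[of "\<tau> z" i] by linarith
    from fatou_radial_limits[OF pr this] show ?thesis by metis
  qed
  then obtain N where N: "\<And>i. negligible (N i)"
    "\<And>i t. t \<in> {0..2 * pi} \<Longrightarrow> t \<notin> N i \<Longrightarrow> \<exists>L. ((\<lambda>r. polar (\<lambda>z. \<tau> z $ i) r t) \<longlongrightarrow> L) (at_left 1)"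
    by metis
  define N0 where "N0 = (\<Union>i. N i)"
  have N0: "negligible N0" unfolding N0_def using N(1) by (intro negligible_Union) auto
  have land: "t \<in> landing" if t: "t \<in> {0..2 * pi}" "t \<notin> N0" for t
  proof -
    obtain L where L: "\<And>i. ((\<lambda>r. polar (\<lambda>z. \<tau> z $ i) r t) \<longlongrightarrow> L i) (at_left 1)"
      using N(2)[OF t(1)] t(2) unfolding N0_def by (metis UN_I UNIV_I)
    have "((\<lambda>r. polar \<tau> r t) \<longlongrightarrow> (\<chi> i. L i)) (at_left 1)"
      by (rule vec_tendstoI) (use L in \<open>simp add: polar_def\<close>)
    then show ?thesis unfolding landing_def by blast
  qed
  have "(\<Sum>j<m. norm (polar \<tau> (x (Suc j)) 0 - polar \<tau> (x j) 0)) \<le> l / 2"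
  proof (rule radial_image_length[OF u M _ x])
    fix n :: nat assume n: "0 < n"
    define h where "h = 2 * pi / real n"
    have h: "0 < h" "real n * h = 2 * pi" using n by (auto simp: h_def)
    define N1 where "N1 = (\<Union>k<n. (+) (- (real k * h)) ` N0)"
    have "negligible N1"
      unfolding N1_def
    proof (rule negligible_Union)
      fix T assume "T \<in> (\<lambda>k. (+) (- (real k * h)) ` N0) ` {..<n}"
      then obtain k where "T = (+) (- (real k * h)) ` N0" by blast
      then show "negligible T" by (simp only: negligible_translation[OF N0])
    qed simp
    moreover have "t + real k * h \<in> landing" if t: "t \<in> {0..h} - N1" and k: "k < n" for t k
    proof (rule land)
      have "real (Suc k) * h \<le> real n * h" using k h by (intro mult_right_mono) auto
      then show "t + real k * h \<in> {0..2 * pi}" using t h by (auto simp: algebra_simps)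
      show "t + real k * h \<notin> N0"
      proof
        assume "t + real k * h \<in> N0"
        then have "- (real k * h) + (t + real k * h) \<in> N1" unfolding N1_def using k by blast
        then show False using t by simp
      qed
    qed
    then have "\<exists>S\<le>l. ((\<lambda>r. \<Sum>k<n. norm (polar \<tau> r (t + real (Suc k) * h) - polar \<tau> r (t + real k * h))) \<longlongrightarrow> S) (at_left 1)"
      if "t \<in> {0..h} - N1" for t
      using landing_polygon[OF 0 _ n, of l t] len that unfolding bc h_def by blast
    ultimately show "\<exists>N. negligible N \<and> (\<forall>t\<in>{0..2 * pi / real n} - N. \<exists>S\<le>l.
        ((\<lambda>r. \<Sum>k<n. norm (polar \<tau> r (t + real (Suc k) * (2 * pi / real n)) - polar \<tau> r (t + real k * (2 * pi / real n)))) \<longlongrightarrow> S) (at_left 1))"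
      unfolding h_def by blast
  qed
  then show ?thesis by (simp add: polar_def dist_norm norm_minus_commute)
qed

text \<open>A Moebius map takes \<open>a\<close> to \<open>0\<close>; a rotation then moves the image of \<open>b\<close> to the positive real axis.
  The required map is the inverse.\<close>

lemma disc_automorphism_through:
  fixes a b :: complex
  assumes "norm a < 1" "norm b < 1" "a \<noteq> b"
  obtains m m' and x :: real where "homeomorphism (ball 0 1) (ball 0 1) m m'" "m holomorphic_on ball 0 1"
    "m 0 = a" "0 < x" "x < 1" "m (of_real x) = b"
proof -
  define c where "c = Moebius_function 0 a b"
  have c: "norm c < 1" unfolding c_def by (rule Moebius_function_norm_lt_1) (use assms in auto)
  have Mc: "Moebius_function 0 (- a) c = b"
    unfolding c_def by (rule Moebius_function_compose) (use assms in auto)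
  have M0: "Moebius_function 0 (- a) 0 = a" by (simp add: Moebius_function_simple)
  have c0: "c \<noteq> 0" using Mc M0 assms(3) by auto
  define w where "w = sgn c"
  have w: "norm w = 1" "w * of_real (norm c) = c"
    using c0 by (auto simp: w_def sgn_eq norm_divide)
  have w0: "w \<noteq> 0" using w(1) by auto
  define m where "m = (\<lambda>z. Moebius_function 0 (- a) (w * z))"
  define m' where "m' = (\<lambda>z. Moebius_function 0 a z / w)"
  have hol: "m holomorphic_on ball 0 1" "m' holomorphic_on ball 0 1"
    unfolding m_def m'_def using assms w w0
    by (auto intro!: holomorphic_intros Moebius_function_holomorphic
        holomorphic_on_compose_gen[where g = "Moebius_function 0 (- a)" and t = "ball 0 1" and f = "\<lambda>z. w * z", unfolded o_def]
        simp: norm_mult)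
  have "homeomorphism (ball 0 1) (ball 0 1) m m'"
  proof (rule homeomorphismI)
    show "continuous_on (ball 0 1) m" "continuous_on (ball 0 1) m'"
      using hol holomorphic_on_imp_continuous_on by auto
    show "m ` ball 0 1 \<subseteq> ball 0 1"
      unfolding m_def using assms w by (auto intro!: Moebius_function_norm_lt_1 simp: norm_mult)
    show "m' ` ball 0 1 \<subseteq> ball 0 1"
      unfolding m'_def using assms w by (auto intro!: Moebius_function_norm_lt_1 simp: norm_divide)
    show "m' (m z) = z" if "z \<in> ball 0 1" for z
      using that w w0 assms Moebius_function_compose[of a "- a" "w * z"]
      by (simp add: m_def m'_def norm_mult)
    show "m (m' z) = z" if "z \<in> ball 0 1" for z
      using that w0 assms Moebius_function_compose[of "- a" a z] by (simp add: m_def m'_def)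
  qed
  then show ?thesis
    using hol(1) c c0 by (intro that[of m m' "norm c"]) (auto simp: m_def M0 w(2) Mc)
qed

text \<open>The image under \<open>\<tau>\<close> of the hyperbolic segment between the two preimages is an admissible arc, and
  its inscribed polygons are those of the radius in \<open>harmonic_surface_radial_length\<close>.\<close>

theorem geodesic_diameter_le_half_boundary:
  fixes \<Phi> :: "complex \<Rightarrow> real ^ 'n"
  assumes "simply_connected_harmonic_surface \<Phi>" "rectifiable (boundary_curve \<Phi>)"
  shows "geodesic_diameter (open_surface \<Phi>) \<le> ereal (1/2) * path_length (boundary_curve \<Phi>)"
proof -
  obtain l where len: "path_length (boundary_curve \<Phi>) = ereal l" and l: "0 \<le> l"
    using assms(2) path_length_nonneg[of "boundary_curve \<Phi>"]
    by (cases "path_length (boundary_curve \<Phi>)") (auto simp: rectifiable_def)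
  obtain \<Psi> \<tau> \<sigma> where \<Phi>: "homeomorphism (cball 0 1) (\<Phi> ` cball 0 1) \<Phi> \<Psi>"
    and \<tau>: "homeomorphism (ball 0 1) (\<Phi> ` ball 0 1) \<tau> \<sigma>"
    and harm: "\<And>i. harmonic_on (\<lambda>z. \<tau> z $ i) (ball 0 1)"
    using assms(1) unfolding simply_connected_harmonic_surface_def jordan_surface_def open_surface_def by blast
  have "\<exists>F. F holomorphic_on ball 0 1 \<and> (\<forall>z\<in>ball 0 1. \<tau> z $ i = Re (F z))" for i
    using harmonic_on_ball_Re_holomorphic[OF harm[of i]] by metis
  then obtain F where F: "\<And>i. F i holomorphic_on ball 0 1" "\<And>i z. z \<in> ball 0 1 \<Longrightarrow> \<tau> z $ i = Re (F i z)"
    by metis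
  have "intrinsic_dist (open_surface \<Phi>) P Q \<le> ereal (l / 2)"
    if PQ: "P \<in> open_surface \<Phi>" "Q \<in> open_surface \<Phi>" for P Q
  proof (cases "P = Q")
    case True
    then show ?thesis using l by (simp add: intrinsic_dist_def)
  next
    case False
    have ab: "\<sigma> P \<in> ball 0 1" "\<tau> (\<sigma> P) = P" "\<sigma> Q \<in> ball 0 1" "\<tau> (\<sigma> Q) = Q"
      using PQ homeomorphism_image2[OF \<tau>] homeomorphism_apply2[OF \<tau>] by (auto simp: open_surface_def)
    then have "norm (\<sigma> P) < 1" "norm (\<sigma> Q) < 1" "\<sigma> P \<noteq> \<sigma> Q" using False by auto
    then obtain m m' and x :: real where m: "homeomorphism (ball 0 1) (ball 0 1) m m'" "m holomorphic_on ball 0 1"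
      "m 0 = \<sigma> P" and x: "0 < x" "x < 1" and mx: "m (of_real x) = \<sigma> Q"
      using disc_automorphism_through by metis
    note \<tau>m = homeomorphism_compose[OF m(1) \<tau>]
    have mb: "m z \<in> ball 0 1" if "z \<in> ball 0 1" for z using homeomorphism_image1[OF m(1)] that by blast
    have Fm: "(F i \<circ> m) holomorphic_on ball 0 1" for i
      by (rule holomorphic_on_compose_gen[OF m(2) F(1)]) (use mb in blast)
    have Rem: "(\<tau> \<circ> m) z $ i = Re ((F i \<circ> m) z)" if "z \<in> ball 0 1" for i z
      using F(2)[OF mb[OF that]] by simp
    define \<gamma> where "\<gamma> = (\<lambda>t. (\<tau> \<circ> m) (of_real (x * t)))"
    have xt: "x * t \<in> {0..<1}" if t: "t \<in> {0..1}" for t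
    proof -
      have "x * t \<le> x * 1" using t x by (intro mult_left_mono) auto
      then have "x * t < 1" using x by linarith
      then show ?thesis using t x by simp
    qed
    then have xt': "of_real (x * t) \<in> (ball 0 1 :: complex set)" if "t \<in> {0..1}" for t
      using that by (auto simp del: of_real_mult)
    have "path \<gamma>"
      unfolding path_def \<gamma>_def
      by (intro continuous_on_compose2[OF homeomorphism_cont1[OF \<tau>m]] continuous_intros) (use xt' in auto)
    moreover have "inj_on \<gamma> {0..1}"
    proof (rule inj_onI)
      fix s t :: real assume st: "s \<in> {0..1}" "t \<in> {0..1}" "\<gamma> s = \<gamma> t"
      then have "(of_real (x * s) :: complex) = of_real (x * t)"
        using homeomorphism_apply1[OF \<tau>m xt'[OF st(1)]] homeomorphism_apply1[OF \<tau>m xt'[OF st(2)]]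
        by (metis \<gamma>_def)
      then show "s = t" using x(1) by (simp only: of_real_eq_iff) simp
    qed
    ultimately have "arc \<gamma>" by (simp add: arc_def)
    moreover have "path_image \<gamma> \<subseteq> open_surface \<Phi>"
      unfolding path_image_def \<gamma>_def open_surface_def
      using homeomorphism_image1[OF \<tau>m] xt' by blast
    moreover have "pathstart \<gamma> = P" "pathfinish \<gamma> = Q"
      by (simp_all add: pathstart_def pathfinish_def \<gamma>_def m(3) mx ab)
    ultimately have "intrinsic_dist (open_surface \<Phi>) P Q \<le> path_length \<gamma>"
      using False by (auto simp: intrinsic_dist_def intro!: INF_lower)
    also have "path_length \<gamma> \<le> ereal (l / 2)"
      unfolding path_length_def
    proof (rule SUP_least, clarify)
      fix n :: nat and t :: "nat \<Rightarrow> real" assume t: "mono t" "range t \<subseteq> {0..1}"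
      have "(\<Sum>i<n. dist ((\<tau> \<circ> m) (of_real (x * t i))) ((\<tau> \<circ> m) (of_real (x * t (Suc i))))) \<le> l / 2"
      proof (rule harmonic_surface_radial_length[OF \<Phi> \<tau>m _ _ len])
        show "(F i \<circ> m) holomorphic_on ball 0 1" for i by (rule Fm)
        show "(\<tau> \<circ> m) z $ i = Re ((F i \<circ> m) z)" if "z \<in> ball 0 1" for i z by (rule Rem[OF that])
        show "mono (\<lambda>i. x * t i)" using t(1) x by (auto simp: mono_def)
        show "x * t i \<in> {0..<1}" for i by (rule xt, rule subsetD[OF t(2)]) simp
      qed
      then show "ereal (\<Sum>i<n. dist (\<gamma> (t i)) (\<gamma> (t (Suc i)))) \<le> ereal (l / 2)"
        by (simp add: \<gamma>_def)
    qed
    finally show ?thesis .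
  qed
  then have "geodesic_diameter (open_surface \<Phi>) \<le> ereal (l / 2)"
    unfolding geodesic_diameter_def by (intro SUP_least)
  then show ?thesis by (simp add: len)
qed


section \<open>Steep planar ellipses show that one half is sharp\<close>

lemma dist_le_path_length:
  "ereal (dist (pathstart g) (pathfinish g)) \<le> path_length g"
proof -
  define t :: "nat \<Rightarrow> real" where "t = (\<lambda>i. if i = 0 then 0 else 1)"
  have "mono t" "range t \<subseteq> {0..1}" by (auto simp: t_def mono_def)
  then show ?thesis
    unfolding path_length_def
    by (intro SUP_upper2[of "(1, t)"]) (auto simp: t_def pathstart_def pathfinish_def)
qed

lemma dist_le_geodesic_diameter:
  assumes "P \<in> S" "Q \<in> S"
  shows "ereal (dist P Q) \<le> geodesic_diameter S"
proof -
  have "ereal (dist P Q) \<le> intrinsic_dist S P Q"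
    using dist_le_path_length by (auto simp: intrinsic_dist_def zero_ereal_def intro!: INF_greatest)
  also have "\<dots> \<le> geodesic_diameter S"
    unfolding geodesic_diameter_def using assms by (meson SUP_upper SUP_upper2)
  finally show ?thesis .
qed

lemma partial_linear:
  assumes "bounded_linear L"
  shows "partial_x L = (\<lambda>z. L 1)" "partial_y L = (\<lambda>z. L \<i>)"
proof -
  have "((\<lambda>t. L (z + of_real t)) has_vector_derivative L 1) (at 0)" for z
    by (rule bounded_linear.has_vector_derivative[OF assms]) (auto intro!: derivative_eq_intros)
  moreover have "((\<lambda>t. L (z + \<i> * of_real t)) has_vector_derivative L \<i>) (at 0)" for z
    by (rule bounded_linear.has_vector_derivative[OF assms]) (auto intro!: derivative_eq_intros)
  ultimately show "partial_x L = (\<lambda>z. L 1)" "partial_y L = (\<lambda>z. L \<i>)"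
    unfolding partial_x_def partial_y_def by (auto intro!: ext vector_derivative_at)
qed

lemma partial_const [simp]: "partial_x (\<lambda>z. c) = (\<lambda>z. 0)" "partial_y (\<lambda>z. c) = (\<lambda>z. 0)"
  unfolding partial_x_def partial_y_def by auto

lemma C2_on_linear:
  assumes "bounded_linear L" "open S"
  shows "C2_on L S"
  using assms by (auto simp: C2_on_def C1_on_def partial_linear
      intro: linear_imp_differentiable_on bounded_linear.linear)

lemma harmonic_on_linear:
  assumes "bounded_linear L" "open S"
  shows "harmonic_on L S"
  using assms C2_on_linear by (auto simp: harmonic_on_def partial_linear)

lemma bounded_linear_graph_map:
  "bounded_linear (graph_map (\<lambda>z. N * Re z))"
  by (intro linear_conv_bounded_linear[THEN iffD1] linearI)
     (simp_all add: graph_map_def vec_eq_iff forall_3 algebra_simps)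

lemma norm_tilted_plane:
  "norm (graph_map (\<lambda>z. N * Re z) z) \<le> sqrt (1 + N\<^sup>2) * \<bar>Re z\<bar> + \<bar>Im z\<bar>"
  "sqrt (1 + N\<^sup>2) * \<bar>Re z\<bar> \<le> norm (graph_map (\<lambda>z. N * Re z) z)"
proof -
  have "norm (graph_map (\<lambda>z. N * Re z) z) = sqrt ((sqrt (1 + N\<^sup>2) * Re z)\<^sup>2 + (Im z)\<^sup>2)"
    by (simp add: graph_map_def norm_vec_def L2_set_def sum_3 algebra_simps power_mult_distrib)
  moreover have "\<dots> \<le> \<bar>sqrt (1 + N\<^sup>2) * Re z\<bar> + \<bar>Im z\<bar>"
    by (rule sqrt_sum_squares_le_sum_abs)
  moreover have "\<bar>sqrt (1 + N\<^sup>2) * Re z\<bar> \<le> sqrt ((sqrt (1 + N\<^sup>2) * Re z)\<^sup>2 + (Im z)\<^sup>2)"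
    by (metis real_sqrt_sum_squares_ge1 real_sqrt_abs power2_abs abs_ge_self order_trans real_sqrt_le_iff le_add_same_cancel1 zero_le_power2)
  ultimately show "norm (graph_map (\<lambda>z. N * Re z) z) \<le> sqrt (1 + N\<^sup>2) * \<bar>Re z\<bar> + \<bar>Im z\<bar>"
    "sqrt (1 + N\<^sup>2) * \<bar>Re z\<bar> \<le> norm (graph_map (\<lambda>z. N * Re z) z)"
    by (simp_all add: abs_mult)
qed

text \<open>On \<open>[0, 1]\<close> the function \<open>cos (2\<pi>t)\<close> falls by \<open>2\<close> and then rises by \<open>2\<close>. The sharp total
  variation \<open>4\<close> is needed, since it is the leading term of the perimeter of a long ellipse.\<close>

lemma cos_variation_function:
  fixes s t :: real
  defines "M \<equiv> \<lambda>t. if t \<le> 1/2 then 1 - cos (2 * pi * t) else 3 + cos (2 * pi * t)"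
  assumes "0 \<le> s" "s \<le> t" "t \<le> 1"
  shows "\<bar>cos (2 * pi * t) - cos (2 * pi * s)\<bar> \<le> M t - M s"
proof -
  have 1: "cos (2 * pi * t) \<le> cos (2 * pi * s)" if "0 \<le> s" "s \<le> t" "t \<le> 1/2" for s t :: real
    using that mult_left_mono[of t "1/2" "2*pi"] by (intro cos_monotone_0_pi_le) auto
  have 2: "cos (2 * pi * s) \<le> cos (2 * pi * t)" if "1/2 \<le> s" "s \<le> t" "t \<le> 1" for s t :: real
    using 1[of "1 - t" "1 - s"] that by (simp add: algebra_simps cos_diff)
  show ?thesis
    using 1[of s t] 2[of s t] assms(2-)
      cos_le_one[of "2 * pi * s"] cos_ge_minus_one[of "2 * pi * s"]
      cos_le_one[of "2 * pi * t"] cos_ge_minus_one[of "2 * pi * t"]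
    unfolding M_def by (cases "t \<le> 1/2"; cases "s \<le> 1/2"; simp only: if_True if_False) linarith+
qed

lemma abs_sin_diff_le: "\<bar>sin x - sin y\<bar> \<le> \<bar>x - y\<bar>" for x y :: real
proof -
  have "\<bar>sin x - sin y\<bar> = 2 * \<bar>sin ((x - y) / 2)\<bar> * \<bar>cos ((x + y) / 2)\<bar>"
    by (simp add: sin_diff_sin abs_mult)
  also have "\<dots> \<le> 2 * \<bar>(x - y) / 2\<bar> * 1"
    by (intro mult_mono abs_sin_x_le_abs_x) auto
  finally show ?thesis by simp
qed

text \<open>The leading term is four times the major semi-axis; the contribution of the minor axis is
  bounded crudely, as it does not grow with \<open>N\<close>.\<close>

lemma path_length_tilted_circle:
  "path_length (boundary_curve (graph_map (\<lambda>z. N * Re z))) \<le> ereal (4 * sqrt (1 + N\<^sup>2) + 2 * pi)"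
  unfolding path_length_def
proof (rule SUP_least, clarify)
  fix n :: nat and t :: "nat \<Rightarrow> real" assume t: "mono t" "range t \<subseteq> {0..1}"
  let ?g = "boundary_curve (graph_map (\<lambda>z. N * Re z))"
  define s where "s = sqrt (1 + N\<^sup>2)"
  define M where "M = (\<lambda>t. if t \<le> 1/2 then 1 - cos (2 * pi * t) else 3 + cos (2 * pi * t))"
  have t01: "t i \<in> {0..1}" for i using t(2) by (rule subsetD) simp
  have M: "0 \<le> M x" "M x \<le> 4" for x
    using cos_le_one[of "2 * pi * x"] cos_ge_minus_one[of "2 * pi * x"]
    unfolding M_def by (cases "x \<le> 1/2"; simp only: if_True if_False; linarith)+
  have "dist (?g (t i)) (?g (t (Suc i))) \<le>
      s * (M (t (Suc i)) - M (t i)) + 2 * pi * (t (Suc i) - t i)" for i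
  proof -
    have le: "t i \<le> t (Suc i)" using t(1) by (simp add: monoD)
    let ?d = "cis (2 * pi * t (Suc i)) - cis (2 * pi * t i)"
    have "dist (?g (t i)) (?g (t (Suc i))) = norm (graph_map (\<lambda>z. N * Re z) ?d)"
      by (simp add: dist_commute dist_norm boundary_curve_def linear_diff
          bounded_linear.linear[OF bounded_linear_graph_map] norm_minus_commute)
    also have "\<dots> \<le> s * \<bar>Re ?d\<bar> + \<bar>Im ?d\<bar>"
      unfolding s_def by (rule norm_tilted_plane)
    also have "\<bar>Re ?d\<bar> \<le> M (t (Suc i)) - M (t i)"
      using cos_variation_function[of "t i" "t (Suc i)"] le t01 unfolding M_def by simp
    also have "\<bar>Im ?d\<bar> \<le> \<bar>2 * pi * t (Suc i) - 2 * pi * t i\<bar>"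
      by (simp add: abs_sin_diff_le)
    also have "\<dots> = 2 * pi * (t (Suc i) - t i)"
      using le by (simp add: abs_mult flip: right_diff_distrib)
    finally show ?thesis by (simp add: s_def mult_left_mono)
  qed
  then have "(\<Sum>i<n. dist (?g (t i)) (?g (t (Suc i)))) \<le>
     (\<Sum>i<n. s * (M (t (Suc i)) - M (t i)) + 2 * pi * (t (Suc i) - t i))"
    by (intro sum_mono)
  also have "\<dots> = s * (M (t n) - M (t 0)) + 2 * pi * (t n - t 0)"
    by (simp add: sum.distrib flip: sum_distrib_left) (simp add: sum_lessThan_telescope[of "\<lambda>i. M (t i)"] sum_lessThan_telescope[of t])
  also have "\<dots> \<le> s * 4 + 2 * pi * 1"
    using M[of "t n"] M[of "t 0"] t01[of n] t01[of 0]
    by (intro add_mono mult_left_mono) (auto simp: s_def)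
  finally show "ereal (\<Sum>i<n. dist (?g (t i)) (?g (t (Suc i)))) \<le> ereal (4 * sqrt (1 + N\<^sup>2) + 2 * pi)"
    by (simp add: s_def mult.commute)
qed

lemma tilted_disc_harmonic: "simply_connected_harmonic_surface (graph_map (\<lambda>z. N * Re z))"
  and tilted_disc_minimal: "minimal_graph_over_disk (open_surface (graph_map (\<lambda>z. N * Re z)))"
proof -
  let ?L = "graph_map (\<lambda>z. N * Re z)"
  have inj: "inj_on ?L A" for A
    by (auto intro!: inj_onI complex_eqI simp: graph_map_def vec_eq_iff forall_3)
  have cont: "continuous_on A ?L" for A
    by (rule linear_continuous_on[OF bounded_linear_graph_map])
  obtain \<Psi> where \<Psi>: "homeomorphism (cball 0 1) (?L ` cball 0 1) ?L \<Psi>"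
    using homeomorphism_compact[OF compact_cball cont refl inj] by blast
  have j: "jordan_surface ?L"
    unfolding jordan_surface_def using \<Psi> by blast
  have "homeomorphism (ball 0 1) (open_surface ?L) ?L \<Psi>"
    unfolding open_surface_def
    by (rule homeomorphism_of_subsets[OF \<Psi>]) (use ball_subset_cball in auto)
  moreover have "harmonic_on (\<lambda>z. ?L z $ i) (ball 0 1)" for i
    using bounded_linear_compose[OF bounded_linear_vec_nth bounded_linear_graph_map]
    by (intro harmonic_on_linear) auto
  ultimately show "simply_connected_harmonic_surface ?L"
    unfolding simply_connected_harmonic_surface_def using j by blast
  have p: "partial_x ?L = (\<lambda>z. ?L 1)" "partial_y ?L = (\<lambda>z. ?L \<i>)"
    using partial_linear[OF bounded_linear_graph_map] by auto
  have "minimal_immersion_on ?L (ball 0 1)"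
    unfolding minimal_immersion_on_def
    using C2_on_linear[OF bounded_linear_graph_map]
    by (auto simp: p mean_curvature_def cross3_def graph_map_def vec_eq_iff forall_3)
  then show "minimal_graph_over_disk (open_surface ?L)"
    unfolding minimal_graph_over_disk_def open_surface_def by blast
qed

lemma tilted_disc_diameter:
  assumes "0 \<le> r" "r < 1"
  shows "ereal (2 * r * sqrt (1 + N\<^sup>2)) \<le> geodesic_diameter (open_surface (graph_map (\<lambda>z. N * Re z)))"
proof -
  let ?L = "graph_map (\<lambda>z. N * Re z)"
  have "2 * r * sqrt (1 + N\<^sup>2) \<le> norm (?L (of_real (2 * r)))"
    using norm_tilted_plane(2)[where z = "of_real (2 * r)" and N = N] assms by (simp add: mult.commute)
  also have "?L (of_real (2 * r)) = ?L (of_real r) - ?L (- of_real r)"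
    using linear_diff[OF bounded_linear.linear[OF bounded_linear_graph_map], of N "of_real r" "- of_real r"]
    by simp
  also have "norm \<dots> = dist (?L (of_real r)) (?L (- of_real r))"
    by (simp add: dist_norm)
  finally have "ereal (2 * r * sqrt (1 + N\<^sup>2)) \<le> ereal (dist (?L (of_real r)) (?L (- of_real r)))" by simp
  also have "\<dots> \<le> geodesic_diameter (open_surface ?L)"
    using assms by (intro dist_le_geodesic_diameter) (auto simp: open_surface_def)
  finally show ?thesis .
qed

theorem half_is_sharp:
  assumes "c < 1/2"
  shows "\<exists>\<Phi> :: complex \<Rightarrow> real ^ 3.
     simply_connected_harmonic_surface \<Phi> \<and> rectifiable (boundary_curve \<Phi>) \<and>
     minimal_graph_over_disk (open_surface \<Phi>) \<and>
     geodesic_diameter (open_surface \<Phi>) > ereal c * path_length (boundary_curve \<Phi>)"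
proof -
  \<comment> \<open>Negative \<open>c\<close> would spoil the monotonicity in the estimate of the length.\<close>
  define b where "b = max c 0"
  have b: "0 \<le> b" "b < 1/2" "c \<le> b" using assms by (auto simp: b_def)
  \<comment> \<open>Points \<open>\<plusminus>(b + 1/2)\<close> of the major axis have distance \<open>(2 b + 1) s\<close>, which has to exceed
    \<open>b (4 s + 2 pi)\<close>; this holds as soon as \<open>s (1 - 2 b) \<ge> 8\<close>.\<close>
  define N where "N = 8 / (1 - 2 * b)"
  let ?L = "graph_map (\<lambda>z. N * Re z)"
  define s where "s = sqrt (1 + N\<^sup>2)"
  have Npos: "0 < N" using b by (simp add: N_def)
  have "N \<le> s" unfolding s_def by (rule real_le_rsqrt) simp
  then have sN: "8 \<le> s * (1 - 2 * b)" using b by (simp add: N_def divide_simps mult.commute)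
  obtain p where p: "path_length (boundary_curve ?L) = ereal p" "0 \<le> p" "p \<le> 4 * s + 2 * pi"
    using path_length_tilted_circle[of N] path_length_nonneg[of "boundary_curve ?L"]
    by (cases "path_length (boundary_curve ?L)") (auto simp: s_def)
  have "c * p \<le> b * (4 * s + 2 * pi)"
    using b p by (intro mult_mono) (auto simp: b_def)
  also have "\<dots> \<le> 4 * b * s + pi" using b by (simp add: algebra_simps)
  also have "\<dots> < 2 * (b + 1/2) * s"
    using sN pi_less_4 by (simp add: algebra_simps)
  finally have "ereal c * path_length (boundary_curve ?L) < ereal (2 * (b + 1/2) * s)"
    by (simp add: p(1))
  also have "\<dots> \<le> geodesic_diameter (open_surface ?L)"
    unfolding s_def using b by (intro tilted_disc_diameter) auto
  finally have "ereal c * path_length (boundary_curve ?L) < geodesic_diameter (open_surface ?L)" .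
  moreover have "rectifiable (boundary_curve ?L)" by (simp add: rectifiable_def p(1))
  ultimately show ?thesis using tilted_disc_harmonic tilted_disc_minimal by blast
qed

theorem theorem3p10:
  shows "(\<forall>\<Phi> :: complex \<Rightarrow> real ^ 'n.
            simply_connected_harmonic_surface \<Phi> \<and> rectifiable (boundary_curve \<Phi>) \<longrightarrow>
            geodesic_diameter (open_surface \<Phi>) \<le> ereal (1/2) * path_length (boundary_curve \<Phi>)) \<and>
         (\<forall>c::real. c < 1/2 \<longrightarrow>
            (\<exists>\<Phi> :: complex \<Rightarrow> real ^ 3.
               simply_connected_harmonic_surface \<Phi> \<and> rectifiable (boundary_curve \<Phi>) \<and>
               minimal_graph_over_disk (open_surface \<Phi>) \<and>
               geodesic_diameter (open_surface \<Phi>) > ereal c * path_length (boundary_curve \<Phi>)))"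
  using geodesic_diameter_le_half_boundary half_is_sharp by blast

end
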